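(* Let $X$ be a p.c.f. self-similar set with self-similar energy $\mathcal{E}$, self-similar measure $\mu$ and associated Laplacian $\Delta$, as in the context. Let $\lambda\in\mathbb{C}$ be such that none of the numbers $r_w\mu_w\lambda$, $w\in W_*$, is a Dirichlet eigenvalue of $\Delta$, and such that $\lambda$ is not a Neumann eigenvalue of $\Delta$. Let $G^{(\lambda)}(x,y)$ be the Dirichlet resolvent kernel, for $p\in V_0$ let $\eta^{(\lambda)}_p$ be the solution of $(\lambda\,\mathrm{id}-\Delta)\eta^{(\lambda)}_p=0$ on $X$ with $\eta^{(\lambda)}_p(q)=\delta_{pq}$ for $q\in V_0$, and let $[C^{(\lambda)}_{pq}]_{p,q\in V_0}$ be the symmetric matrix with $\sum_{q\in V_0}C^{(\lambda)}_{pq}\,\partial_n\eta^{(\lambda)}_q(x)=\delta_{px}$ for all $p,x\in V_0$. Then $$G^{(\lambda)}_N(x,y)=G^{(\lambda)}(x,y)+\sum_{p,q\in V_0}C^{(\lambda)}_{pq}\,\eta^{(\lambda)}_p(x)\,\eta^{(\lambda)}_q(y)$$ is symmetric, is (as a function of $y$) in $\mathrm{dom}_{\mathcal M}(\Delta_y)$, and satisfies $(\lambda-\Delta_y)G^{(\lambda)}_N(x,y)=\delta_x(y)$ on $X\setminus V_0$. It has (with respect to $y$) vanishing normal derivatives on $V_0$ and is therefore the Neumann resolvent kernel of the Laplacian.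
   Context: Self-similar set. $F_1,\dots,F_J$ are injective contractions of $\mathbb{R}^d$ (Lipschitz constants in $(0,1)$) and $X$ is the unique nonempty compact set with $X=\bigcup_j F_j(X)$. For a word $w=w_1\cdots w_m$ on $\{1,\dots,J\}$, $|w|=m$, $F_w=F_{w_1}\circ\cdots\circ F_{w_m}$, and $K_w=F_w(X)$ is an $m$-cell; $W_*=\bigcup_{m\ge0}\{1,\dots,J\}^m$ (the empty word has $F_\emptyset=\mathrm{id}$). $X$ is post-critically finite (p.c.f.): its boundary $V_0$ is a finite set of fixed points of the maps $F_j$ such that $F_w(X)\cap F_{w'}(X)\subseteq F_w(V_0)\cap F_{w'}(V_0)$ for distinct words $w,w'$ of equal length. $V_m=\bigcup_{|w|=m}F_w(V_0)$. $\sum_{K_j\ni q}$ means the sum over $\{j: q\in F_j(X)\}$. Energy. It is assumed that there is a self-similar energy: conductances $c_{xy}=c_{yx}$ on $V_0$ and factors $r_1,\dots,r_J\in(0,1)$ such that, with $\mathcal{E}_0(u,v)=\frac12\sum_{x,y\in V_0}c_{xy}(u(x)-u(y))(v(x)-v(y))$ and $\mathcal{E}_m(u,v)=\sum_{|w|=m}r_w^{-1}\mathcal{E}_0(u\circ F_w,v\circ F_w)$, $\mathcal{E}_0(u)$ is the minimum of $\mathcal{E}_1$ over extensions of $u$ from $V_0$ to $V_1$; $\mathcal{E}=\lim_m\mathcal{E}_m$ is a Dirichlet form with $\mathcal{E}(u)=\sum_j r_j^{-1}\mathcal{E}(u\circ F_j)$, vanishing only on constants, $\mathrm{dom}\,\mathcal{E}=\{u:\mathcal{E}(u)<\infty\}$,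 and $\mathrm{dom}_0\,\mathcal{E}$ is the set of $u\in\mathrm{dom}\,\mathcal{E}$ vanishing on $V_0$. Here $r_w=r_{w_1}\cdots r_{w_m}$, $r_\emptyset=1$. Measure. $\mu$ is the self-similar probability measure with weights $\mu_j\in(0,1)$, $\sum_j\mu_j=1$: $\mu(A)=\sum_j\mu_j\mu(F_j^{-1}A)$; $\mu_w=\mu_{w_1}\cdots\mu_{w_m}$, $\mu_\emptyset=1$. Laplacian. For $u\in\mathrm{dom}\,\mathcal{E}$ and $f$ continuous (resp. $f\in L^2(\mu)$), $u\in\mathrm{dom}\,\Delta$ (resp. $\mathrm{dom}_{L^2}\Delta$) with $\Delta u=f$ iff $\mathcal{E}(u,v)=-\int_X fv\,d\mu$ for all $v\in\mathrm{dom}_0\,\mathcal{E}$. More generally $u\in\mathrm{dom}_{\mathcal M}\Delta$ with $\Delta u=\nu$, $\nu$ a finite signed (or complex) Borel measure, iff $\mathcal{E}(u,v)=-\int_X v\,d\nu$ for all $v\in\mathrm{dom}_0\,\mathcal{E}$ (so $\nu$ matters only on $X\setminus V_0$); functions $f$ are identified with measures $f\mu$. $\Delta_y$ means $\Delta$ applied in the variable $y$; $\delta_x$ with one index is the Dirac mass at $x$ and $\delta_{pq}$ is the Kronecker delta. An equation $\Delta u=f$ "on the cell $K_w$" means $\Delta(u\circ F_w)=r_w\mu_w\, f\circ F_w$ on $X$. Functions may be complex-valued, with $\mathcal{E}$ extended bilinearly. Normal derivatives. For $q\in V_0$ the fixed point of $F_i$, $\partial_nu(q)=\lim_{m\to\infty}r_i^{-m}\sum_{q'\in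 V_0}c_{qq'}\big(u(q)-u(F_i^mq')\big)$. At $x=F_wq$, $q\in V_0$, the normal derivative with respect to the cell $K_w$ is $\partial_n^{K_w}u(x)=r_w^{-1}\,\partial_n(u\circ F_w)(q)$. Eigenvalues. $\lambda$ is a Dirichlet (resp. Neumann) eigenvalue of $\Delta$ if there is a nonzero $u\in\mathrm{dom}\,\Delta$ with $\Delta u=\lambda u$ and $u=0$ (resp. $\partial_nu=0$) on $V_0$. Dirichlet resolvent kernel. For $p\in V_1\setminus V_0$, $\psi^{(\lambda)}_p$ is the solution of $(\lambda\,\mathrm{id}-\Delta)\psi^{(\lambda)}_p=0$ on each $F_j(X)$ with $\psi^{(\lambda)}_p(q)=\delta_{pq}$ for $q\in V_1$; $B^{(\lambda)}_{pq}=\sum_{K_j\ni q}\partial_n^{K_j}\psi^{(\lambda)}_p(q)$ for $p,q\in V_1\setminus V_0$; $[G^{(\lambda)}_{pq}]$ is the inverse matrix of $[B^{(\lambda)}_{pq}]$; $\Psi^{(\lambda)}(x,y)=\sum_{p,q\in V_1\setminus V_0}G^{(\lambda)}_{pq}\psi^{(\lambda)}_p(x)\psi^{(\lambda)}_q(y)$; and $G^{(\lambda)}(x,y)=\sum_{w\in W_*}r_w\Psi^{(r_w\mu_w\lambda)}(F_w^{-1}x,F_w^{-1}y)$, with terms taken to be $0$ unless $x,y\in F_w(X)$. It is the kernel of $(\lambda\,\mathrm{id}-\Delta)^{-1}$ with Dirichlet boundary conditions. The matrix $C^{(\lambda)}$ exists and is symmetric: it is the inverse of the symmetric matrix $[\partial_n\eta^{(\lambda)}_p(q)]_{p,q\in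 V_0}$, which is invertible when $\lambda$ is neither a Dirichlet nor a Neumann eigenvalue. The Neumann resolvent kernel is the kernel $G_N^{(\lambda)}$ such that $u(x)=\int_XG^{(\lambda)}_N(x,y)f(y)\,d\mu(y)$ solves $(\lambda\,\mathrm{id}-\Delta)u=f$ with $\partial_nu=0$ on $V_0$.
   Formalization: Added: distinct cells of equal length do not meet in V_0, and E_0 (not only the energy E) vanishes only on constants; vanishing normal derivatives are claimed for x in X∖V_0 only, since for x in V_0 the normal derivative at x is 1. *)

theory Defs
  imports "HOL-Probability.Probability_Measure"
begin

section \<open>Self-similar sets\<close>

text \<open>Functions on the self-similar set are modelled as functions on the ambient Euclidean space;
  only their values on \<open>fractal S\<close> are ever used. The letters are \<open>1, \<dots>, nmaps S\<close>.\<close>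

record 'a pcf_data =
  nmaps :: nat
  ssmap :: "nat \<Rightarrow> 'a \<Rightarrow> 'a"
  fractal :: "'a set"
  bdry :: "'a set"
  conductance :: "'a \<Rightarrow> 'a \<Rightarrow> real"
  rfactor :: "nat \<Rightarrow> real"
  weight :: "nat \<Rightarrow> real"
  ssmeasure :: "'a measure"

definition letters :: "'a::euclidean_space pcf_data \<Rightarrow> nat set" where
  "letters S = {1..nmaps S}"

definition words :: "'a::euclidean_space pcf_data \<Rightarrow> nat list set" where
  "words S = lists (letters S)"

definition words_len :: "'a::euclidean_space pcf_data \<Rightarrow> nat \<Rightarrow> nat list set" where
  "words_len S m = {w \<in> words S. length w = m}"

definition wmap :: "'a::euclidean_space pcf_data \<Rightarrow> nat list \<Rightarrow> 'a \<Rightarrow> 'a" where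
  "wmap S w = foldr (\<lambda>j g. ssmap S j \<circ> g) w id"

definition cell :: "'a::euclidean_space pcf_data \<Rightarrow> nat list \<Rightarrow> 'a set" where
  "cell S w = wmap S w ` fractal S"

definition rword :: "'a::euclidean_space pcf_data \<Rightarrow> nat list \<Rightarrow> real" where
  "rword S w = prod_list (map (rfactor S) w)"

definition muword :: "'a::euclidean_space pcf_data \<Rightarrow> nat list \<Rightarrow> real" where
  "muword S w = prod_list (map (weight S) w)"

definition Vset :: "'a::euclidean_space pcf_data \<Rightarrow> nat \<Rightarrow> 'a set" where
  "Vset S m = (\<Union>w\<in>words_len S m. wmap S w ` bdry S)"

definition contraction :: "('a::euclidean_space \<Rightarrow> 'a) \<Rightarrow> bool" where
  "contraction f \<longleftrightarrow> (\<exists>L. 0 < L \<and> L < 1 \<and> L-lipschitz_on UNIV f)"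

definition self_similar_set :: "'a::euclidean_space pcf_data \<Rightarrow> bool" where
  "self_similar_set S \<longleftrightarrow>
     (\<forall>j\<in>letters S. inj (ssmap S j) \<and> contraction (ssmap S j)) \<and>
     fractal S \<noteq> {} \<and> compact (fractal S) \<and>
     fractal S = (\<Union>j\<in>letters S. ssmap S j ` fractal S)"

text \<open>The last conjunct (cells of equal length do not meet at boundary points) is the usual clause
  "with the intersection disjoint from \<open>V\<^sub>0\<close>" of the definition of a p.c.f. set. It says that
  a boundary point \<open>q\<close>, fixed by \<open>F\<^sub>i\<close>, lies in no \<open>m\<close>-cell other than \<open>F\<^sub>i\<^sup>m(X)\<close>; the formula for
  the normal derivative at \<open>q\<close> (a limit along these cells alone) presupposes it, both for the
  index \<open>i\<close> to be determined by \<open>q\<close> and for the Gauss-Green formula to hold.\<close>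

definition post_critically_finite :: "'a::euclidean_space pcf_data \<Rightarrow> bool" where
  "post_critically_finite S \<longleftrightarrow>
     finite (bdry S) \<and>
     (\<forall>q\<in>bdry S. \<exists>i\<in>letters S. ssmap S i q = q) \<and>
     (\<forall>m. \<forall>w\<in>words_len S m. \<forall>w'\<in>words_len S m. w \<noteq> w' \<longrightarrow>
        cell S w \<inter> cell S w' \<subseteq> wmap S w ` bdry S \<inter> wmap S w' ` bdry S) \<and>
     (\<forall>m. \<forall>w\<in>words_len S m. \<forall>w'\<in>words_len S m. w \<noteq> w' \<longrightarrow>
        cell S w \<inter> cell S w' \<inter> bdry S = {})"

section \<open>Self-similar measure\<close>

definition self_similar_measure :: "'a::euclidean_space pcf_data \<Rightarrow> bool" where
  "self_similar_measure S \<longleftrightarrow>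
     (\<forall>j\<in>letters S. 0 < weight S j \<and> weight S j < 1) \<and>
     (\<Sum>j\<in>letters S. weight S j) = 1 \<and>
     sets (ssmeasure S) = sets (restrict_space borel (fractal S)) \<and>
     prob_space (ssmeasure S) \<and>
     (\<forall>A\<in>sets (ssmeasure S). measure (ssmeasure S) A =
        (\<Sum>j\<in>letters S. weight S j * measure (ssmeasure S) (ssmap S j -` A \<inter> fractal S)))"

section \<open>Self-similar energy\<close>

definition energy0 :: "'a::euclidean_space pcf_data \<Rightarrow> ('a \<Rightarrow> real) \<Rightarrow> ('a \<Rightarrow> real) \<Rightarrow> real" where
  "energy0 S u v =
     (1/2) * (\<Sum>x\<in>bdry S. \<Sum>y\<in>bdry S. conductance S x y * (u x - u y) * (v x - v y))"

definition energy_level ::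
    "'a::euclidean_space pcf_data \<Rightarrow> nat \<Rightarrow> ('a \<Rightarrow> real) \<Rightarrow> ('a \<Rightarrow> real) \<Rightarrow> real" where
  "energy_level S m u v =
     (\<Sum>w\<in>words_len S m. inverse (rword S w) * energy0 S (u \<circ> wmap S w) (v \<circ> wmap S w))"

text \<open>\<open>energy_level S m u u\<close> only sees the values on \<open>V\<^sub>m\<close>; as usual, the domain consists of
  continuous functions on the fractal. The sequence \<open>energy_level S m u u\<close> is increasing in \<open>m\<close>,
  so that convergence means that the limit is finite.\<close>

definition dom_energy :: "'a::euclidean_space pcf_data \<Rightarrow> ('a \<Rightarrow> real) set" where
  "dom_energy S = {u. continuous_on (fractal S) u \<and> convergent (\<lambda>m. energy_level S m u u)}"

definition energy :: "'a::euclidean_space pcf_data \<Rightarrow> ('a \<Rightarrow> real) \<Rightarrow> ('a \<Rightarrow> real) \<Rightarrow> real" where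
  "energy S u v = lim (\<lambda>m. energy_level S m u v)"

definition dirichlet_form ::
    "'a measure \<Rightarrow> ('a \<Rightarrow> real) set \<Rightarrow> (('a \<Rightarrow> real) \<Rightarrow> ('a \<Rightarrow> real) \<Rightarrow> real) \<Rightarrow> bool" where
  "dirichlet_form M D Q \<longleftrightarrow>
     \<comment> \<open>a dense subspace of real \<open>L\<^sup>2(M)\<close>\<close>
     (\<forall>u\<in>D. u \<in> borel_measurable M \<and> integrable M (\<lambda>x. (u x)\<^sup>2)) \<and>
     (\<lambda>x. 0) \<in> D \<and>
     (\<forall>u\<in>D. \<forall>v\<in>D. \<forall>a b. (\<lambda>x. a * u x + b * v x) \<in> D) \<and>
     (\<forall>f e. f \<in> borel_measurable M \<and> integrable M (\<lambda>x. (f x)\<^sup>2) \<and> e > 0 \<longrightarrow>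
        (\<exists>u\<in>D. (\<integral>x. (f x - u x)\<^sup>2 \<partial>M) < e)) \<and>
     \<comment> \<open>a nonnegative symmetric bilinear form\<close>
     (\<forall>u\<in>D. \<forall>v\<in>D. \<forall>g\<in>D. \<forall>a b. Q (\<lambda>x. a * u x + b * v x) g = a * Q u g + b * Q v g) \<and>
     (\<forall>u\<in>D. \<forall>v\<in>D. Q u v = Q v u) \<and>
     (\<forall>u\<in>D. 0 \<le> Q u u) \<and>
     \<comment> \<open>closed\<close>
     (\<forall>us. (\<forall>n. us n \<in> D) \<and>
        (\<forall>e>0. \<exists>N. \<forall>m\<ge>N. \<forall>n\<ge>N.
           Q (\<lambda>x. us m x - us n x) (\<lambda>x. us m x - us n x)
             + (\<integral>x. (us m x - us n x)\<^sup>2 \<partial>M) < e) \<longrightarrow>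
        (\<exists>u\<in>D. (\<lambda>n. Q (\<lambda>x. us n x - u x) (\<lambda>x. us n x - u x)
             + (\<integral>x. (us n x - u x)\<^sup>2 \<partial>M)) \<longlonglongrightarrow> 0)) \<and>
     \<comment> \<open>Markovian\<close>
     (\<forall>u\<in>D. (\<lambda>x. min 1 (max 0 (u x))) \<in> D \<and>
        Q (\<lambda>x. min 1 (max 0 (u x))) (\<lambda>x. min 1 (max 0 (u x))) \<le> Q u u)"

text \<open>"Vanishing only on constants" is required of the energy as well as of its restriction
  \<open>energy0\<close> to the boundary, i.e. the network of conductances on \<open>V\<^sub>0\<close> is connected.\<close>

definition self_similar_energy :: "'a::euclidean_space pcf_data \<Rightarrow> bool" where
  "self_similar_energy S \<longleftrightarrow>
     (\<forall>x\<in>bdry S. \<forall>y\<in>bdry S.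
        0 \<le> conductance S x y \<and> conductance S x y = conductance S y x) \<and>
     (\<forall>j\<in>letters S. 0 < rfactor S j \<and> rfactor S j < 1) \<and>
     (\<forall>u. (\<exists>v. (\<forall>x\<in>bdry S. v x = u x) \<and> energy_level S 1 v v = energy0 S u u) \<and>
          (\<forall>v. (\<forall>x\<in>bdry S. v x = u x) \<longrightarrow> energy0 S u u \<le> energy_level S 1 v v)) \<and>
     (\<forall>u. energy0 S u u = 0 \<longrightarrow> (\<exists>k. \<forall>x\<in>bdry S. u x = k)) \<and>
     dirichlet_form (ssmeasure S) (dom_energy S) (energy S) \<and>
     (\<forall>u\<in>dom_energy S. (\<forall>j\<in>letters S. u \<circ> ssmap S j \<in> dom_energy S) \<and>
        energy S u u =
          (\<Sum>j\<in>letters S. inverse (rfactor S j) * energy S (u \<circ> ssmap S j) (u \<circ> ssmap S j))) \<and>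
     (\<forall>u\<in>dom_energy S. energy S u u = 0 \<longleftrightarrow> (\<exists>k. \<forall>x\<in>fractal S. u x = k))"

text \<open>Complex-valued functions: the bilinear (not sesquilinear) extension.\<close>

definition cdom_energy :: "'a::euclidean_space pcf_data \<Rightarrow> ('a \<Rightarrow> complex) set" where
  "cdom_energy S = {u. (\<lambda>x. Re (u x)) \<in> dom_energy S \<and> (\<lambda>x. Im (u x)) \<in> dom_energy S}"

definition cdom0_energy :: "'a::euclidean_space pcf_data \<Rightarrow> ('a \<Rightarrow> complex) set" where
  "cdom0_energy S = {u \<in> cdom_energy S. \<forall>q\<in>bdry S. u q = 0}"

definition cenergy ::
    "'a::euclidean_space pcf_data \<Rightarrow> ('a \<Rightarrow> complex) \<Rightarrow> ('a \<Rightarrow> complex) \<Rightarrow> complex" where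
  "cenergy S u v = Complex
     (energy S (\<lambda>x. Re (u x)) (\<lambda>x. Re (v x)) - energy S (\<lambda>x. Im (u x)) (\<lambda>x. Im (v x)))
     (energy S (\<lambda>x. Re (u x)) (\<lambda>x. Im (v x)) + energy S (\<lambda>x. Im (u x)) (\<lambda>x. Re (v x)))"

section \<open>Laplacian\<close>

text \<open>\<open>has_laplacian S u f\<close> stands for \<open>u \<in> dom \<Delta>\<close> and \<open>\<Delta>u = f\<close>; similarly for the \<open>L\<^sup>2\<close> and
  the measure-valued versions below.\<close>

definition weak_laplacian ::
    "'a::euclidean_space pcf_data \<Rightarrow> ('a \<Rightarrow> complex) \<Rightarrow> ('a \<Rightarrow> complex) \<Rightarrow> bool" where
  "weak_laplacian S u f \<longleftrightarrow> u \<in> cdom_energy S \<and>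
     (\<forall>v\<in>cdom0_energy S. cenergy S u v = - (\<integral>x. f x * v x \<partial>ssmeasure S))"

definition has_laplacian ::
    "'a::euclidean_space pcf_data \<Rightarrow> ('a \<Rightarrow> complex) \<Rightarrow> ('a \<Rightarrow> complex) \<Rightarrow> bool" where
  "has_laplacian S u f \<longleftrightarrow> continuous_on (fractal S) f \<and> weak_laplacian S u f"

definition square_integrable :: "'a measure \<Rightarrow> ('a \<Rightarrow> complex) \<Rightarrow> bool" where
  "square_integrable M f \<longleftrightarrow> f \<in> borel_measurable M \<and> integrable M (\<lambda>x. (cmod (f x))\<^sup>2)"

definition has_L2_laplacian ::
    "'a::euclidean_space pcf_data \<Rightarrow> ('a \<Rightarrow> complex) \<Rightarrow> ('a \<Rightarrow> complex) \<Rightarrow> bool" where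
  "has_L2_laplacian S u f \<longleftrightarrow> square_integrable (ssmeasure S) f \<and> weak_laplacian S u f"

text \<open>A complex Borel measure on \<open>X\<close> is a countably additive complex set function on the Borel
  subsets of \<open>X\<close>. Its integral is taken by writing it as \<open>h M\<close> with a finite positive measure \<open>M\<close>
  (e.g. the total variation) and an integrable density \<open>h\<close>; the value does not depend on the
  choice of \<open>M\<close> and \<open>h\<close>.\<close>

definition complex_measure_on :: "'a::euclidean_space set \<Rightarrow> ('a set \<Rightarrow> complex) \<Rightarrow> bool" where
  "complex_measure_on X \<nu> \<longleftrightarrow>
     (\<forall>A::nat \<Rightarrow> 'a set. range A \<subseteq> sets (restrict_space borel X) \<and> disjoint_family A \<longrightarrow>
        (\<lambda>n. \<nu> (A n)) sums \<nu> (\<Union>n. A n))"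

definition has_complex_measure_integral ::
    "'a::euclidean_space set \<Rightarrow> ('a set \<Rightarrow> complex) \<Rightarrow> ('a \<Rightarrow> complex) \<Rightarrow> complex \<Rightarrow> bool" where
  "has_complex_measure_integral X \<nu> v I \<longleftrightarrow>
     (\<exists>M h. finite_measure M \<and> sets M = sets (restrict_space borel X) \<and>
        integrable M h \<and> (\<forall>A\<in>sets M. \<nu> A = (LINT y:A|M. h y)) \<and>
        integrable M (\<lambda>y. v y * h y) \<and> I = (\<integral>y. v y * h y \<partial>M))"

definition has_measure_laplacian ::
    "'a::euclidean_space pcf_data \<Rightarrow> ('a \<Rightarrow> complex) \<Rightarrow> ('a set \<Rightarrow> complex) \<Rightarrow> bool" where
  "has_measure_laplacian S u \<nu> \<longleftrightarrow>
     u \<in> cdom_energy S \<and> complex_measure_on (fractal S) \<nu> \<and>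
     (\<forall>v\<in>cdom0_energy S. has_complex_measure_integral (fractal S) \<nu> v (- cenergy S u v))"

text \<open>\<open>\<Delta>u = f\<close> on the cell \<open>K\<^sub>w\<close>.\<close>

definition has_laplacian_on_cell ::
    "'a::euclidean_space pcf_data \<Rightarrow> nat list \<Rightarrow> ('a \<Rightarrow> complex) \<Rightarrow> ('a \<Rightarrow> complex) \<Rightarrow> bool" where
  "has_laplacian_on_cell S w u f \<longleftrightarrow>
     has_laplacian S (u \<circ> wmap S w)
       (\<lambda>x. complex_of_real (rword S w * muword S w) * f (wmap S w x))"

section \<open>Normal derivatives and eigenvalues\<close>

definition fixing_letter :: "'a::euclidean_space pcf_data \<Rightarrow> 'a \<Rightarrow> nat" where
  "fixing_letter S q = (THE i. i \<in> letters S \<and> ssmap S i q = q)"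

definition discrete_normal_derivative ::
    "'a::euclidean_space pcf_data \<Rightarrow> ('a \<Rightarrow> complex) \<Rightarrow> 'a \<Rightarrow> nat \<Rightarrow> complex" where
  "discrete_normal_derivative S u q m =
     complex_of_real (inverse (rfactor S (fixing_letter S q) ^ m)) *
     (\<Sum>q'\<in>bdry S. complex_of_real (conductance S q q') *
        (u q - u ((ssmap S (fixing_letter S q) ^^ m) q')))"

definition has_normal_derivative ::
    "'a::euclidean_space pcf_data \<Rightarrow> ('a \<Rightarrow> complex) \<Rightarrow> 'a \<Rightarrow> complex \<Rightarrow> bool" where
  "has_normal_derivative S u q d \<longleftrightarrow> discrete_normal_derivative S u q \<longlonglongrightarrow> d"

definition normal_derivative ::
    "'a::euclidean_space pcf_data \<Rightarrow> ('a \<Rightarrow> complex) \<Rightarrow> 'a \<Rightarrow> complex" where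
  "normal_derivative S u q = lim (discrete_normal_derivative S u q)"

definition cell_normal_derivative ::
    "'a::euclidean_space pcf_data \<Rightarrow> nat list \<Rightarrow> ('a \<Rightarrow> complex) \<Rightarrow> 'a \<Rightarrow> complex" where
  "cell_normal_derivative S w u x =
     complex_of_real (inverse (rword S w)) *
     normal_derivative S (u \<circ> wmap S w) (inv (wmap S w) x)"

definition dirichlet_eigenvalue :: "'a::euclidean_space pcf_data \<Rightarrow> complex \<Rightarrow> bool" where
  "dirichlet_eigenvalue S z \<longleftrightarrow>
     (\<exists>u. (\<exists>x\<in>fractal S. u x \<noteq> 0) \<and> has_laplacian S u (\<lambda>x. z * u x) \<and>
          (\<forall>q\<in>bdry S. u q = 0))"

definition neumann_eigenvalue :: "'a::euclidean_space pcf_data \<Rightarrow> complex \<Rightarrow> bool" where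
  "neumann_eigenvalue S z \<longleftrightarrow>
     (\<exists>u. (\<exists>x\<in>fractal S. u x \<noteq> 0) \<and> has_laplacian S u (\<lambda>x. z * u x) \<and>
          (\<forall>q\<in>bdry S. has_normal_derivative S u q 0))"

section \<open>Resolvent kernels\<close>

definition is_eta ::
    "'a::euclidean_space pcf_data \<Rightarrow> complex \<Rightarrow> 'a \<Rightarrow> ('a \<Rightarrow> complex) \<Rightarrow> bool" where
  "is_eta S z p u \<longleftrightarrow> has_laplacian S u (\<lambda>x. z * u x) \<and> (\<forall>q\<in>bdry S. u q = of_bool (p = q))"

definition is_psi ::
    "'a::euclidean_space pcf_data \<Rightarrow> complex \<Rightarrow> 'a \<Rightarrow> ('a \<Rightarrow> complex) \<Rightarrow> bool" where
  "is_psi S z p u \<longleftrightarrow>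
     (\<forall>j\<in>letters S. has_laplacian_on_cell S [j] u (\<lambda>x. z * u x)) \<and>
     (\<forall>q\<in>Vset S 1. u q = of_bool (p = q))"

text \<open>The choice only affects values off the fractal, since the solution is unique on it.\<close>

definition psi :: "'a::euclidean_space pcf_data \<Rightarrow> complex \<Rightarrow> 'a \<Rightarrow> 'a \<Rightarrow> complex" where
  "psi S z p = (SOME u. is_psi S z p u)"

definition Bmat :: "'a::euclidean_space pcf_data \<Rightarrow> complex \<Rightarrow> 'a \<Rightarrow> 'a \<Rightarrow> complex" where
  "Bmat S z p q = (\<Sum>j | j \<in> letters S \<and> q \<in> cell S [j]. cell_normal_derivative S [j] (psi S z p) q)"

definition inverse_matrix_on ::
    "'a set \<Rightarrow> ('a \<Rightarrow> 'a \<Rightarrow> complex) \<Rightarrow> ('a \<Rightarrow> 'a \<Rightarrow> complex) \<Rightarrow> bool" where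
  "inverse_matrix_on I A B \<longleftrightarrow>
     (\<forall>p\<in>I. \<forall>q\<in>I. (\<Sum>s\<in>I. A p s * B s q) = of_bool (p = q) \<and>
                   (\<Sum>s\<in>I. B p s * A s q) = of_bool (p = q))"

definition Gmat :: "'a::euclidean_space pcf_data \<Rightarrow> complex \<Rightarrow> 'a \<Rightarrow> 'a \<Rightarrow> complex" where
  "Gmat S z = (SOME A. inverse_matrix_on (Vset S 1 - bdry S) (Bmat S z) A)"

definition Psi :: "'a::euclidean_space pcf_data \<Rightarrow> complex \<Rightarrow> 'a \<Rightarrow> 'a \<Rightarrow> complex" where
  "Psi S z x y =
     (\<Sum>p\<in>Vset S 1 - bdry S. \<Sum>q\<in>Vset S 1 - bdry S. Gmat S z p q * psi S z p x * psi S z q y)"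

definition dirichlet_resolvent_kernel ::
    "'a::euclidean_space pcf_data \<Rightarrow> complex \<Rightarrow> 'a \<Rightarrow> 'a \<Rightarrow> complex" where
  "dirichlet_resolvent_kernel S z x y =
     (\<Sum>\<^sub>\<infinity>w\<in>words S.
        if x \<in> cell S w \<and> y \<in> cell S w
        then complex_of_real (rword S w) *
             Psi S (complex_of_real (rword S w * muword S w) * z)
               (inv (wmap S w) x) (inv (wmap S w) y)
        else 0)"

text \<open>\<open>(z - \<Delta>) u = f\<close> is written as \<open>\<Delta>u = z u - f\<close>. The right-hand sides are all of \<open>L\<^sup>2\<close>; for
  continuous ones the solution is required to lie in the domain of the continuous Laplacian.\<close>

definition neumann_resolvent_kernel ::
    "'a::euclidean_space pcf_data \<Rightarrow> complex \<Rightarrow> ('a \<Rightarrow> 'a \<Rightarrow> complex) \<Rightarrow> bool" where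
  "neumann_resolvent_kernel S z K \<longleftrightarrow>
     (\<forall>f u. square_integrable (ssmeasure S) f \<and>
            (\<forall>x\<in>fractal S. u x = (\<integral>y. K x y * f y \<partial>ssmeasure S)) \<longrightarrow>
        has_L2_laplacian S u (\<lambda>x. z * u x - f x) \<and>
        (continuous_on (fractal S) f \<longrightarrow> has_laplacian S u (\<lambda>x. z * u x - f x)) \<and>
        (\<forall>q\<in>bdry S. has_normal_derivative S u q 0))"

end

theory Submission
  imports Defs
begin

text \<open>
  Write \<open>E\<^sub>z(u, v) = E(u, v) + z \<integral> u v\<close>. The energy is complete on the functions vanishing on \<open>V\<^sub>0\<close> and
  controls their supremum, so for small \<open>z\<close> the equation \<open>E\<^sub>z(g, v) = \<phi>(v)\<close> is solved by the Riesz
  representation and iteration. For general \<open>z\<close> solvability passes from the parameters \<open>r\<^sub>j \<mu>\<^sub>j z\<close> to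
  \<open>z\<close>: gluing solutions on the 1-cells leaves a finite linear system on \<open>V\<^sub>1 - V\<^sub>0\<close> with matrix
  \<open>B\<^sub>p\<^sub>q = E\<^sub>z(\<psi>\<^sub>p, \<psi>\<^sub>q)\<close>, which is injective since \<open>z\<close> is no Dirichlet eigenvalue; as \<open>r\<^sub>w \<mu>\<^sub>w\<close> tends to
  \<open>0\<close>, finitely many such steps lead from small parameters to \<open>z\<close>. The gluing formula writes the
  function \<open>g\<^sub>x\<close> with \<open>E\<^sub>z(g\<^sub>x, v) = v(x)\<close> as \<open>\<Psi>(x, \<cdot>)\<close> plus rescaled functions of the same kind on the
  1-cells, and iterating it yields the series of the Dirichlet kernel, so \<open>G(x, y) = g\<^sub>x(y)\<close>.

  The normal derivative at \<open>q\<close> is the limit of energies against bump functions shrinking to \<open>q\<close>; hence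
  that of \<open>g\<^sub>x\<close> is \<open>- \<eta>\<^sub>q(x)\<close>, and the matrix \<open>C\<close> is chosen so that the added term cancels it.
\<close>

section \<open>Quadratic forms, linear systems and complex measures\<close>

text \<open>\<open>Ez z\<close> is symmetric but neither sesquilinear nor definite, so for general
  complex \<open>z\<close> no coercivity argument gives solvability; hence the descent in the
  parameter. It uses the eigenvalue hypothesis word by word, and its steps produce exactly the terms
  of the series.

  Two estimates carry the analysis. The constant \<open>K\<close> bounds oscillation by the root of
  the energy at all levels at once: moving between points of \<open>V1\<close> costs
  \<open>K * (1 - sqrt \<rho>)\<close>, passing to a 1-cell gains the factor
  \<open>sqrt \<rho>\<close>, and together this is again at most \<open>K\<close>. A finite cost on
  \<open>V1\<close> requires a connected graph there; this is not among the hypotheses and is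
  derived from the fact that only constants have zero energy. Secondly,
  \<open>cmod z * K\<^sup>2 \<le> 1/2\<close> is the threshold below which the term with
  \<open>z\<close> is at most half of the energy. There the Green functions are bounded by
  \<open>2 * K\<^sup>2\<close>, uniformly in the parameter and the source point, which makes the
  remainder of the series decay like \<open>\<rho> ^ n\<close>.\<close>

lemma quadratic_form_Cauchy_Schwarz:
  fixes a b c :: real
  assumes "\<And>t s. 0 \<le> t\<^sup>2 * a + 2 * t * s * c + s\<^sup>2 * b"
  shows "\<bar>c\<bar> \<le> sqrt a * sqrt b"
proof -
  have b: "0 \<le> b" using assms[of 0 1] by simp
  have "c\<^sup>2 \<le> a * b"
  proof (cases "b = 0")
    case True
    have "c = 0"
    proof (rule ccontr)
      assume "c \<noteq> 0"
      \<comment> \<open>For \<open>b = 0\<close> the form is affine in \<open>s\<close>; at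
        \<open>t = 1\<close> this \<open>s\<close> gives it the value -1.\<close>
      then have "2 * (- (a + 1) / (2 * c)) * c = - (a + 1)" by (simp add: field_simps)
      then show False using assms[of 1 "- (a + 1) / (2 * c)"] True by simp
    qed
    then show ?thesis using True by simp
  next
    case False
    have "0 \<le> b * (a * b - c\<^sup>2)"
      using assms[of b "- c"] by (simp add: algebra_simps power2_eq_square)
    then show ?thesis using b False by (simp add: zero_le_mult_iff)
  qed
  then have "sqrt (c\<^sup>2) \<le> sqrt (a * b)" by (rule real_sqrt_le_mono)
  then show ?thesis by (simp add: real_sqrt_mult)
qed

text \<open>First-order condition at a minimum, by which \<open>E_harm\<close> and
  \<open>Riesz_D0\<close> turn minimality into an equation. The quadratic is homogenised and read as
  a form whose first diagonal coefficient is 0.\<close>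

lemma linear_perturbation_nonneg:
  fixes d e :: real
  assumes "\<And>t. 0 \<le> 2 * t * d + t\<^sup>2 * e"
  shows "d = 0"
proof -
  have "\<bar>d\<bar> \<le> sqrt 0 * sqrt e"
  proof (rule quadratic_form_Cauchy_Schwarz)
    fix t s :: real
    have "0 \<le> 2 * (t * s) * d + (t * s)\<^sup>2 * e" by (rule assms)
    show "0 \<le> t\<^sup>2 * 0 + 2 * t * s * d + s\<^sup>2 * e"
    proof (cases "t = 0")
      case True
      have "0 \<le> e" using assms[of 1] assms[of "-1"] by simp
      then show ?thesis using True by simp
    next
      case False
      have "0 \<le> 2 * (s / t) * d + (s / t)\<^sup>2 * e" by (rule assms)
      then have "0 \<le> t\<^sup>2 * (2 * (s / t) * d + (s / t)\<^sup>2 * e)" by simp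
      also have "\<dots> = 2 * t * s * d + s\<^sup>2 * e"
        using False by (simp add: field_simps power2_eq_square)
      finally show ?thesis by simp
    qed
  qed
  then show ?thesis by simp
qed

text \<open>Connectedness is asked for in cut form because it will be checked with indicator
  functions of zero energy. Points related by some bound form an equivalence class that no edge
  leaves, hence all of \<open>V\<close>; finiteness lets the separate constants be added up to
  one.\<close>

lemma oscillation_bound_connected:
  fixes Q :: "('b \<Rightarrow> real) \<Rightarrow> real"
  assumes "finite V"
    and edge: "\<And>x y. (x, y) \<in> R \<Longrightarrow> \<exists>c\<ge>0. \<forall>u. \<bar>u x - u y\<bar> \<le> c * sqrt (Q u)"
    and connected: "\<And>A. A \<subseteq> V \<Longrightarrow> A \<noteq> {} \<Longrightarrow> (\<And>x y. (x, y) \<in> R \<Longrightarrow> x \<in> V \<Longrightarrow> y \<in> V \<Longrightarrow> x \<in> A \<longleftrightarrow> y \<in> A) \<Longrightarrow> A = V"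
    and nonneg: "\<And>u. 0 \<le> Q u"
  shows "\<exists>c\<ge>0. \<forall>u. \<forall>x\<in>V. \<forall>y\<in>V. \<bar>u x - u y\<bar> \<le> c * sqrt (Q u)"
proof -
  define B where "B x y \<longleftrightarrow> (\<exists>c\<ge>0. \<forall>u. \<bar>u x - u y\<bar> \<le> c * sqrt (Q u))" for x y
  have trans: "B x z" if "B x y" "B y z" for x y z
  proof -
    obtain c d where c: "c \<ge> 0" "\<And>u. \<bar>u x - u y\<bar> \<le> c * sqrt (Q u)"
      and d: "d \<ge> 0" "\<And>u. \<bar>u y - u z\<bar> \<le> d * sqrt (Q u)" using \<open>B x y\<close> \<open>B y z\<close> unfolding B_def by blast
    have "\<bar>u x - u z\<bar> \<le> (c + d) * sqrt (Q u)" for u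
      using c(2)[of u] d(2)[of u] by (simp add: algebra_simps)
    then show ?thesis unfolding B_def using c d by (intro exI[of _ "c + d"]) auto
  qed
  have sym: "B y x" if "B x y" for x y using that unfolding B_def by (simp add: abs_minus_commute)
  have refl: "B x x" for x unfolding B_def by (intro exI[of _ 0]) auto
  have "B x y" if "x \<in> V" "y \<in> V" for x y
  proof -
    have "{y\<in>V. B x y} = V"
    proof (rule connected)
      show "{y\<in>V. B x y} \<noteq> {}" using refl that by auto
      fix a b assume "(a, b) \<in> R" "a \<in> V" "b \<in> V"
      moreover from this have "B a b" using edge unfolding B_def by blast
      ultimately show "a \<in> {y\<in>V. B x y} \<longleftrightarrow> b \<in> {y\<in>V. B x y}"
        using trans sym by blast
    qed auto
    then show ?thesis using that by blast
  qed
  then have "\<exists>c. \<forall>x\<in>V. \<forall>y\<in>V. c x y \<ge> 0 \<and> (\<forall>u. \<bar>u x - u y\<bar> \<le> c x y * sqrt (Q u))"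
    unfolding B_def by metis
  then obtain c where c: "\<And>x y. x \<in> V \<Longrightarrow> y \<in> V \<Longrightarrow> c x y \<ge> 0"
    "\<And>x y u. x \<in> V \<Longrightarrow> y \<in> V \<Longrightarrow> \<bar>u x - u y\<bar> \<le> c x y * sqrt (Q u)" by blast
  define C where "C = (\<Sum>x\<in>V. \<Sum>y\<in>V. c x y)"
  have le: "c x y \<le> C" if "x \<in> V" "y \<in> V" for x y
  proof -
    have "c x y \<le> (\<Sum>y\<in>V. c x y)"
      using assms(1) c(1) that by (intro member_le_sum) auto
    also have "\<dots> \<le> C"
      unfolding C_def using assms(1) c(1) that by (intro member_le_sum[of x V "\<lambda>x. \<Sum>y\<in>V. c x y"]) (auto intro: sum_nonneg)
    finally show ?thesis .
  qed
  have "\<bar>u x - u y\<bar> \<le> C * sqrt (Q u)" if "x \<in> V" "y \<in> V" for x y u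
    using c(2)[OF that, of u] mult_right_mono[OF le[OF that], of "sqrt (Q u)"] nonneg[of u] by simp
  moreover have "C \<ge> 0" unfolding C_def using c(1) by (intro sum_nonneg) auto
  ultimately show ?thesis by blast
qed

lemma square_le_of_abs_le_sqrt:
  fixes a k e :: real
  assumes "\<bar>a\<bar> \<le> k * sqrt e" "0 \<le> e"
  shows "a\<^sup>2 \<le> k\<^sup>2 * e"
  using power_mono[OF assms(1) abs_ge_zero, of 2] assms(2) by (simp add: power_mult_distrib)

text \<open>Gaussian elimination: an unknown \<open>p0\<close> with nonzero coefficient in equation
  \<open>k\<close> is solved for, which leaves one equation and one unknown fewer.\<close>

lemma underdetermined_system:
  fixes B :: "'b \<Rightarrow> 'c \<Rightarrow> 'k::field"
  assumes "finite Q" "finite J" "card Q < card J"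
  shows "\<exists>a. (\<exists>p\<in>J. a p \<noteq> 0) \<and> (\<forall>q\<in>Q. (\<Sum>p\<in>J. a p * B p q) = 0)"
  using assms
proof (induction Q arbitrary: J B rule: finite_induct)
  case empty
  then show ?case by (intro exI[of _ "\<lambda>_. 1"]) (auto simp: card_gt_0_iff)
next
  case (insert k Q)
  show ?case
  proof (cases "\<forall>p\<in>J. B p k = 0")
    case True
    have "card Q < card J" using insert by simp
    then obtain a where "\<exists>p\<in>J. a p \<noteq> 0" "\<forall>q\<in>Q. (\<Sum>p\<in>J. a p * B p q) = 0"
      using insert.IH[of J B] insert.prems by blast
    then show ?thesis using True by (intro exI[of _ a]) auto
  next
    case False
    then obtain p0 where p0: "p0 \<in> J" "B p0 k \<noteq> 0" by blast
    let ?J = "J - {p0}"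
    have "card Q < card ?J" using insert p0 by simp
    then obtain a where a: "\<exists>p\<in>?J. a p \<noteq> 0"
      "\<And>q. q \<in> Q \<Longrightarrow> (\<Sum>p\<in>?J. a p * (B p q - B p k / B p0 k * B p0 q)) = 0"
      using insert.IH[of ?J "\<lambda>p q. B p q - B p k / B p0 k * B p0 q"] insert.prems by blast
    define b where "b p = (if p = p0 then - (\<Sum>p\<in>?J. a p * (B p k / B p0 k)) else a p)" for p
    have sum: "(\<Sum>p\<in>J. b p * B p q) = (\<Sum>p\<in>?J. a p * (B p q - B p k / B p0 k * B p0 q))" for q
    proof -
      have "(\<Sum>p\<in>J. b p * B p q) = b p0 * B p0 q + (\<Sum>p\<in>?J. b p * B p q)"
        using insert.prems p0 by (simp add: sum.remove)
      also have "(\<Sum>p\<in>?J. b p * B p q) = (\<Sum>p\<in>?J. a p * B p q)"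
        by (intro sum.cong) (auto simp: b_def)
      also have "b p0 * B p0 q + (\<Sum>p\<in>?J. a p * B p q) = (\<Sum>p\<in>?J. a p * (B p q - B p k / B p0 k * B p0 q))"
        by (simp add: b_def sum_distrib_right sum_subtractf right_diff_distrib mult.assoc)
      finally show ?thesis .
    qed
    have "\<exists>p\<in>J. b p \<noteq> 0" using a(1) by (auto simp: b_def)
    moreover have "(\<Sum>p\<in>J. b p * B p q) = 0" if "q \<in> insert k Q" for q
      using that sum[of q] a(2)[of q] p0(2) by auto
    ultimately show ?thesis by blast
  qed
qed

text \<open>To solve for a right-hand side \<open>b\<close>, it is adjoined as the column of an
  extra unknown \<open>None\<close>. The enlarged homogeneous system is underdetermined, and
  injectivity forces the coefficient of \<open>None\<close> in a nontrivial solution to be nonzero,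
  so that one can divide by it.\<close>

lemma inverse_matrix_on_exists:
  assumes I: "finite I"
    and inj: "\<And>a p. (\<And>q. q \<in> I \<Longrightarrow> (\<Sum>p\<in>I. a p * B p q) = 0) \<Longrightarrow> p \<in> I \<Longrightarrow> a p = 0"
  shows "\<exists>A. inverse_matrix_on I B A"
proof -
  have "\<exists>c. \<forall>q\<in>I. (\<Sum>p\<in>I. c p * B p q) = b q" for b
  proof -
    let ?J = "insert None (Some ` I)"
    have "card I < card ?J" using I by (simp add: card_image)
    then obtain a where a: "\<exists>p\<in>?J. a p \<noteq> 0"
      "\<And>q. q \<in> I \<Longrightarrow> (\<Sum>p\<in>?J. a p * (case p of None \<Rightarrow> b q | Some p \<Rightarrow> B p q)) = 0"
      using underdetermined_system[OF I, of ?J "\<lambda>p q. case p of None \<Rightarrow> b q | Some p \<Rightarrow> B p q"] I by auto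
    have sum: "a None * b q + (\<Sum>p\<in>I. a (Some p) * B p q) = 0" if "q \<in> I" for q
      using a(2)[OF that] I by (simp add: sum.reindex)
    have "a None \<noteq> 0"
    proof
      assume "a None = 0"
      then have "a (Some p) = 0" if "p \<in> I" for p
        using sum by (intro inj[of "\<lambda>p. a (Some p)"] that) simp
      then show False using a(1) \<open>a None = 0\<close> by auto
    qed
    then have "(\<Sum>p\<in>I. (- a (Some p) / a None) * B p q) = b q" if "q \<in> I" for q
      using sum[OF that] by (simp add: sum_divide_distrib[symmetric] sum_negf field_simps add_eq_0_iff)
    then show ?thesis by (intro exI[of _ "\<lambda>p. - a (Some p) / a None"]) simp
  qed
  then have "\<forall>s. \<exists>c. \<forall>q\<in>I. (\<Sum>p\<in>I. c p * B p q) = of_bool (s = q)" by (rule allI)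
  then obtain A where A: "\<And>s q. q \<in> I \<Longrightarrow> (\<Sum>p\<in>I. A s p * B p q) = of_bool (s = q)" by metis
  have "(\<Sum>s\<in>I. B p s * A s q) = of_bool (p = q)" if "p \<in> I" "q \<in> I" for p q
  proof -
    \<comment> \<open>So far \<open>A\<close> is only a left inverse. From \<open>A B = 1\<close>
      the rows of \<open>B A - 1\<close> are annihilated by \<open>B\<close>, hence zero by
      injectivity.\<close>
    have "(\<Sum>t\<in>I. B p t * A t q) - of_bool (p = q) = 0"
    proof (rule inj[of "\<lambda>s. (\<Sum>t\<in>I. B p t * A t s) - of_bool (p = s)"])
      fix q assume q: "q \<in> I"
      have "(\<Sum>s\<in>I. (\<Sum>t\<in>I. B p t * A t s) * B s q) = (\<Sum>s\<in>I. \<Sum>t\<in>I. B p t * (A t s * B s q))"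
        by (simp add: sum_distrib_right mult.assoc)
      also have "\<dots> = (\<Sum>t\<in>I. B p t * (\<Sum>s\<in>I. A t s * B s q))"
        by (subst sum.swap) (simp add: sum_distrib_left)
      also have "\<dots> = (\<Sum>t\<in>I. if t = q then B p t else 0)"
        using A[OF q] by (intro sum.cong) auto
      also have "\<dots> = B p q" using I q by simp
      finally have *: "(\<Sum>s\<in>I. (\<Sum>t\<in>I. B p t * A t s) * B s q) = B p q" .
      have "(\<Sum>s\<in>I. of_bool (p = s) * B s q) = (\<Sum>s\<in>I. if s = p then B s q else 0)"
        by (intro sum.cong) auto
      also have "\<dots> = B p q" using I \<open>p \<in> I\<close> by simp
      finally show "(\<Sum>s\<in>I. ((\<Sum>t\<in>I. B p t * A t s) - of_bool (p = s)) * B s q) = 0"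
        using * by (simp add: left_diff_distrib sum_subtractf)
    qed fact
    then show ?thesis by simp
  qed
  then show ?thesis using A unfolding inverse_matrix_on_def by blast
qed

text \<open>Countable additivity by dominated convergence: partial sums of indicators of disjoint
  sets are again indicators, so \<open>norm (h y)\<close> dominates.\<close>

lemma complex_measure_on_density:
  fixes h :: "'a::euclidean_space \<Rightarrow> complex"
  assumes N: "sets N = sets (restrict_space borel X)" and h: "integrable N h"
    and \<nu>: "\<And>A. A \<in> sets N \<Longrightarrow> \<nu> A = (LINT y:A|N. h y)"
  shows "complex_measure_on X \<nu>"
  unfolding complex_measure_on_def
proof (intro allI impI, elim conjE)
  fix A :: "nat \<Rightarrow> 'a set"
  assume "range A \<subseteq> sets (restrict_space borel X)" and disj: "disjoint_family A"
  then have A [measurable]: "A n \<in> sets N" for n using N by auto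
  have "(\<lambda>n. \<integral>y. (\<Sum>i<n. indicator (A i) y *\<^sub>R h y) \<partial>N) \<longlonglongrightarrow> (\<integral>y. indicator (\<Union>i. A i) y *\<^sub>R h y \<partial>N)"
  proof (rule integral_dominated_convergence[where w = "\<lambda>y. norm (h y)"])
    show "AE y in N. (\<lambda>n. \<Sum>i<n. indicator (A i) y *\<^sub>R h y) \<longlonglongrightarrow> indicator (\<Union>i. A i) y *\<^sub>R h y"
    proof (rule AE_I2)
      fix y
      have "(\<lambda>i. indicator (A i) y :: real) sums indicator (\<Union>i. A i) y"
        using disj by (intro indicator_sums) (auto simp: disjoint_family_on_def)
      then have "(\<lambda>i. indicator (A i) y *\<^sub>R h y) sums (indicator (\<Union>i. A i) y *\<^sub>R h y)"
        by (rule sums_scaleR_left)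
      then show "(\<lambda>n. \<Sum>i<n. indicator (A i) y *\<^sub>R h y) \<longlonglongrightarrow> indicator (\<Union>i. A i) y *\<^sub>R h y"
        by (simp add: sums_def)
    qed
    show "AE y in N. norm (\<Sum>i<n. indicator (A i) y *\<^sub>R h y) \<le> norm (h y)" for n
    proof (rule AE_I2)
      fix y
      have "disjoint_family_on A {..<n}" using disj by (auto simp: disjoint_family_on_def)
      then have "(\<Sum>i<n. indicator (A i) y :: real) = indicator (\<Union>i<n. A i) y"
        by (subst indicator_UN_disjoint) auto
      then have "(\<Sum>i<n. indicator (A i) y *\<^sub>R h y) = (indicator (\<Union>i<n. A i) y :: real) *\<^sub>R h y"
        by (simp add: scaleR_sum_left[symmetric])
      then show "norm (\<Sum>i<n. indicator (A i) y *\<^sub>R h y) \<le> norm (h y)"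
        by (simp split: split_indicator)
    qed
    show "integrable N (\<lambda>y. norm (h y))" using h by (rule integrable_norm)
  qed (use borel_measurable_integrable[OF h] in measurable)
  moreover have "(\<integral>y. (\<Sum>i<n. indicator (A i) y *\<^sub>R h y) \<partial>N) = (\<Sum>i<n. \<nu> (A i))" for n
    unfolding \<nu>[OF A] set_lebesgue_integral_def
    by (rule Bochner_Integration.integral_sum) (intro integrable_mult_indicator A h)
  moreover have "(\<Union>i. A i) \<in> sets N" by measurable
  ultimately show "(\<lambda>n. \<nu> (A n)) sums \<nu> (\<Union>n. A n)"
    by (simp add: sums_def \<nu> set_lebesgue_integral_def)
qed

text \<open>Meant for the words of one length, at most one of which contributes to a kernel. A
  witness is returned even if all terms vanish, so that there is one word for every length.\<close>

lemma sum_single_term: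
  fixes f :: "'b \<Rightarrow> 'c::comm_monoid_add"
  assumes "finite A" "A \<noteq> {}" "\<And>w w'. w \<in> A \<Longrightarrow> w' \<in> A \<Longrightarrow> w \<noteq> w' \<Longrightarrow> f w \<noteq> 0 \<Longrightarrow> f w' = 0"
  shows "\<exists>w\<in>A. sum f A = f w \<and> (\<forall>w'\<in>A. w' \<noteq> w \<longrightarrow> f w' = 0)"
proof -
  obtain w where w: "w \<in> A" "\<And>w'. w' \<in> A \<Longrightarrow> w' \<noteq> w \<Longrightarrow> f w' = 0"
  proof (cases "\<forall>w\<in>A. f w = 0")
    case True
    then show ?thesis using that assms(2) by blast
  next
    case False
    then show ?thesis using that assms(3) by metis
  qed
  have "sum f A = f w + sum f (A - {w})" using assms(1) w(1) by (rule sum.remove)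
  also have "sum f (A - {w}) = 0" using w(2) by (intro sum.neutral) auto
  finally show ?thesis using w by (intro bexI[of _ w]) auto
qed

section \<open>Self-similar sets\<close>

locale pcf_energy =
  fixes S :: "'a::euclidean_space pcf_data"
  assumes self_similar_set: "self_similar_set S"
    and post_critically_finite: "post_critically_finite S"
    and self_similar_measure: "self_similar_measure S"
    and self_similar_energy: "self_similar_energy S"
begin
abbreviation "X \<equiv> fractal S"
abbreviation "V0 \<equiv> bdry S"
abbreviation "F \<equiv> ssmap S"
abbreviation "L \<equiv> letters S"
abbreviation "M \<equiv> ssmeasure S"
abbreviation "r \<equiv> rfactor S"
abbreviation "V1 \<equiv> Vset S (Suc 0)"
abbreviation "\<mu> \<equiv> weight S"

lemma finite_L [simp]: "finite L"
  by (simp add: letters_def)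

lemma inj_F: "j \<in> L \<Longrightarrow> inj (F j)"
  using self_similar_set by (auto simp: self_similar_set_def)

lemma F_eq_iff [simp]: "j \<in> L \<Longrightarrow> F j x = F j y \<longleftrightarrow> x = y"
  using inj_F by (auto simp: inj_def)

lemma inv_F [simp]: "j \<in> L \<Longrightarrow> inv (F j) (F j x) = x"
  using inj_F by simp

lemma compact_X: "compact X" and X_nonempty: "X \<noteq> {}" and X_eq: "X = (\<Union>j\<in>L. F j ` X)"
  using self_similar_set by (auto simp: self_similar_set_def)

lemma closed_X: "closed X"
  using compact_X by (rule compact_imp_closed)

lemma F_in_X [intro, simp]: "j \<in> L \<Longrightarrow> x \<in> X \<Longrightarrow> F j x \<in> X"
  using X_eq by blast

lemma X_cases:
  assumes "x \<in> X"
  obtains j y where "j \<in> L" "y \<in> X" "x = F j y"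
  using assms X_eq by blast

lemma L_nonempty: "L \<noteq> {}"
  using X_eq X_nonempty by auto

lemma contraction_F: "\<exists>\<theta>. 0 < \<theta> \<and> \<theta> < 1 \<and> (\<forall>j\<in>L. \<forall>x y. dist (F j x) (F j y) \<le> \<theta> * dist x y)"
proof -
  have "\<forall>j\<in>L. \<exists>l. 0 < l \<and> l < 1 \<and> l-lipschitz_on UNIV (F j)"
    using self_similar_set by (auto simp: self_similar_set_def contraction_def)
  then obtain l where l: "\<And>j. j \<in> L \<Longrightarrow> 0 < l j \<and> l j < 1 \<and> (l j)-lipschitz_on UNIV (F j)"
    by metis
  define \<theta> where "\<theta> = Max (l ` L)"
  have le: "l j \<le> \<theta>" if "j \<in> L" for j
    unfolding \<theta>_def using that by simp
  have "\<theta> \<in> l ` L"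
    unfolding \<theta>_def using L_nonempty by (intro Max_in) auto
  then have "0 < \<theta>" "\<theta> < 1" using l by auto
  moreover have "dist (F j x) (F j y) \<le> \<theta> * dist x y" if "j \<in> L" for j x y
    using lipschitz_onD[of "l j" UNIV "F j" x y] l[OF that] mult_right_mono[OF le[OF that], of "dist x y"]
    by force
  ultimately show ?thesis by blast
qed

lemma continuous_F: "j \<in> L \<Longrightarrow> continuous_on A (F j)"
  using self_similar_set
  by (meson contraction_def continuous_on_subset lipschitz_on_continuous_on self_similar_set_def subset_UNIV)

lemma finite_V0 [simp]: "finite V0"
  using post_critically_finite by (simp add: post_critically_finite_def)

lemma V0_fixed: "q \<in> V0 \<Longrightarrow> \<exists>i\<in>L. F i q = q"
  using post_critically_finite by (simp add: post_critically_finite_def)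

text \<open>The contraction maps the point of \<open>X\<close> nearest to its fixed point
  \<open>q\<close> to a point of \<open>X\<close> that is closer by a factor less than 1, so the
  nearest distance is 0.\<close>

lemma V0_subset_X: "V0 \<subseteq> X"
proof
  fix q assume "q \<in> V0"
  then obtain i where i: "i \<in> L" "F i q = q" using V0_fixed by blast
  obtain \<theta> where \<theta>: "\<theta> < 1" "\<And>x y. dist (F i x) (F i y) \<le> \<theta> * dist x y"
    using contraction_F i by blast
  obtain x where x: "x \<in> X" "\<And>y. y \<in> X \<Longrightarrow> dist q x \<le> dist q y"
    using distance_attains_inf[OF closed_X X_nonempty] by blast
  have "dist q x \<le> dist q (F i x)" using x i by auto
  also have "\<dots> \<le> \<theta> * dist q x" using \<theta>(2)[of q x] i by simp
  finally have "dist q x = 0"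
    using \<theta>(1) by (metis less_eq_real_def linorder_not_le mult_less_cancel_right2 zero_le_dist)
  then show "q \<in> X" using x by simp
qed

lemma V0_X [simp, intro]: "q \<in> V0 \<Longrightarrow> q \<in> X"
  using V0_subset_X by blast

lemma words_Nil [simp]: "[] \<in> words S" and words_Cons [simp]: "j # w \<in> words S \<longleftrightarrow> j \<in> L \<and> w \<in> words S"
  by (auto simp: words_def)

lemma words_len_0 [simp]: "words_len S 0 = {[]}"
  by (auto simp: words_len_def)

lemma words_len_Suc: "words_len S (Suc n) = (\<lambda>(j, w). j # w) ` (L \<times> words_len S n)"
  by (auto simp: words_len_def length_Suc_conv image_iff)

lemma sum_words_len_Suc:
  "(\<Sum>w\<in>words_len S (Suc n). f w) = (\<Sum>j\<in>L. \<Sum>w\<in>words_len S n. f (j # w))"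
proof -
  have "inj_on (\<lambda>(j, w). j # w) (L \<times> words_len S n)" by (auto simp: inj_on_def)
  then show ?thesis
    unfolding words_len_Suc by (simp add: sum.reindex sum.cartesian_product split_def)
qed

lemma finite_words_len [simp]: "finite (words_len S n)"
  by (induction n) (auto simp: words_len_Suc)

lemma wmap_Nil [simp]: "wmap S [] = id" and wmap_Cons [simp]: "wmap S (j # w) = F j \<circ> wmap S w"
  by (simp_all add: wmap_def)

lemma rword_Nil [simp]: "rword S [] = 1" and rword_Cons [simp]: "rword S (j # w) = r j * rword S w"
  by (simp_all add: rword_def)

lemma muword_Nil [simp]: "muword S [] = 1" and muword_Cons [simp]: "muword S (j # w) = \<mu> j * muword S w"
  by (simp_all add: muword_def)

lemma inj_wmap: "w \<in> words S \<Longrightarrow> inj (wmap S w)"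
  by (induction w) (auto intro!: inj_compose inj_F simp: inj_on_def)

lemma inv_wmap [simp]: "w \<in> words S \<Longrightarrow> inv (wmap S w) (wmap S w x) = x"
  using inj_wmap by simp

lemma wmap_in_X [simp, intro]: "w \<in> words S \<Longrightarrow> x \<in> X \<Longrightarrow> wmap S w x \<in> X"
  by (induction w) auto

lemma cell_Nil [simp]: "cell S [] = X" and cell_Cons: "cell S (j # w) = F j ` cell S w"
  by (auto simp: cell_def)

lemma cell_single: "cell S [j] = F j ` X"
  by (auto simp: cell_def)

lemma cells_cover: "x \<in> X \<Longrightarrow> \<exists>w\<in>words_len S n. x \<in> cell S w"
proof (induction n arbitrary: x)
  case (Suc n)
  obtain j y where j: "j \<in> L" "y \<in> X" "x = F j y" using Suc.prems X_cases by blast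
  then show ?case using Suc.IH[of y] by (force simp: words_len_Suc cell_Cons)
qed simp

lemma cell_diameter:
  "\<exists>\<theta> D. 0 < \<theta> \<and> \<theta> < 1 \<and> (\<forall>w\<in>words S. \<forall>x\<in>cell S w. \<forall>y\<in>cell S w. dist x y \<le> \<theta> ^ length w * D)"
proof -
  obtain \<theta> where \<theta>: "0 < \<theta>" "\<theta> < 1" "\<And>j x y. j \<in> L \<Longrightarrow> dist (F j x) (F j y) \<le> \<theta> * dist x y"
    using contraction_F by blast
  have "dist (wmap S w x) (wmap S w y) \<le> \<theta> ^ length w * dist x y" if "w \<in> words S" for w x y
    using that
  proof (induction w)
    case (Cons j w)
    have "dist (F j (wmap S w x)) (F j (wmap S w y)) \<le> \<theta> * dist (wmap S w x) (wmap S w y)"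
      using Cons.prems \<theta>(3) by simp
    also have "\<dots> \<le> \<theta> * (\<theta> ^ length w * dist x y)"
      using Cons \<theta>(1) by (intro mult_left_mono) auto
    finally show ?case by (simp add: mult_ac)
  qed simp
  moreover have "dist x y \<le> diameter X" if "x \<in> X" "y \<in> X" for x y
    using compact_X that by (simp add: compact_imp_bounded diameter_bounded_bound)
  ultimately have "dist (wmap S w x) (wmap S w y) \<le> \<theta> ^ length w * diameter X"
    if "w \<in> words S" "x \<in> X" "y \<in> X" for w x y
    using \<theta>(1) that by (meson mult_left_mono order.trans zero_le_power less_imp_le)
  then have "\<forall>w\<in>words S. \<forall>x\<in>cell S w. \<forall>y\<in>cell S w. dist x y \<le> \<theta> ^ length w * diameter X"
    by (auto simp: cell_def)
  then show ?thesis using \<theta> by blast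
qed

lemma words_len1 [simp]: "j \<in> L \<Longrightarrow> [j] \<in> words_len S (Suc 0)"
  by (simp add: words_len_def)

lemma F_inter:
  assumes "j \<in> L" "k \<in> L" "j \<noteq> k" "x \<in> X" "y \<in> X" "F j x = F k y"
  shows "x \<in> V0" "y \<in> V0"
proof -
  have "cell S [j] \<inter> cell S [k] \<subseteq> wmap S [j] ` V0 \<inter> wmap S [k] ` V0"
    using post_critically_finite assms words_len1 unfolding post_critically_finite_def
    by (metis list.inject)
  moreover have "F j x \<in> cell S [j] \<inter> cell S [k]"
    using assms by (metis IntI cell_single imageI)
  ultimately have "F j x \<in> F j ` V0 \<inter> F k ` V0" by auto
  then obtain a b where "a \<in> V0" "F j x = F j a" "b \<in> V0" "F j x = F k b" by auto
  then show "x \<in> V0" "y \<in> V0" using assms F_eq_iff by metis+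
qed

lemma F_disjoint_V0:
  assumes "j \<in> L" "k \<in> L" "j \<noteq> k" "x \<in> X" "y \<in> X" "F j x = F k y"
  shows "F j x \<notin> V0"
proof -
  have "cell S [j] \<inter> cell S [k] \<inter> V0 = {}"
    using post_critically_finite assms words_len1 unfolding post_critically_finite_def
    by (metis list.inject)
  then show ?thesis using assms by (auto simp: cell_single)
qed

text \<open>Distinct 1-cells never meet in \<open>V0\<close>, so only one 1-cell contains
  \<open>q\<close>. This makes the definite description denote, and the third claim evaluates glued
  functions at boundary points.\<close>

lemma fixing_letter:
  assumes "q \<in> V0"
  shows "fixing_letter S q \<in> L" "F (fixing_letter S q) q = q"
    "\<And>j x. j \<in> L \<Longrightarrow> x \<in> X \<Longrightarrow> F j x = q \<longleftrightarrow> j = fixing_letter S q \<and> x = q"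
proof -
  obtain i where i: "i \<in> L" "F i q = q" using assms V0_fixed by blast
  have *: "j = i" if "j \<in> L" "x \<in> X" "F j x = q" for j x
    using F_disjoint_V0[of j i x q] that i assms by auto
  have "fixing_letter S q = i"
    unfolding fixing_letter_def using i assms by (intro the_equality) (auto intro: *)
  then show "fixing_letter S q \<in> L" "F (fixing_letter S q) q = q"
    "\<And>j x. j \<in> L \<Longrightarrow> x \<in> X \<Longrightarrow> F j x = q \<longleftrightarrow> j = fixing_letter S q \<and> x = q"
    using i * F_eq_iff by metis+
qed

lemma V1_eq: "V1 = (\<Union>j\<in>L. F j ` V0)"
  by (auto simp: Vset_def words_len_Suc)

lemma finite_V1 [simp]: "finite (V1)"
  by (simp add: V1_eq)

lemma V0_subset_V1: "V0 \<subseteq> V1"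
proof
  fix q assume "q \<in> V0"
  then show "q \<in> V1" using fixing_letter[of q] unfolding V1_eq by (metis UN_iff imageI)
qed

lemma V1_subset_X: "V1 \<subseteq> X"
  by (auto simp: V1_eq)

lemma F_in_V1:
  assumes "j \<in> L" "x \<in> X"
  shows "F j x \<in> V1 \<longleftrightarrow> x \<in> V0"
proof
  assume "F j x \<in> V1"
  then obtain k y where k: "k \<in> L" "y \<in> V0" "F j x = F k y" by (auto simp: V1_eq)
  show "x \<in> V0"
  proof (cases "j = k")
    case True
    then show ?thesis using k assms by simp
  next
    case False
    then show ?thesis using F_inter(1)[of j k x y] k assms by auto
  qed
qed (use assms in \<open>auto simp: V1_eq\<close>)

text \<open>At a point of several 1-cells an arbitrary one of the pieces is used.\<close>

definition glue :: "(nat \<Rightarrow> 'a \<Rightarrow> 'b) \<Rightarrow> 'a \<Rightarrow> 'b" where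
  "glue g x = (let j = SOME j. j \<in> L \<and> x \<in> F j ` X in g j (inv (F j) x))"

text \<open>Distinct 1-cells meet only in images of boundary points, so the pieces fit together as
  soon as they take the values of a single function \<open>\<phi>\<close> at the vertices.\<close>

lemma glue_F:
  assumes "\<And>j q. j \<in> L \<Longrightarrow> q \<in> V0 \<Longrightarrow> g j q = \<phi> (F j q)" "j \<in> L" "x \<in> X"
  shows "glue g (F j x) = g j x"
proof -
  define k where "k = (SOME k. k \<in> L \<and> F j x \<in> F k ` X)"
  have "k \<in> L \<and> F j x \<in> F k ` X"
    unfolding k_def by (rule someI[of _ j]) (use assms in auto)
  then obtain y where y: "k \<in> L" "y \<in> X" "F j x = F k y" by auto
  have "glue g (F j x) = g k y"
    unfolding glue_def k_def[symmetric] using y by (simp add: Let_def)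
  also have "\<dots> = g j x"
  proof (cases "j = k")
    case False
    then have "x \<in> V0" "y \<in> V0" using F_inter[of j k x y] assms y by auto
    then show ?thesis using assms(1) y assms(2) by metis
  qed (use y in auto)
  finally show ?thesis .
qed

lemma continuous_on_glue:
  assumes "\<And>j. j \<in> L \<Longrightarrow> continuous_on X (u \<circ> F j)"
  shows "continuous_on X u"
proof -
  have "continuous_on (F j ` X) u" if "j \<in> L" for j
  proof -
    have "continuous_on (F j ` X) (inv (F j))"
      using that by (intro continuous_on_inv continuous_F compact_X) auto
    moreover have "continuous_on (inv (F j) ` F j ` X) (u \<circ> F j)"
      using assms[OF that] that by (simp add: image_image)
    ultimately have "continuous_on (F j ` X) ((u \<circ> F j) \<circ> inv (F j))"
      by (rule continuous_on_compose)
    then show ?thesis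
      using that by (elim continuous_on_eq) auto
  qed
  moreover have "closed (F j ` X)" if "j \<in> L" for j
    using that by (intro compact_imp_closed compact_continuous_image continuous_F compact_X)
  ultimately have "continuous_on (\<Union>j\<in>L. F j ` X) u"
    by (intro continuous_on_closed_Union) auto
  then show ?thesis using X_eq by simp
qed

text \<open>The finitely many cells of one level that miss \<open>x\<close> have a closed union, so
  a whole neighbourhood of \<open>x\<close> in \<open>X\<close> is covered by cells through
  \<open>x\<close>.\<close>

lemma continuous_on_X_cells:
  fixes u :: "'a \<Rightarrow> real"
  assumes "\<And>e. e > 0 \<Longrightarrow> \<exists>n. \<forall>w\<in>words_len S n. \<forall>x\<in>cell S w. \<forall>y\<in>cell S w. \<bar>u x - u y\<bar> < e"
  shows "continuous_on X u"
  unfolding continuous_on_iff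
proof (intro ballI allI impI)
  fix x e assume x: "x \<in> X" and "0 < (e::real)"
  then obtain n where n: "\<And>w x y. w \<in> words_len S n \<Longrightarrow> x \<in> cell S w \<Longrightarrow> y \<in> cell S w \<Longrightarrow> \<bar>u x - u y\<bar> < e"
    using assms by meson
  have "closed (cell S w)" if "w \<in> words_len S n" for w
  proof -
    have "continuous_on X (wmap S w)" if "w \<in> words S" for w
      using that by (induction w) (auto intro!: continuous_on_compose continuous_F continuous_on_id simp del: o_apply simp: id_def[symmetric])
    then show ?thesis
      unfolding cell_def using that
      by (intro compact_imp_closed compact_continuous_image compact_X) (auto simp: words_len_def)
  qed
  then have "closed (\<Union>w\<in>{w\<in>words_len S n. x \<notin> cell S w}. cell S w)"
    by (intro closed_UN) auto
  moreover have "x \<notin> (\<Union>w\<in>{w\<in>words_len S n. x \<notin> cell S w}. cell S w)" by auto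
  ultimately obtain d where d: "d > 0" "\<And>y. dist y x < d \<Longrightarrow> y \<notin> (\<Union>w\<in>{w\<in>words_len S n. x \<notin> cell S w}. cell S w)"
    by (metis (no_types, lifting) ComplD ComplI open_Compl open_dist)
  have "dist (u y) (u x) < e" if y: "y \<in> X" "dist y x < d" for y
  proof -
    obtain w where "w \<in> words_len S n" "y \<in> cell S w" using cells_cover y by blast
    then show ?thesis using d(2)[OF y(2)] n[of w y x] by (auto simp: dist_real_def)
  qed
  then show "\<exists>d>0. \<forall>y\<in>X. dist y x < d \<longrightarrow> dist (u y) (u x) < e" using d by blast
qed

section \<open>The self-similar measure\<close>

lemma sets_M: "sets M = sets (restrict_space borel X)" and prob_space_M: "prob_space M"
  and weight_pos: "j \<in> L \<Longrightarrow> 0 < \<mu> j" and weight_less_1: "j \<in> L \<Longrightarrow> \<mu> j < 1"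
  and sum_weight: "(\<Sum>j\<in>L. \<mu> j) = 1"
  and measure_self_similar:
    "A \<in> sets M \<Longrightarrow> measure M A = (\<Sum>j\<in>L. \<mu> j * measure M (F j -` A \<inter> X))"
  using self_similar_measure by (auto simp: self_similar_measure_def)

sublocale prob_space M by (rule prob_space_M)

lemma space_M [simp]: "space M = X"
  using sets_eq_imp_space_eq[OF sets_M] by (simp add: space_restrict_space)

lemma measure_X [simp]: "measure M X = 1"
  using prob_space by simp

lemma borel_X: "X \<in> sets borel" using closed_X by auto

lemma sets_M_iff: "A \<in> sets M \<longleftrightarrow> A \<in> sets borel \<and> A \<subseteq> X"
  unfolding sets_M by (subst sets_restrict_space_iff) (use borel_X in auto)

lemma measurable_continuous_on [intro]:
  fixes f :: "'a \<Rightarrow> 'b::topological_space"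
  assumes "continuous_on X f"
  shows "f \<in> borel_measurable M"
  using borel_measurable_continuous_on_restrict[OF assms]
  by (simp add: measurable_cong_sets[OF sets_M refl])

lemma continuous_on_bounded:
  fixes f :: "'a \<Rightarrow> 'b::real_normed_vector"
  assumes "continuous_on X f"
  shows "\<exists>B. \<forall>x\<in>X. norm (f x) \<le> B"
  using compact_imp_bounded[OF compact_continuous_image[OF assms compact_X]]
  by (auto simp: bounded_iff)

lemma integrable_continuous_on [intro]:
  fixes f :: "'a \<Rightarrow> 'b::{banach, second_countable_topology}"
  assumes "continuous_on X f"
  shows "integrable M f"
proof -
  obtain B where "\<forall>x\<in>X. norm (f x) \<le> B" using continuous_on_bounded[OF assms] by blast
  then show ?thesis using assms by (intro integrable_const_bound[of _ B]) auto
qed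

lemma measurable_F [measurable]: "j \<in> L \<Longrightarrow> F j \<in> measurable M M"
proof -
  assume j: "j \<in> L"
  have "F j \<in> measurable M (restrict_space borel X)"
    using measurable_continuous_on[OF continuous_F[OF j]] j
    by (intro measurable_restrict_space2) auto
  then show ?thesis using measurable_cong_sets[OF refl sets_M] by blast
qed

text \<open>Self-similarity of \<open>M\<close> is given for sets only. As the image of (weighted
  letters) x \<open>M\<close>, the measure obeys Fubini's theorem, which yields the corresponding
  formula for integrals.\<close>

lemma M_eq_distr:
  "M = distr (point_measure L (\<lambda>j. ennreal (\<mu> j)) \<Otimes>\<^sub>M M) M (\<lambda>(j, x). F j x)" (is "_ = distr (?P \<Otimes>\<^sub>M _) _ ?f")
  and measurable_case_F: "(\<lambda>(j, x). F j x) \<in> measurable (point_measure L (\<lambda>j. ennreal (\<mu> j)) \<Otimes>\<^sub>M M) M"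
  and finite_measure_P: "finite_measure (point_measure L (\<lambda>j. ennreal (\<mu> j)))"
proof -
  show fin: "finite_measure ?P"
    by (rule finite_measureI) (simp add: space_point_measure emeasure_point_measure_finite)
  show *: "?f \<in> measurable (?P \<Otimes>\<^sub>M M) M"
    unfolding measurable_cong_sets[OF sets_pair_measure_cong[OF sets_point_measure_count_space refl] refl]
    by (rule measurable_pair_measure_countable1) (auto simp: countable_finite)
  show "M = distr (?P \<Otimes>\<^sub>M M) M ?f"
  proof (rule measure_eqI)
    fix A assume A: "A \<in> sets M"
    interpret P: finite_measure ?P by fact
    have "emeasure (distr (?P \<Otimes>\<^sub>M M) M ?f) A = emeasure (?P \<Otimes>\<^sub>M M) (?f -` A \<inter> space (?P \<Otimes>\<^sub>M M))"
      by (rule emeasure_distr[OF * A])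
    also have "\<dots> = (\<integral>\<^sup>+j. emeasure M (Pair j -` (?f -` A \<inter> space (?P \<Otimes>\<^sub>M M))) \<partial>?P)"
      by (rule emeasure_pair_measure_alt) (use measurable_sets[OF * A] in simp)
    also have "\<dots> = (\<Sum>j\<in>L. ennreal (\<mu> j) * emeasure M (Pair j -` (?f -` A \<inter> space (?P \<Otimes>\<^sub>M M))))"
      by (subst nn_integral_point_measure_finite) (auto simp: mult.commute)
    also have "\<dots> = (\<Sum>j\<in>L. ennreal (\<mu> j * measure M (F j -` A \<inter> X)))"
    proof (intro sum.cong refl)
      fix j assume j: "j \<in> L"
      have "Pair j -` (?f -` A \<inter> space (?P \<Otimes>\<^sub>M M)) = F j -` A \<inter> X"
        using j by (auto simp: space_pair_measure space_point_measure)
      then show "ennreal (\<mu> j) * emeasure M (Pair j -` (?f -` A \<inter> space (?P \<Otimes>\<^sub>M M))) = ennreal (\<mu> j * measure M (F j -` A \<inter> X))"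
        using weight_pos[OF j] by (simp add: emeasure_eq_measure ennreal_mult)
    qed
    also have "\<dots> = ennreal (\<Sum>j\<in>L. \<mu> j * measure M (F j -` A \<inter> X))"
      using weight_pos by (intro sum_ennreal mult_nonneg_nonneg) (auto intro: less_imp_le)
    also have "\<dots> = emeasure M A" using measure_self_similar[OF A] by (simp add: emeasure_eq_measure)
    finally show "emeasure M A = emeasure (distr (?P \<Otimes>\<^sub>M M) M ?f) A" by simp
  qed simp
qed

lemma integral_self_similar:
  fixes f :: "'a \<Rightarrow> 'b::{banach, second_countable_topology}"
  assumes f: "integrable M f"
  shows "j \<in> L \<Longrightarrow> integrable M (f \<circ> F j)"
    and "(\<integral>x. f x \<partial>M) = (\<Sum>j\<in>L. \<mu> j *\<^sub>R (\<integral>x. f (F j x) \<partial>M))"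
proof -
  let ?P = "point_measure L (\<lambda>j. ennreal (\<mu> j))"
  interpret P: finite_measure ?P by (rule finite_measure_P)
  interpret PM: pair_sigma_finite ?P M ..
  have int: "integrable (?P \<Otimes>\<^sub>M M) (\<lambda>p. f (case p of (j, x) \<Rightarrow> F j x))"
    using f by (subst (asm) M_eq_distr) (simp add: integrable_distr_eq measurable_case_F borel_measurable_integrable[OF f])
  then have "integrable (?P \<Otimes>\<^sub>M M) (\<lambda>(j, x). f (F j x))" by (simp add: split_def)
  note int' = this
  \<comment> \<open>Every letter has positive mass, so almost every letter means every
    letter.\<close>
  have "AE j in ?P. integrable M (\<lambda>x. f (F j x))"
    using PM.AE_integrable_fst[OF int'] .
  then show "integrable M (f \<circ> F j)" if "j \<in> L" for j
    using that weight_pos[OF that] by (simp add: AE_point_measure comp_def)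
  have "(\<integral>x. f x \<partial>M) = (\<integral>p. f (case p of (j, x) \<Rightarrow> F j x) \<partial>(?P \<Otimes>\<^sub>M M))"
    by (subst (1) M_eq_distr) (simp add: integral_distr measurable_case_F borel_measurable_integrable[OF f])
  also have "\<dots> = (\<integral>p. (case p of (j, x) \<Rightarrow> f (F j x)) \<partial>(?P \<Otimes>\<^sub>M M))" by (simp add: split_def)
  also have "\<dots> = (\<integral>j. (\<integral>x. f (F j x) \<partial>M) \<partial>?P)"
    using PM.integral_fst'[OF int'] by simp
  also have "\<dots> = (\<Sum>j\<in>L. \<mu> j *\<^sub>R (\<integral>x. f (F j x) \<partial>M))"
    by (rule lebesgue_integral_point_measure_finite) (auto intro: less_imp_le weight_pos)
  finally show "(\<integral>x. f x \<partial>M) = (\<Sum>j\<in>L. \<mu> j *\<^sub>R (\<integral>x. f (F j x) \<partial>M))" .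
qed

text \<open>At a boundary point only the 1-cell of its fixing letter contributes, so its mass equals
  a weight below 1 times itself and is 0. For \<open>x = F j y\<close>, preimages of
  \<open>x\<close> in other 1-cells are boundary points, so the mass of \<open>x\<close> is
  \<open>\<mu> j\<close> times that of \<open>y\<close>; iterating bounds it by every power of the
  largest weight.\<close>

lemma measure_singleton [simp]: "measure M {x} = 0"
proof (cases "x \<in> X")
  case True
  have sing: "measure M {F j y} = \<mu> j * measure M {y} + (\<Sum>k\<in>L-{j}. \<mu> k * measure M (F k -` {F j y} \<inter> X))"
    if "j \<in> L" "y \<in> X" for j y
  proof -
    have "F j -` {F j y} \<inter> X = {y}" using that by auto
    then show ?thesis
      using that by (subst measure_self_similar) (auto simp: sets_M_iff sum.remove)
  qed
  have V0: "measure M {q} = 0" if q: "q \<in> V0" for q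
  proof -
    let ?i = "fixing_letter S q"
    have "F k -` {F ?i q} \<inter> X = {}" if "k \<in> L - {?i}" for k
      using fixing_letter[OF q] that by auto
    then have "measure M {q} = \<mu> ?i * measure M {q}"
      using sing[of ?i q] fixing_letter[OF q] q by simp
    then show ?thesis using weight_less_1[of ?i] fixing_letter[OF q] by auto
  qed
  \<comment> \<open>Local to this proof: the largest weight of the measure, not the largest energy
    factor that bears this name below.\<close>
  define \<rho> where "\<rho> = Max (\<mu> ` L)"
  have \<rho>: "\<mu> j \<le> \<rho>" if "j \<in> L" for j
    unfolding \<rho>_def using that by simp
  have "\<rho> \<in> \<mu> ` L"
    unfolding \<rho>_def using L_nonempty by (intro Max_in) auto
  then have \<rho>01: "0 < \<rho>" "\<rho> < 1" using weight_pos weight_less_1 by auto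
  have "measure M {x} \<le> \<rho> ^ n" if "x \<in> X" for n x
    using that
  proof (induction n arbitrary: x)
    case (Suc n)
    obtain j y where j: "j \<in> L" "y \<in> X" "x = F j y" using Suc.prems X_cases by blast
    have "measure M (F k -` {F j y} \<inter> X) = 0" if "k \<in> L - {j}" for k
    proof (cases "\<exists>z\<in>X. F k z = F j y")
      case True
      then obtain z where z: "z \<in> X" "F k z = F j y" by blast
      then have "F k -` {F j y} \<inter> X = {z}" using that F_eq_iff[of k _ z] by auto
      moreover have "z \<in> V0" using F_inter[of k j z y] that j z by auto
      ultimately show ?thesis using V0 by simp
    next
      case False
      then have "F k -` {F j y} \<inter> X = {}" by auto
      then show ?thesis by simp
    qed
    then have "measure M {x} = \<mu> j * measure M {y}" using sing[of j y] j by simp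
    also have "\<dots> \<le> \<rho> * \<rho> ^ n"
      using Suc.IH[of y] j \<rho> \<rho>01 by (intro mult_mono) auto
    finally show ?case by simp
  qed simp
  then have "measure M {x} \<le> \<rho> ^ n" for n using True by blast
  then have "measure M {x} \<le> 0"
    by (intro LIMSEQ_le_const[OF LIMSEQ_power_zero[of \<rho>]]) (use \<rho>01 in auto)
  then show ?thesis by (simp add: measure_le_0_iff)
qed (simp add: measure_notin_sets sets_M_iff)

lemma AE_neq: "AE y in M. y \<noteq> x"
proof (cases "x \<in> X")
  case True
  then have "{x} \<in> null_sets M"
    by (auto simp: null_sets_def emeasure_eq_measure sets_M_iff)
  then show ?thesis by (rule AE_I') auto
qed (auto intro!: AE_I2)

section \<open>Discrete energies and oscillation bounds\<close>

abbreviation "E0 \<equiv> energy0 S"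
abbreviation "En \<equiv> energy_level S"
abbreviation "E \<equiv> energy S"
abbreviation "E2 u \<equiv> energy S u u"
abbreviation "D \<equiv> dom_energy S"
abbreviation "cnd \<equiv> conductance S"

lemma cnd_nonneg: "x \<in> V0 \<Longrightarrow> y \<in> V0 \<Longrightarrow> 0 \<le> cnd x y"
  and cnd_sym: "x \<in> V0 \<Longrightarrow> y \<in> V0 \<Longrightarrow> cnd x y = cnd y x"
  and r_pos: "j \<in> L \<Longrightarrow> 0 < r j"
  and r_less_1: "j \<in> L \<Longrightarrow> r j < 1"
  and extension_exists: "\<exists>v. (\<forall>x\<in>V0. v x = a x) \<and> En (Suc 0) v v = E0 a a"
  and E0_le_extension: "(\<And>x. x \<in> V0 \<Longrightarrow> v x = a x) \<Longrightarrow> E0 a a \<le> En (Suc 0) v v"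
  and E0_zero: "E0 a a = 0 \<Longrightarrow> \<exists>k. \<forall>x\<in>V0. a x = k"
  and dirichlet_form_E: "dirichlet_form M D E"
  and D_comp_F: "u \<in> D \<Longrightarrow> j \<in> L \<Longrightarrow> u \<circ> F j \<in> D"
  and E_zero: "u \<in> D \<Longrightarrow> E u u = 0 \<longleftrightarrow> (\<exists>k. \<forall>x\<in>X. u x = k)"
  using self_similar_energy by (auto simp: self_similar_energy_def)

lemma E0_cong: "(\<And>x. x \<in> V0 \<Longrightarrow> u x = u' x) \<Longrightarrow> (\<And>x. x \<in> V0 \<Longrightarrow> v x = v' x) \<Longrightarrow> E0 u v = E0 u' v'"
  unfolding energy0_def by (auto intro!: sum.cong)

lemma E0_sym: "E0 u v = E0 v u"
  unfolding energy0_def by (simp add: mult_ac)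

lemma E0_linear: "E0 (\<lambda>x. a * u x + b * v x) g = a * E0 u g + b * E0 v g"
proof -
  have "cnd x y * ((a * u x + b * v x) - (a * u y + b * v y)) * (g x - g y)
    = a * (cnd x y * (u x - u y) * (g x - g y)) + b * (cnd x y * (v x - v y) * (g x - g y))" for x y
    by (simp add: algebra_simps)
  then show ?thesis
    unfolding energy0_def by (simp add: sum.distrib sum_distrib_left[symmetric] distrib_left)
qed

lemma E0_nonneg: "0 \<le> E0 u u"
  unfolding energy0_def
  using cnd_nonneg by (auto intro!: sum_nonneg simp: mult.assoc)

lemma E0_edge:
  assumes "x \<in> V0" "y \<in> V0"
  shows "cnd x y * (u x - u y)\<^sup>2 \<le> 2 * E0 u u"
proof -
  have nn: "0 \<le> cnd x y * (u x - u y) * (u x - u y)" if "x \<in> V0" "y \<in> V0" for x y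
    using that cnd_nonneg by (auto simp: mult.assoc)
  have "cnd x y * (u x - u y) * (u x - u y) \<le> (\<Sum>y\<in>V0. cnd x y * (u x - u y) * (u x - u y))"
    using assms nn by (intro member_le_sum) auto
  also have "\<dots> \<le> (\<Sum>x\<in>V0. \<Sum>y\<in>V0. cnd x y * (u x - u y) * (u x - u y))"
    using assms nn by (intro member_le_sum[of x V0 "\<lambda>x. \<Sum>y\<in>V0. cnd x y * (u x - u y) * (u x - u y)"]) (auto intro!: sum_nonneg)
  finally show ?thesis by (simp add: energy0_def power2_eq_square mult.assoc)
qed

lemma En_0 [simp]: "En 0 u v = E0 u v"
  by (simp add: energy_level_def)

lemma En_Suc: "En (Suc n) u v = (\<Sum>j\<in>L. inverse (r j) * En n (u \<circ> F j) (v \<circ> F j))"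
  unfolding energy_level_def sum_words_len_Suc by (simp add: sum_distrib_left mult.assoc o_assoc)

lemma En_cong:
  "(\<And>x. x \<in> X \<Longrightarrow> u x = u' x) \<Longrightarrow> (\<And>x. x \<in> X \<Longrightarrow> v x = v' x) \<Longrightarrow> En n u v = En n u' v'"
proof (induction n arbitrary: u u' v v')
  case 0
  then show ?case by (auto intro: E0_cong)
next
  case (Suc n)
  then have "En n (u \<circ> F j) (v \<circ> F j) = En n (u' \<circ> F j) (v' \<circ> F j)" if "j \<in> L" for j
    by (intro Suc.IH) (simp_all add: Suc.prems that)
  then show ?case by (simp add: En_Suc)
qed

lemma En_sym: "En n u v = En n v u"
  by (induction n arbitrary: u v) (auto simp: En_Suc E0_sym)

lemma En_linear: "En n (\<lambda>x. a * u x + b * v x) g = a * En n u g + b * En n v g"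
proof (induction n arbitrary: u v g)
  case (Suc n)
  have "En n ((\<lambda>x. a * u x + b * v x) \<circ> F j) (g \<circ> F j) = a * En n (u \<circ> F j) (g \<circ> F j) + b * En n (v \<circ> F j) (g \<circ> F j)" for j
    using Suc[of "u \<circ> F j" "v \<circ> F j" "g \<circ> F j"] by (simp add: comp_def)
  then show ?case
    by (simp add: En_Suc sum.distrib sum_distrib_left algebra_simps)
qed (simp add: E0_linear)

lemma En_quadratic:
  "En n (\<lambda>x. a * u x + b * v x) (\<lambda>x. a * u x + b * v x) = a\<^sup>2 * En n u u + 2 * a * b * En n u v + b\<^sup>2 * En n v v"
  by (simp add: En_linear En_sym[of n _ "\<lambda>x. a * u x + b * v x"] En_sym[of n v u] algebra_simps power2_eq_square)

lemma En_nonneg: "0 \<le> En n u u"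
  by (induction n arbitrary: u) (auto simp: En_Suc E0_nonneg r_pos less_imp_le intro!: sum_nonneg)

lemma En_mono_Suc: "En n u u \<le> En (Suc n) u u"
proof (induction n arbitrary: u)
  case 0
  show ?case using E0_le_extension[of u u] by simp
next
  case (Suc n)
  show ?case
    unfolding En_Suc[of "Suc n"] En_Suc[of n] using r_pos Suc.IH
    by (intro sum_mono mult_left_mono) (auto simp: less_imp_le En_Suc[symmetric])
qed

lemma En_mono: "m \<le> n \<Longrightarrow> En m u u \<le> En n u u"
  using lift_Suc_mono_le[of "\<lambda>n. En n u u"] En_mono_Suc by blast

lemma En_comp_F_le:
  assumes "j \<in> L" shows "En n (u \<circ> F j) (u \<circ> F j) \<le> r j * En (Suc n) u u"
proof -
  have "inverse (r j) * En n (u \<circ> F j) (u \<circ> F j) \<le> En (Suc n) u u"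
    unfolding En_Suc using assms r_pos En_nonneg
    by (intro member_le_sum[of j L "\<lambda>j. inverse (r j) * En n (u \<circ> F j) (u \<circ> F j)"]) (auto simp: less_imp_le)
  then show ?thesis using r_pos[OF assms] by (simp add: field_simps)
qed

lemma dom_cong:
  assumes "\<And>x. x \<in> X \<Longrightarrow> u x = v x" "u \<in> D" shows "v \<in> D"
proof -
  have "continuous_on X v" using assms continuous_on_cong[of X X u v] by (simp add: dom_energy_def)
  moreover have "(\<lambda>n. En n v v) = (\<lambda>n. En n u u)" using assms by (intro ext En_cong) auto
  ultimately show ?thesis using assms by (simp add: dom_energy_def)
qed

lemma E_cong:
  "(\<And>x. x \<in> X \<Longrightarrow> u x = u' x) \<Longrightarrow> (\<And>x. x \<in> X \<Longrightarrow> v x = v' x) \<Longrightarrow> E u v = E u' v'"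
  unfolding energy_def using En_cong[of u u' v v'] by presburger

text \<open>Turns "zero energy only for constants" into a connectedness property of the fractal:
  constancy on each 1-cell annihilates the energy at every positive level. Values at shared vertices
  need no attention, since \<open>f\<close> is one function.\<close>

lemma locally_constant_imp_constant:
  fixes f :: "'a \<Rightarrow> real"
  assumes "\<And>j. j \<in> L \<Longrightarrow> \<exists>c. \<forall>x\<in>X. f (F j x) = c"
  shows "\<exists>k. \<forall>x\<in>X. f x = k"
proof -
  have En_const: "En n (\<lambda>x. c) (\<lambda>x. c) = 0" for n c
    by (induction n) (auto simp: En_Suc comp_def energy0_def)
  \<comment> \<open>Level 0 compares boundary points lying in different 1-cells and is left out; the
    limit does not see it.\<close>
  have zero: "En (Suc n) f f = 0" for n
  proof -
    have "En n (f \<circ> F j) (f \<circ> F j) = 0" if "j \<in> L" for j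
    proof -
      obtain c where "\<And>x. x \<in> X \<Longrightarrow> f (F j x) = c" using assms[OF \<open>j \<in> L\<close>] by blast
      then have "En n (f \<circ> F j) (f \<circ> F j) = En n (\<lambda>x. c) (\<lambda>x. c)" by (intro En_cong) auto
      then show ?thesis using En_const by simp
    qed
    then show ?thesis by (simp add: En_Suc)
  qed
  then have lim: "(\<lambda>n. En n f f) \<longlonglongrightarrow> 0"
    by (subst filterlim_sequentially_Suc[symmetric]) simp
  have "continuous_on X f"
  proof (rule continuous_on_glue)
    fix j assume "j \<in> L"
    then obtain c where "\<And>x. x \<in> X \<Longrightarrow> f (F j x) = c" using assms by blast
    then show "continuous_on X (f \<circ> F j)"
      using continuous_on_cong[of X X "f \<circ> F j" "\<lambda>x. c"] by simp
  qed
  then have "f \<in> D" using lim by (auto simp: dom_energy_def convergent_def)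
  moreover have "E f f = 0" unfolding energy_def using lim by (rule limI)
  ultimately show ?thesis using E_zero by blast
qed

lemma two_letters: "j \<in> L \<Longrightarrow> \<exists>k\<in>L. k \<noteq> j"
proof (rule ccontr)
  assume "j \<in> L" "\<not> (\<exists>k\<in>L. k \<noteq> j)"
  then have "L = {j}" by blast
  then show False using sum_weight weight_less_1[OF \<open>j \<in> L\<close>] by simp
qed

text \<open>Without boundary points the 1-cells would be disjoint, and the indicator of one of them
  would be locally constant but not constant.\<close>

lemma V0_nonempty: "V0 \<noteq> {}"
proof
  assume V0: "V0 = {}"
  obtain j k x where jk: "j \<in> L" "k \<in> L" "k \<noteq> j" "x \<in> X"
    using L_nonempty two_letters X_nonempty by blast
  have "\<exists>c. \<forall>x\<in>X. (of_bool (F l x \<in> F j ` X) :: real) = c" if "l \<in> L" for l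
  proof (cases "l = j")
    case False
    then have "F l x \<notin> F j ` X" if "x \<in> X" for x
      using F_inter(1)[of l j x] \<open>l \<in> L\<close> that jk V0 by auto
    then show ?thesis by (intro exI[of _ 0]) auto
  qed auto
  then obtain c where c: "\<And>x. x \<in> X \<Longrightarrow> (of_bool (x \<in> F j ` X) :: real) = c"
    using locally_constant_imp_constant[of "\<lambda>x. of_bool (x \<in> F j ` X)"] by blast
  have "F k x \<notin> F j ` X"
    using F_inter(1)[of k j x] jk V0 by auto
  then show False using c[of "F j x"] c[of "F k x"] jk by auto
qed

text \<open>Across an edge of positive conductance the bound is a single term of the energy. The
  indicator of a union of components has zero energy, so \<open>E0_zero\<close> gives
  connectedness.\<close>

lemma E0_oscillation: "\<exists>c\<ge>0. \<forall>u. \<forall>x\<in>V0. \<forall>y\<in>V0. \<bar>u x - u y\<bar> \<le> c * sqrt (E0 u u)"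
proof (rule oscillation_bound_connected[where R = "{(x, y). x \<in> V0 \<and> y \<in> V0 \<and> 0 < cnd x y}"])
  fix x y assume "(x, y) \<in> {(x, y). x \<in> V0 \<and> y \<in> V0 \<and> 0 < cnd x y}"
  then have xy: "x \<in> V0" "y \<in> V0" "0 < cnd x y" by auto
  have "\<bar>u x - u y\<bar> \<le> sqrt (2 / cnd x y) * sqrt (E0 u u)" for u
  proof -
    have "(u x - u y)\<^sup>2 \<le> 2 / cnd x y * E0 u u"
      using E0_edge[of x y u] xy by (simp add: field_simps)
    then have "sqrt ((u x - u y)\<^sup>2) \<le> sqrt (2 / cnd x y * E0 u u)" by (rule real_sqrt_le_mono)
    then show ?thesis by (simp only: real_sqrt_mult real_sqrt_abs)
  qed
  then show "\<exists>c\<ge>0. \<forall>u. \<bar>u x - u y\<bar> \<le> c * sqrt (E0 u u)"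
    using xy by (intro exI[of _ "sqrt (2 / cnd x y)"]) auto
next
  fix A assume A: "A \<subseteq> V0" "A \<noteq> {}"
    and closed: "\<And>x y. (x, y) \<in> {(x, y). x \<in> V0 \<and> y \<in> V0 \<and> 0 < cnd x y} \<Longrightarrow> x \<in> V0 \<Longrightarrow> y \<in> V0 \<Longrightarrow> x \<in> A \<longleftrightarrow> y \<in> A"
  define f :: "'a \<Rightarrow> real" where "f x = of_bool (x \<in> A)" for x
  have "cnd x y * (f x - f y) * (f x - f y) = 0" if "x \<in> V0" "y \<in> V0" for x y
    using closed[of x y] cnd_nonneg[OF that] that unfolding f_def by (cases "cnd x y = 0") auto
  then have "E0 f f = 0" unfolding energy0_def by (auto intro!: sum.neutral)
  then obtain k where "\<And>x. x \<in> V0 \<Longrightarrow> f x = k" using E0_zero by blast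
  then have "f x = f y" if "x \<in> V0" "y \<in> V0" for x y using that by simp
  then show "A = V0" using A unfolding f_def by (auto split: if_splits) (metis of_bool_eq_iff subsetD)
qed (auto simp: E0_nonneg)

text \<open>A connected component of the graph on \<open>V\<^sub>1\<close> determines a locally constant function on the fractal,
  which has zero energy and is therefore constant: the graph is connected.\<close>

lemma E1_oscillation: "\<exists>c\<ge>0. \<forall>u. \<forall>x\<in>V1. \<forall>y\<in>V1. \<bar>u x - u y\<bar> \<le> c * sqrt (En (Suc 0) u u)"
proof (rule oscillation_bound_connected[where R = "\<Union>j\<in>L. F j ` V0 \<times> F j ` V0"])
  fix x y assume "(x, y) \<in> (\<Union>j\<in>L. F j ` V0 \<times> F j ` V0)"
  then obtain j p q where j: "j \<in> L" "p \<in> V0" "q \<in> V0" "x = F j p" "y = F j q" by auto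
  obtain c where c: "c \<ge> 0" "\<And>u x y. x \<in> V0 \<Longrightarrow> y \<in> V0 \<Longrightarrow> \<bar>u x - u y\<bar> \<le> c * sqrt (E0 u u)"
    using E0_oscillation by blast
  have "\<bar>u x - u y\<bar> \<le> c * sqrt (En (Suc 0) u u)" for u
  proof -
    have "\<bar>u x - u y\<bar> \<le> c * sqrt (E0 (u \<circ> F j) (u \<circ> F j))"
      using c(2)[of p q "u \<circ> F j"] j by simp
    also have "E0 (u \<circ> F j) (u \<circ> F j) \<le> En (Suc 0) u u"
      using En_comp_F_le[OF j(1), of 0 u] mult_right_mono[OF less_imp_le[OF r_less_1[OF j(1)]], of "En (Suc 0) u u"] En_nonneg[of "Suc 0" u]
      by simp
    finally show ?thesis using c(1) by (simp add: mult_left_mono)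
  qed
  then show "\<exists>c\<ge>0. \<forall>u. \<bar>u x - u y\<bar> \<le> c * sqrt (En (Suc 0) u u)" using c(1) by blast
next
  fix A assume A: "A \<subseteq> V1" "A \<noteq> {}"
    and closed: "\<And>x y. (x, y) \<in> (\<Union>j\<in>L. F j ` V0 \<times> F j ` V0) \<Longrightarrow> x \<in> V1 \<Longrightarrow> y \<in> V1 \<Longrightarrow> x \<in> A \<longleftrightarrow> y \<in> A"
  have closed': "F j p \<in> A \<longleftrightarrow> F j ` V0 \<subseteq> A" if "j \<in> L" "p \<in> V0" for j p
  proof -
    have "F j p \<in> A \<longleftrightarrow> F j q \<in> A" if "q \<in> V0" for q
    proof (rule closed)
      show "(F j p, F j q) \<in> (\<Union>j\<in>L. F j ` V0 \<times> F j ` V0)" using that \<open>j \<in> L\<close> \<open>p \<in> V0\<close> by auto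
      show "F j p \<in> V1" "F j q \<in> V1" using that \<open>j \<in> L\<close> \<open>p \<in> V0\<close> by (auto simp: V1_eq)
    qed
    then show ?thesis unfolding image_subset_iff using that(2) by blast
  qed
  define f :: "'a \<Rightarrow> real" where "f x = of_bool (\<exists>j\<in>L. x \<in> F j ` X \<and> F j ` V0 \<subseteq> A)" for x
  have f: "f (F j x) = of_bool (F j ` V0 \<subseteq> A)" if "j \<in> L" "x \<in> X" for j x
  proof -
    \<comment> \<open>The existential in \<open>f\<close> may be witnessed by another 1-cell through
      the same point; that point is then a vertex, and \<open>closed'\<close> makes the two cells
      agree.\<close>
    have "F j ` V0 \<subseteq> A" if k: "k \<in> L" "F j x \<in> F k ` X" "F k ` V0 \<subseteq> A" for k
    proof (cases "j = k")
      case False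
      obtain y where y: "y \<in> X" "F j x = F k y" using k by auto
      then have "x \<in> V0" "y \<in> V0" using F_inter[of j k x y] that \<open>j \<in> L\<close> \<open>x \<in> X\<close> False by auto
      then show ?thesis using closed'[of j x] closed'[of k y] k y \<open>j \<in> L\<close> by auto
    qed (use k in auto)
    then show ?thesis unfolding f_def using that by auto
  qed
  then obtain c where c: "\<And>x. x \<in> X \<Longrightarrow> f x = c"
    using locally_constant_imp_constant[of f] by meson
  obtain a where a: "a \<in> A" using A by auto
  then have "a \<in> (\<Union>j\<in>L. F j ` V0)" using A by (auto simp: V1_eq)
  then obtain j p where j: "j \<in> L" "p \<in> V0" "F j p \<in> A" using a by auto
  then have "f (F j p) = 1" using f[of j p] closed'[of j p] by simp
  then have "f (F k q) = 1" if "k \<in> L" "q \<in> V0" for k q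
    using c[of "F j p"] c[of "F k q"] j that by simp
  then have "F k q \<in> A" if "k \<in> L" "q \<in> V0" for k q
    using f[of k q] that closed'[of k q] by (auto split: if_splits)
  then show "A = V1" using A by (auto simp: V1_eq)
qed (auto simp: En_nonneg)

definition \<rho> :: real where "\<rho> = Max (r ` L)"

lemma \<rho>: "0 < \<rho>" "\<rho> < 1" "j \<in> L \<Longrightarrow> r j \<le> \<rho>"
proof -
  have "\<rho> \<in> r ` L" unfolding \<rho>_def using L_nonempty by (intro Max_in) auto
  then show "0 < \<rho>" "\<rho> < 1" using r_pos r_less_1 by auto
  show "r j \<le> \<rho>" if "j \<in> L" using that by (simp add: \<rho>_def)
qed

lemma sqrt_\<rho>: "0 < sqrt \<rho>" "sqrt \<rho> < 1"
  using \<rho> by auto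

text \<open>The factor \<open>1 - sqrt \<rho>\<close> makes the oscillation bound on one level and the bound, contracted by
  \<open>sqrt \<rho>\<close>, on all deeper levels add up to \<open>K\<close> again.\<close>

definition K :: real where
  "K = (SOME K. 0 < K \<and> (\<forall>u. \<forall>x\<in>V0. \<forall>y\<in>V0. \<bar>u x - u y\<bar> \<le> K * sqrt (E0 u u)) \<and>
     (\<forall>u. \<forall>x\<in>V1. \<forall>y\<in>V1. \<bar>u x - u y\<bar> \<le> K * (1 - sqrt \<rho>) * sqrt (En (Suc 0) u u)))"

lemma K_pos: "0 < K"
  and K_V0: "x \<in> V0 \<Longrightarrow> y \<in> V0 \<Longrightarrow> \<bar>u x - u y\<bar> \<le> K * sqrt (E0 u u)"
  and K_V1: "x \<in> V1 \<Longrightarrow> y \<in> V1 \<Longrightarrow> \<bar>u x - u y\<bar> \<le> K * (1 - sqrt \<rho>) * sqrt (En (Suc 0) u u)"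
proof -
  obtain c0 where c0: "c0 \<ge> 0" "\<And>u x y. x \<in> V0 \<Longrightarrow> y \<in> V0 \<Longrightarrow> \<bar>u x - u y\<bar> \<le> c0 * sqrt (E0 u u)"
    using E0_oscillation by blast
  obtain c1 where c1: "c1 \<ge> 0" "\<And>u x y. x \<in> V1 \<Longrightarrow> y \<in> V1 \<Longrightarrow> \<bar>u x - u y\<bar> \<le> c1 * sqrt (En (Suc 0) u u)"
    using E1_oscillation by blast
  define k where "k = 1 + c0 + c1 / (1 - sqrt \<rho>)"
  have k: "0 < k" "c0 \<le> k" "c1 \<le> k * (1 - sqrt \<rho>)"
  proof -
    have nn: "0 \<le> c1 / (1 - sqrt \<rho>)" using c1(1) sqrt_\<rho> by simp
    then show "0 < k" "c0 \<le> k" using c0(1) by (simp_all add: k_def)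
    have "c1 = c1 / (1 - sqrt \<rho>) * (1 - sqrt \<rho>)" using sqrt_\<rho> by simp
    also have "\<dots> \<le> k * (1 - sqrt \<rho>)"
      using c0(1) sqrt_\<rho> by (intro mult_right_mono) (auto simp: k_def)
    finally show "c1 \<le> k * (1 - sqrt \<rho>)" .
  qed
  have "0 < k \<and> (\<forall>u. \<forall>x\<in>V0. \<forall>y\<in>V0. \<bar>u x - u y\<bar> \<le> k * sqrt (E0 u u)) \<and>
     (\<forall>u. \<forall>x\<in>V1. \<forall>y\<in>V1. \<bar>u x - u y\<bar> \<le> k * (1 - sqrt \<rho>) * sqrt (En (Suc 0) u u))"
  proof (intro conjI allI ballI)
    show "\<bar>u x - u y\<bar> \<le> k * sqrt (E0 u u)" if "x \<in> V0" "y \<in> V0" for u x y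
      using c0(2)[OF that, of u] mult_right_mono[OF k(2), of "sqrt (E0 u u)"] E0_nonneg[of u] by simp
    show "\<bar>u x - u y\<bar> \<le> k * (1 - sqrt \<rho>) * sqrt (En (Suc 0) u u)" if "x \<in> V1" "y \<in> V1" for u x y
      using c1(2)[OF that, of u] mult_right_mono[OF k(3), of "sqrt (En (Suc 0) u u)"] En_nonneg[of "Suc 0" u] by simp
  qed (fact k(1))
  then have *: "0 < K \<and> (\<forall>u. \<forall>x\<in>V0. \<forall>y\<in>V0. \<bar>u x - u y\<bar> \<le> K * sqrt (E0 u u)) \<and>
     (\<forall>u. \<forall>x\<in>V1. \<forall>y\<in>V1. \<bar>u x - u y\<bar> \<le> K * (1 - sqrt \<rho>) * sqrt (En (Suc 0) u u))"
    unfolding K_def by (rule someI)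
  then show "0 < K"
    "x \<in> V0 \<Longrightarrow> y \<in> V0 \<Longrightarrow> \<bar>u x - u y\<bar> \<le> K * sqrt (E0 u u)"
    "x \<in> V1 \<Longrightarrow> y \<in> V1 \<Longrightarrow> \<bar>u x - u y\<bar> \<le> K * (1 - sqrt \<rho>) * sqrt (En (Suc 0) u u)"
    by blast+
qed

lemma F_V0_V1 [simp, intro]: "j \<in> L \<Longrightarrow> q \<in> V0 \<Longrightarrow> F j q \<in> V1"
  by (auto simp: V1_eq)

lemma V0_V1 [simp, intro]: "q \<in> V0 \<Longrightarrow> q \<in> V1"
  using V0_subset_V1 by blast

text \<open>The common induction step of the oscillation estimates: \<open>e\<close> is the energy
  inside a 1-cell, \<open>e'\<close> the energy of the whole.\<close>

lemma sqrt_energy_step: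
  assumes "e \<le> r j * e'" "j \<in> L" "0 \<le> e'"
  shows "K * sqrt e + K * (1 - sqrt \<rho>) * sqrt e' \<le> K * sqrt e'"
proof -
  have "sqrt e \<le> sqrt (\<rho> * e')"
    using assms \<rho>(3)[OF assms(2)] mult_right_mono[OF \<rho>(3)[OF assms(2)] assms(3)] by simp
  then have "K * sqrt e \<le> K * (sqrt \<rho> * sqrt e')"
    using K_pos by (simp add: real_sqrt_mult)
  then show ?thesis by (simp add: algebra_simps)
qed

lemma vertex_oscillation:
  "w \<in> words_len S n \<Longrightarrow> q \<in> V0 \<Longrightarrow> q0 \<in> V0 \<Longrightarrow> \<bar>u (wmap S w q) - u q0\<bar> \<le> K * sqrt (En n u u)"
proof (induction n arbitrary: u w)
  case 0
  then show ?case using K_V0 by simp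
next
  case (Suc n)
  then obtain j w' where w: "w = j # w'" "j \<in> L" "w' \<in> words_len S n" by (auto simp: words_len_Suc)
  \<comment> \<open>The intermediate point \<open>F j q0\<close> is reached from
    \<open>wmap S w q\<close> inside the 1-cell of \<open>j\<close>, and from \<open>q0\<close>
    within \<open>V1\<close>.\<close>
  have "\<bar>u (wmap S w q) - u q0\<bar> \<le> \<bar>(u \<circ> F j) (wmap S w' q) - (u \<circ> F j) q0\<bar> + \<bar>u (F j q0) - u q0\<bar>"
    using w by simp
  also have "\<dots> \<le> K * sqrt (En n (u \<circ> F j) (u \<circ> F j)) + K * (1 - sqrt \<rho>) * sqrt (En (Suc 0) u u)"
    using Suc.prems w by (intro add_mono K_V1 Suc.IH) auto
  also have "\<dots> \<le> K * sqrt (En n (u \<circ> F j) (u \<circ> F j)) + K * (1 - sqrt \<rho>) * sqrt (En (Suc n) u u)"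
    using K_pos sqrt_\<rho> En_mono[of "Suc 0" "Suc n" u] by (intro add_left_mono mult_left_mono) auto
  also have "\<dots> \<le> K * sqrt (En (Suc n) u u)"
    by (rule sqrt_energy_step[OF En_comp_F_le]) (use w En_nonneg in auto)
  finally show ?case .
qed

section \<open>The energy form\<close>

lemma D_continuous: "u \<in> D \<Longrightarrow> continuous_on X u"
  by (simp add: dom_energy_def)

lemma D_lin: "u \<in> D \<Longrightarrow> v \<in> D \<Longrightarrow> (\<lambda>x. a * u x + b * v x) \<in> D"
  and E_lin: "u \<in> D \<Longrightarrow> v \<in> D \<Longrightarrow> g \<in> D \<Longrightarrow> E (\<lambda>x. a * u x + b * v x) g = a * E u g + b * E v g"
  and E_sym: "u \<in> D \<Longrightarrow> v \<in> D \<Longrightarrow> E u v = E v u"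
  and E_nonneg: "u \<in> D \<Longrightarrow> 0 \<le> E u u"
  and D_zero [simp]: "(\<lambda>x. 0) \<in> D"
  using dirichlet_form_E unfolding dirichlet_form_def by blast+

lemma D_add: "u \<in> D \<Longrightarrow> v \<in> D \<Longrightarrow> (\<lambda>x. u x + v x) \<in> D"
  and D_diff: "u \<in> D \<Longrightarrow> v \<in> D \<Longrightarrow> (\<lambda>x. u x - v x) \<in> D"
  and D_scale: "u \<in> D \<Longrightarrow> (\<lambda>x. a * u x) \<in> D"
  using D_lin[of u v 1 1] D_lin[of u v 1 "-1"] D_lin[of u "\<lambda>x. 0" a 0] by simp_all

lemma E_add: "u \<in> D \<Longrightarrow> v \<in> D \<Longrightarrow> g \<in> D \<Longrightarrow> E (\<lambda>x. u x + v x) g = E u g + E v g"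
  and E_diff: "u \<in> D \<Longrightarrow> v \<in> D \<Longrightarrow> g \<in> D \<Longrightarrow> E (\<lambda>x. u x - v x) g = E u g - E v g"
  and E_scale: "u \<in> D \<Longrightarrow> g \<in> D \<Longrightarrow> E (\<lambda>x. a * u x) g = a * E u g"
  using E_lin[of u v g 1 1] E_lin[of u v g 1 "-1"] E_lin[of u "\<lambda>x. 0" g a 0] by simp_all

lemma E_quadratic:
  assumes "u \<in> D" "v \<in> D"
  shows "E2 (\<lambda>x. a * u x + b * v x) = a\<^sup>2 * E u u + 2 * a * b * E u v + b\<^sup>2 * E v v"
  using assms D_lin[OF assms, of a b]
  by (simp add: E_lin E_sym[of _ "\<lambda>x. a * u x + b * v x"] E_sym[of v u] algebra_simps power2_eq_square)

lemma E_Cauchy_Schwarz: "u \<in> D \<Longrightarrow> v \<in> D \<Longrightarrow> \<bar>E u v\<bar> \<le> sqrt (E u u) * sqrt (E v v)"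
  using E_quadratic[of u v] E_nonneg[OF D_lin[of u v]]
  by (intro quadratic_form_Cauchy_Schwarz) (metis mult.assoc)

text \<open>\<open>energy\<close> is a bare \<open>lim\<close>, while membership in \<open>D\<close>
  gives convergence for equal arguments only; polarisation covers the mixed ones.\<close>

lemma E_limit:
  assumes "u \<in> D" "v \<in> D" shows "(\<lambda>n. En n u v) \<longlonglongrightarrow> E u v"
proof -
  have conv: "(\<lambda>n. En n u u) \<longlonglongrightarrow> lim (\<lambda>n. En n u u)" if "u \<in> D" for u
    using that by (simp add: dom_energy_def convergent_LIMSEQ_iff)
  have "convergent (\<lambda>n. (En n (\<lambda>x. 1 * u x + 1 * v x) (\<lambda>x. 1 * u x + 1 * v x) - En n u u - En n v v) / 2)"
    using tendsto_divide[OF tendsto_diff[OF tendsto_diff[OF conv[OF D_lin[OF assms, of 1 1]] conv[OF assms(1)]] conv[OF assms(2)]] tendsto_const[of 2]]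
    by (intro convergentI) simp
  moreover have "(En n (\<lambda>x. 1 * u x + 1 * v x) (\<lambda>x. 1 * u x + 1 * v x) - En n u u - En n v v) / 2 = En n u v" for n
    unfolding En_quadratic by simp
  ultimately show ?thesis by (simp add: energy_def convergent_LIMSEQ_iff)
qed

lemma En_le_E: "u \<in> D \<Longrightarrow> En n u u \<le> E u u"
  using E_limit[of u u] En_mono[of n _ u] by (intro LIMSEQ_le_const[of "\<lambda>n. En n u u"]) auto

lemma E_self_similar:
  assumes "u \<in> D" "v \<in> D"
  shows "E u v = (\<Sum>j\<in>L. inverse (r j) * E (u \<circ> F j) (v \<circ> F j))"
proof -
  have "(\<lambda>n. En (Suc n) u v) \<longlonglongrightarrow> E u v"
    using E_limit[OF assms] by (rule LIMSEQ_Suc)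
  moreover have "(\<lambda>n. En (Suc n) u v) \<longlonglongrightarrow> (\<Sum>j\<in>L. inverse (r j) * E (u \<circ> F j) (v \<circ> F j))"
    unfolding En_Suc using assms by (intro tendsto_intros E_limit D_comp_F)
  ultimately show ?thesis by (rule LIMSEQ_unique)
qed

text \<open>Level \<open>n + 1\<close> of \<open>u\<close> is a weighted sum of level
  \<open>n\<close> of its pieces, so convergence can be checked piecewise.\<close>

lemma D_glue:
  assumes "\<And>j. j \<in> L \<Longrightarrow> u \<circ> F j \<in> D"
  shows "u \<in> D"
proof -
  have "(\<lambda>n. En (Suc n) u u) \<longlonglongrightarrow> (\<Sum>j\<in>L. inverse (r j) * E (u \<circ> F j) (u \<circ> F j))"
    unfolding En_Suc by (intro tendsto_intros E_limit assms)
  then have "(\<lambda>n. En n u u) \<longlonglongrightarrow> (\<Sum>j\<in>L. inverse (r j) * E (u \<circ> F j) (u \<circ> F j))"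
    by (rule LIMSEQ_imp_Suc)
  then have "convergent (\<lambda>n. En n u u)"
    by (rule convergentI)
  moreover have "continuous_on X u"
    by (rule continuous_on_glue, rule D_continuous, rule assms)
  ultimately show ?thesis by (simp add: dom_energy_def)
qed

text \<open>The cells through \<open>x\<close> shrink to \<open>x\<close> and each contains the
  vertex \<open>wmap S (w n) q\<close>, so the bound for vertices passes to \<open>x\<close> by
  continuity.\<close>

lemma oscillation:
  assumes "u \<in> D" "x \<in> X" "q \<in> V0"
  shows "\<bar>u x - u q\<bar> \<le> K * sqrt (E u u)"
proof -
  obtain \<theta> d where \<theta>: "0 < \<theta>" "\<theta> < 1"
    "\<And>w x y. w \<in> words S \<Longrightarrow> x \<in> cell S w \<Longrightarrow> y \<in> cell S w \<Longrightarrow> dist x y \<le> \<theta> ^ length w * d"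
    using cell_diameter by metis
  have "\<forall>n. \<exists>w. w \<in> words_len S n \<and> x \<in> cell S w"
    using cells_cover assms(2) by blast
  then obtain w where w: "\<And>n. w n \<in> words_len S n" "\<And>n. x \<in> cell S (w n)" by metis
  define y where "y n = wmap S (w n) q" for n
  have y: "y n \<in> X" for n
    unfolding y_def using w(1)[of n] assms by (auto simp: words_len_def)
  have "(\<lambda>n. dist (y n) x) \<longlonglongrightarrow> 0"
  proof (rule Lim_null_comparison)
    show "(\<lambda>n. \<theta> ^ n * d) \<longlonglongrightarrow> 0"
      using \<theta> by (intro tendsto_mult_left_zero LIMSEQ_realpow_zero) auto
    have "dist (y n) x \<le> \<theta> ^ n * d" for n
      using \<theta>(3)[of "w n" "y n" x] w[of n] assms by (auto simp: y_def words_len_def cell_def)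
    then show "\<forall>\<^sub>F n in sequentially. norm (dist (y n) x) \<le> \<theta> ^ n * d" by simp
  qed
  then have "y \<longlonglongrightarrow> x" by (rule tendsto_dist_iff[THEN iffD2])
  then have "(\<lambda>n. u (y n)) \<longlonglongrightarrow> u x"
    using D_continuous[OF assms(1)] assms(2) y
    by (intro continuous_on_tendsto_compose[of X u y x]) auto
  then have lim: "(\<lambda>n. \<bar>u (y n) - u q\<bar>) \<longlonglongrightarrow> \<bar>u x - u q\<bar>" by (intro tendsto_intros)
  have "\<bar>u (y n) - u q\<bar> \<le> K * sqrt (E u u)" for n
  proof -
    have "\<bar>u (y n) - u q\<bar> \<le> K * sqrt (En n u u)"
      unfolding y_def using vertex_oscillation w assms by blast
    also have "\<dots> \<le> K * sqrt (E u u)"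
      using K_pos En_le_E[OF assms(1)] by simp
    finally show ?thesis .
  qed
  then show ?thesis using lim by (intro LIMSEQ_le_const2) auto
qed

section \<open>Harmonic functions\<close>

text \<open>One step of harmonic extension: \<open>E0 a a\<close> is the minimum of
  \<open>En (Suc 0)\<close> over all functions with boundary values \<open>a\<close>.\<close>

definition extension :: "('a \<Rightarrow> real) \<Rightarrow> 'a \<Rightarrow> real" where
  "extension a = (SOME v. (\<forall>x\<in>V0. v x = a x) \<and> En (Suc 0) v v = E0 a a)"

lemma extension_V0 [simp]: "q \<in> V0 \<Longrightarrow> extension a q = a q"
  and En_extension: "En (Suc 0) (extension a) (extension a) = E0 a a"
  using someI_ex[OF extension_exists[of a]] by (auto simp: extension_def)

text \<open>Performs \<open>n\<close> extension steps and then fills the interior of each cell with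
  one of the cell's boundary values; with such a default the oscillation bound \<open>K_V0\<close>
  applies already at level 0.\<close>

fun harm_approx :: "nat \<Rightarrow> ('a \<Rightarrow> real) \<Rightarrow> 'a \<Rightarrow> real" where
  "harm_approx 0 a = (\<lambda>x. if x \<in> V0 then a x else a (SOME q. q \<in> V0))"
| "harm_approx (Suc n) a = glue (\<lambda>j. harm_approx n (extension a \<circ> F j))"

lemma harm_approx_V0 [simp]: "q \<in> V0 \<Longrightarrow> harm_approx n a q = a q"
proof (induction n arbitrary: a q)
  case (Suc n)
  let ?i = "fixing_letter S q"
  have "harm_approx (Suc n) a (F ?i q) = harm_approx n (extension a \<circ> F ?i) q"
    unfolding harm_approx.simps
    by (rule glue_F[where \<phi> = "extension a"]) (use Suc fixing_letter in auto)
  then show ?case using Suc fixing_letter[of q] by simp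
qed simp

lemma harm_approx_F [simp]:
  "j \<in> L \<Longrightarrow> x \<in> X \<Longrightarrow> harm_approx (Suc n) a (F j x) = harm_approx n (extension a \<circ> F j) x"
  unfolding harm_approx.simps by (rule glue_F[where \<phi> = "extension a"]) auto

lemma E0_extension_le: "j \<in> L \<Longrightarrow> E0 (extension a \<circ> F j) (extension a \<circ> F j) \<le> r j * E0 a a"
  using En_comp_F_le[of j 0 "extension a"] by (simp add: En_extension)

lemma harm_approx_oscillation:
  "x \<in> X \<Longrightarrow> q \<in> V0 \<Longrightarrow> \<bar>harm_approx n a x - a q\<bar> \<le> K * sqrt (E0 a a)"
proof (induction n arbitrary: a x)
  case 0
  have "(SOME q. q \<in> V0) \<in> V0" using V0_nonempty some_in_eq by blast
  then show ?case using 0 K_V0 by auto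
next
  case (Suc n)
  obtain j y where j: "j \<in> L" "y \<in> X" "x = F j y" using Suc.prems X_cases by blast
  have "\<bar>harm_approx (Suc n) a x - a q\<bar> \<le> \<bar>harm_approx n (extension a \<circ> F j) y - (extension a \<circ> F j) q\<bar> + \<bar>extension a (F j q) - extension a q\<bar>"
    using j Suc.prems by (simp del: harm_approx.simps)
  also have "\<dots> \<le> K * sqrt (E0 (extension a \<circ> F j) (extension a \<circ> F j)) + K * (1 - sqrt \<rho>) * sqrt (E0 a a)"
    using K_V1[of "F j q" q "extension a"] Suc.prems j by (intro add_mono Suc.IH) (auto simp: En_extension)
  also have "\<dots> \<le> K * sqrt (E0 a a)"
    using E0_extension_le E0_nonneg j by (intro sqrt_energy_step) auto
  finally show ?case .
qed

lemma sqrt_E0_extension_le: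
  assumes "j \<in> L"
  shows "sqrt (\<rho> ^ n) * sqrt (E0 (extension a \<circ> F j) (extension a \<circ> F j)) \<le> sqrt (\<rho> ^ Suc n) * sqrt (E0 a a)"
proof -
  have "E0 (extension a \<circ> F j) (extension a \<circ> F j) \<le> \<rho> * E0 a a"
    using E0_extension_le[OF assms, of a] mult_right_mono[OF \<rho>(3)[OF assms] E0_nonneg[of a]] by simp
  then have "sqrt (E0 (extension a \<circ> F j) (extension a \<circ> F j)) \<le> sqrt \<rho> * sqrt (E0 a a)"
    by (metis real_sqrt_le_mono real_sqrt_mult)
  then have "sqrt (\<rho> ^ n) * sqrt (E0 (extension a \<circ> F j) (extension a \<circ> F j)) \<le> sqrt (\<rho> ^ n) * (sqrt \<rho> * sqrt (E0 a a))"
    using \<rho> by (intro mult_left_mono) auto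
  also have "\<dots> = sqrt (\<rho> ^ Suc n) * sqrt (E0 a a)" by (simp add: real_sqrt_mult)
  finally show ?thesis .
qed

text \<open>After \<open>n\<close> common extension steps the data on a cell have energy at most
  \<open>\<rho> ^ n * E0 a a\<close>. There both approximations stay within \<open>K\<close> times
  its root of one boundary value, whence the factor 2.\<close>

lemma harm_approx_Cauchy:
  "x \<in> X \<Longrightarrow> \<bar>harm_approx n a x - harm_approx (n + k) a x\<bar> \<le> 2 * K * (sqrt (\<rho> ^ n) * sqrt (E0 a a))"
proof (induction n arbitrary: a x)
  case 0
  obtain q where "q \<in> V0" using V0_nonempty by blast
  then show ?case
    using harm_approx_oscillation[of x q 0 a] harm_approx_oscillation[of x q k a] 0 by simp
next
  case (Suc n)
  obtain j y where j: "j \<in> L" "y \<in> X" "x = F j y" using Suc.prems X_cases by blast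
  let ?b = "extension a \<circ> F j"
  have "\<bar>harm_approx (Suc n) a x - harm_approx (Suc n + k) a x\<bar> \<le> 2 * K * (sqrt (\<rho> ^ n) * sqrt (E0 ?b ?b))"
    using Suc.IH[of y ?b] j by (simp add: comp_def del: harm_approx.simps)
  also have "\<dots> \<le> 2 * K * (sqrt (\<rho> ^ Suc n) * sqrt (E0 a a))"
    using K_pos by (intro mult_left_mono sqrt_E0_extension_le j) auto
  finally show ?case .
qed

definition harm :: "('a \<Rightarrow> real) \<Rightarrow> 'a \<Rightarrow> real" where
  "harm a x = lim (\<lambda>n. harm_approx n a x)"

lemma sqrt_\<rho>_power_0: "(\<lambda>n. sqrt (\<rho> ^ n)) \<longlonglongrightarrow> 0"
  using \<rho> by (simp add: real_sqrt_power LIMSEQ_power_zero)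

lemma harm_limit:
  assumes "x \<in> X" shows "(\<lambda>n. harm_approx n a x) \<longlonglongrightarrow> harm a x"
proof -
  have "Cauchy (\<lambda>n. harm_approx n a x)"
  proof (rule metric_CauchyI)
    fix e :: real assume "e > 0"
    have "(\<lambda>n. 2 * K * (sqrt (\<rho> ^ n) * sqrt (E0 a a))) \<longlonglongrightarrow> 2 * K * (0 * sqrt (E0 a a))"
      by (intro tendsto_intros sqrt_\<rho>_power_0)
    then have "\<forall>\<^sub>F n in sequentially. 2 * K * (sqrt (\<rho> ^ n) * sqrt (E0 a a)) < e / 2"
      using \<open>e > 0\<close> by (intro order_tendstoD(2)) auto
    then obtain N where N: "2 * K * (sqrt (\<rho> ^ N) * sqrt (E0 a a)) < e / 2"
      by (auto simp: eventually_sequentially)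
    have "\<bar>harm_approx N a x - harm_approx m a x\<bar> < e / 2" if "m \<ge> N" for m
      using harm_approx_Cauchy[OF assms, of N a "m - N"] that N by simp
    then show "\<exists>N. \<forall>m\<ge>N. \<forall>n\<ge>N. dist (harm_approx m a x) (harm_approx n a x) < e"
      by (intro exI[of _ N]) (smt (verit) dist_real_def field_sum_of_halves)
  qed
  then show ?thesis by (simp add: harm_def Cauchy_convergent_iff convergent_LIMSEQ_iff)
qed

lemma harm_V0 [simp]: "q \<in> V0 \<Longrightarrow> harm a q = a q"
  by (simp add: harm_def)

lemma harm_F [simp]:
  assumes "j \<in> L" "x \<in> X" shows "harm a (F j x) = harm (extension a \<circ> F j) x"
proof -
  have "(\<lambda>n. harm_approx (Suc n) a (F j x)) \<longlonglongrightarrow> harm a (F j x)"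
    using harm_limit[of "F j x" a] assms by (intro LIMSEQ_Suc) auto
  then have "(\<lambda>n. harm_approx n (extension a \<circ> F j) x) \<longlonglongrightarrow> harm a (F j x)"
    using assms by (simp del: harm_approx.simps)
  then show ?thesis using harm_limit[OF assms(2)] LIMSEQ_unique by blast
qed

lemma harm_oscillation:
  assumes "x \<in> X" "q \<in> V0" shows "\<bar>harm a x - a q\<bar> \<le> K * sqrt (E0 a a)"
proof -
  have "(\<lambda>n. \<bar>harm_approx n a x - a q\<bar>) \<longlonglongrightarrow> \<bar>harm a x - a q\<bar>"
    using harm_limit[OF assms(1)] by (intro tendsto_intros)
  then show ?thesis using harm_approx_oscillation assms by (intro LIMSEQ_le_const2) auto
qed

lemma harm_cell_oscillation:
  "w \<in> words_len S n \<Longrightarrow> x \<in> X \<Longrightarrow> y \<in> X \<Longrightarrow>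
     \<bar>harm a (wmap S w x) - harm a (wmap S w y)\<bar> \<le> 2 * K * (sqrt (\<rho> ^ n) * sqrt (E0 a a))"
proof (induction n arbitrary: a w)
  case 0
  obtain q where "q \<in> V0" using V0_nonempty by blast
  then show ?case using 0 harm_oscillation[of x q a] harm_oscillation[of y q a] by simp
next
  case (Suc n)
  then obtain j w' where w: "w = j # w'" "j \<in> L" "w' \<in> words_len S n" by (auto simp: words_len_Suc)
  let ?b = "extension a \<circ> F j"
  have "wmap S w' x \<in> X" "wmap S w' y \<in> X" using w Suc.prems by (auto simp: words_len_def)
  then have "\<bar>harm a (wmap S w x) - harm a (wmap S w y)\<bar> \<le> 2 * K * (sqrt (\<rho> ^ n) * sqrt (E0 ?b ?b))"
    using Suc.IH[OF w(3), of ?b] Suc.prems w by (simp add: comp_def)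
  also have "\<dots> \<le> 2 * K * (sqrt (\<rho> ^ Suc n) * sqrt (E0 a a))"
    using K_pos by (intro mult_left_mono sqrt_E0_extension_le w) auto
  finally show ?case .
qed

text \<open>Every extension step attains the minimum and so preserves the energy. The level energies
  are therefore constant, which puts \<open>harm a\<close> into \<open>D\<close>.\<close>

lemma En_harm: "En n (harm a) (harm a) = E0 a a"
proof (induction n arbitrary: a)
  case 0
  show ?case by (auto intro: E0_cong)
next
  case (Suc n)
  have "En (Suc n) (harm a) (harm a) = (\<Sum>j\<in>L. inverse (r j) * En n (harm (extension a \<circ> F j)) (harm (extension a \<circ> F j)))"
    unfolding En_Suc by (intro sum.cong refl arg_cong[where f = "\<lambda>x. _ * x"] En_cong) auto
  also have "\<dots> = En (Suc 0) (extension a) (extension a)"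
    by (simp add: Suc.IH En_Suc comp_def)
  finally show ?case by (simp add: En_extension)
qed

lemma harm_D [simp]: "harm a \<in> D"
proof -
  have "continuous_on X (harm a)"
  proof (rule continuous_on_X_cells)
    fix e :: real assume "e > 0"
    have "(\<lambda>n. 2 * K * (sqrt (\<rho> ^ n) * sqrt (E0 a a))) \<longlonglongrightarrow> 2 * K * (0 * sqrt (E0 a a))"
      by (intro tendsto_intros sqrt_\<rho>_power_0)
    then have "\<forall>\<^sub>F n in sequentially. 2 * K * (sqrt (\<rho> ^ n) * sqrt (E0 a a)) < e"
      using \<open>e > 0\<close> by (intro order_tendstoD(2)) auto
    then obtain n where n: "2 * K * (sqrt (\<rho> ^ n) * sqrt (E0 a a)) < e"
      by (auto simp: eventually_sequentially)
    show "\<exists>n. \<forall>w\<in>words_len S n. \<forall>x\<in>cell S w. \<forall>y\<in>cell S w. \<bar>harm a x - harm a y\<bar> < e"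
    proof (intro exI[of _ n] ballI)
      fix w x y assume "w \<in> words_len S n" "x \<in> cell S w" "y \<in> cell S w"
      then show "\<bar>harm a x - harm a y\<bar> < e"
        using harm_cell_oscillation[of w n _ _ a] n by (fastforce simp: cell_def)
    qed
  qed
  then show ?thesis by (simp add: dom_energy_def En_harm convergent_const)
qed

text \<open>Perturbing the minimiser \<open>harm a\<close> of \<open>En n\<close> in the direction of \<open>v\<close> shows that the two bilinear
  forms agree on it.\<close>

lemma E_harm:
  assumes "v \<in> D" shows "E (harm a) v = E0 a v"
proof -
  have "En n (harm a) v = E0 a v" for n
  proof -
    have "0 \<le> 2 * t * (En n (harm a) v - E0 a v) + t\<^sup>2 * (En n v v - E0 v v)" for t
    proof -
      have "E0 (\<lambda>x. 1 * harm a x + t * v x) (\<lambda>x. 1 * harm a x + t * v x) \<le> En n (\<lambda>x. 1 * harm a x + t * v x) (\<lambda>x. 1 * harm a x + t * v x)"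
        using En_mono[of 0 n] by simp
      then show ?thesis
        using En_quadratic[of n 1 "harm a" t v] En_quadratic[of 0 1 "harm a" t v] En_harm[of n a] En_harm[of 0 a]
          E0_cong[of "harm a" a v v] by (simp add: algebra_simps)
    qed
    then show ?thesis using linear_perturbation_nonneg by fastforce
  qed
  then show ?thesis using E_limit[OF harm_D assms, of a] LIMSEQ_unique by (metis (no_types, lifting) ext tendsto_const)
qed

section \<open>Completeness and the Riesz representation\<close>

definition D0 :: "('a \<Rightarrow> real) set" where
  "D0 = {u \<in> D. \<forall>q\<in>V0. u q = 0}"

lemma D0_D: "u \<in> D0 \<Longrightarrow> u \<in> D" and D0_V0: "u \<in> D0 \<Longrightarrow> q \<in> V0 \<Longrightarrow> u q = 0"
  by (auto simp: D0_def)

lemma D0_lin: "u \<in> D0 \<Longrightarrow> v \<in> D0 \<Longrightarrow> (\<lambda>x. a * u x + b * v x) \<in> D0"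
  and D0_diff: "u \<in> D0 \<Longrightarrow> v \<in> D0 \<Longrightarrow> (\<lambda>x. u x - v x) \<in> D0"
  and D0_zero: "(\<lambda>x. 0) \<in> D0"
  by (auto simp: D0_def D_lin D_diff)

lemma E_diff_self: "u \<in> D \<Longrightarrow> v \<in> D \<Longrightarrow> E2 (\<lambda>x. u x - v x) = E u u - 2 * E u v + E v v"
  using E_quadratic[of u v 1 "-1"] by simp

lemma D0_sup: "u \<in> D0 \<Longrightarrow> x \<in> X \<Longrightarrow> \<bar>u x\<bar> \<le> K * sqrt (E u u)"
  using V0_nonempty oscillation[of u x] D0_D D0_V0 by (metis diff_zero ex_in_conv)

lemma D_square_integrable: "u \<in> D \<Longrightarrow> integrable M (\<lambda>x. (u x)\<^sup>2)"
  using D_continuous by (intro integrable_continuous_on continuous_intros) auto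

lemma D0_square_integral:
  assumes "u \<in> D0" shows "(\<integral>x. (u x)\<^sup>2 \<partial>M) \<le> K\<^sup>2 * E u u"
proof -
  have "(\<integral>x. (u x)\<^sup>2 \<partial>M) \<le> (\<integral>x. K\<^sup>2 * E u u \<partial>M)"
  proof (rule integral_mono)
    fix x assume "x \<in> space M"
    then have "\<bar>u x\<bar> \<le> K * sqrt (E u u)" using D0_sup[OF assms] by simp
    then show "(u x)\<^sup>2 \<le> K\<^sup>2 * E u u"
      using E_nonneg[OF D0_D[OF assms]] by (rule square_le_of_abs_le_sqrt)
  qed (use D_square_integrable D0_D assms in auto)
  then show ?thesis by simp
qed

text \<open>The value at \<open>x\<close> is compared with every \<open>u y\<close>, through a
  boundary point, and the result is integrated over \<open>y\<close>. It serves for limits that are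
  not yet known to vanish on \<open>V0\<close>.\<close>

lemma D_sup_square:
  assumes "u \<in> D" "x \<in> X"
  shows "(u x)\<^sup>2 \<le> 2 * (\<integral>y. (u y)\<^sup>2 \<partial>M) + 8 * K\<^sup>2 * E u u"
proof -
  obtain q where q: "q \<in> V0" using V0_nonempty by blast
  have "(u x)\<^sup>2 \<le> 2 * (u y)\<^sup>2 + 8 * K\<^sup>2 * E u u" if "y \<in> X" for y
  proof -
    have "\<bar>u x - u y\<bar> \<le> 2 * K * sqrt (E u u)"
      using oscillation[OF assms q] oscillation[OF assms(1) that q] by simp
    then have "(u x - u y)\<^sup>2 \<le> (2 * K)\<^sup>2 * E u u"
      using E_nonneg[OF assms(1)] by (rule square_le_of_abs_le_sqrt)
    then have "(u x - u y)\<^sup>2 \<le> 4 * K\<^sup>2 * E u u" by (simp add: power_mult_distrib)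
    moreover have "(u x)\<^sup>2 \<le> 2 * (u y)\<^sup>2 + 2 * (u x - u y)\<^sup>2"
      using zero_le_power2[of "u x - 2 * u y"] by (simp add: power2_eq_square algebra_simps)
    ultimately show ?thesis by simp
  qed
  then have "(\<integral>y. (u x)\<^sup>2 \<partial>M) \<le> (\<integral>y. 2 * (u y)\<^sup>2 + 8 * K\<^sup>2 * E u u \<partial>M)"
    using D_square_integrable[OF assms(1)] by (intro integral_mono) auto
  then show ?thesis using D_square_integrable[OF assms(1)] by simp
qed

text \<open>On \<open>D0\<close> the energy dominates the integral of the square, so the sequence is
  Cauchy in the combined norm and closedness of the Dirichlet form provides \<open>u\<close>. Point
  evaluation is continuous in that norm by \<open>D_sup_square\<close>, so \<open>u\<close> vanishes
  on \<open>V0\<close>.\<close>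

lemma D0_complete:
  assumes s: "\<And>n. s n \<in> D0"
    and Cauchy: "\<And>e. e > 0 \<Longrightarrow> \<exists>N. \<forall>m\<ge>N. \<forall>n\<ge>N. E2 (\<lambda>x. s m x - s n x) < e"
  shows "\<exists>u\<in>D0. (\<lambda>n. E2 (\<lambda>x. s n x - u x)) \<longlonglongrightarrow> 0"
proof -
  have "\<exists>N. \<forall>m\<ge>N. \<forall>n\<ge>N. E2 (\<lambda>x. s m x - s n x) + (\<integral>x. (s m x - s n x)\<^sup>2 \<partial>M) < e" if "e > 0" for e
  proof -
    have pos: "0 < 1 + K\<^sup>2" by (simp add: add_pos_nonneg)
    then have "e / (1 + K\<^sup>2) > 0" using that by simp
    then obtain N where N: "\<And>m n. m \<ge> N \<Longrightarrow> n \<ge> N \<Longrightarrow> E2 (\<lambda>x. s m x - s n x) < e / (1 + K\<^sup>2)"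
      using Cauchy by blast
    have "E2 (\<lambda>x. s m x - s n x) + (\<integral>x. (s m x - s n x)\<^sup>2 \<partial>M) < e" if "m \<ge> N" "n \<ge> N" for m n
    proof -
      have "E2 (\<lambda>x. s m x - s n x) + (\<integral>x. (s m x - s n x)\<^sup>2 \<partial>M)
        \<le> (1 + K\<^sup>2) * E2 (\<lambda>x. s m x - s n x)"
        using D0_square_integral[OF D0_diff[OF s s], of m n] by (simp add: algebra_simps)
      also have "\<dots> < e" using N[OF that] pos by (simp add: field_simps)
      finally show ?thesis .
    qed
    then show ?thesis by blast
  qed
  moreover have "\<forall>n. s n \<in> D" using s D0_D by blast
  ultimately obtain u where u: "u \<in> D"
    "(\<lambda>n. E2 (\<lambda>x. s n x - u x) + (\<integral>x. (s n x - u x)\<^sup>2 \<partial>M)) \<longlonglongrightarrow> 0"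
    using dirichlet_form_E[unfolded dirichlet_form_def, THEN conjunct2, THEN conjunct2, THEN conjunct2, THEN conjunct2,
        THEN conjunct2, THEN conjunct2, THEN conjunct2, THEN conjunct1, THEN spec, of s] by blast
  have dD: "(\<lambda>x. s n x - u x) \<in> D" for n using s u D0_D D_diff by blast
  have nonneg: "0 \<le> E2 (\<lambda>x. s n x - u x)" "0 \<le> (\<integral>x. (s n x - u x)\<^sup>2 \<partial>M)" for n
    using E_nonneg[OF dD] by auto
  have E0: "(\<lambda>n. E2 (\<lambda>x. s n x - u x)) \<longlonglongrightarrow> 0"
    by (rule Lim_null_comparison[OF _ u(2)]) (use nonneg in auto)
  have I0: "(\<lambda>n. (\<integral>x. (s n x - u x)\<^sup>2 \<partial>M)) \<longlonglongrightarrow> 0"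
    by (rule Lim_null_comparison[OF _ u(2)]) (use nonneg in auto)
  have "u q = 0" if "q \<in> V0" for q
  proof -
    have "(\<lambda>n. 2 * (\<integral>x. (s n x - u x)\<^sup>2 \<partial>M) + 8 * K\<^sup>2 * E2 (\<lambda>x. s n x - u x)) \<longlonglongrightarrow> 2 * 0 + 8 * K\<^sup>2 * 0"
      by (intro tendsto_intros E0 I0)
    moreover have "(u q)\<^sup>2 \<le> 2 * (\<integral>x. (s n x - u x)\<^sup>2 \<partial>M) + 8 * K\<^sup>2 * E2 (\<lambda>x. s n x - u x)" for n
      using D_sup_square[OF dD, of q n] that D0_V0[OF s] by simp
    ultimately have "(u q)\<^sup>2 \<le> 2 * 0 + 8 * K\<^sup>2 * 0" by (intro LIMSEQ_le_const) auto
    then show ?thesis by simp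
  qed
  then show ?thesis using u E0 by (auto simp: D0_def)
qed

text \<open>The direct method: \<open>J v = E v v - 2 * \<phi> v\<close> is bounded below, the
  parallelogram identity makes a minimising sequence Cauchy, and the first variation at its limit is
  the equation.\<close>

lemma Riesz_D0:
  assumes linear: "\<And>u v a b. u \<in> D0 \<Longrightarrow> v \<in> D0 \<Longrightarrow> \<phi> (\<lambda>x. a * u x + b * v x) = a * \<phi> u + b * \<phi> v"
    and bounded: "\<And>v. v \<in> D0 \<Longrightarrow> \<bar>\<phi> v\<bar> \<le> c * sqrt (E v v)"
  shows "\<exists>u\<in>D0. \<forall>v\<in>D0. E u v = \<phi> v"
proof -
  define J where "J v = E v v - 2 * \<phi> v" for v
  have "- c\<^sup>2 \<le> J v" if "v \<in> D0" for v
  proof -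
    have "0 \<le> (sqrt (E v v) - c)\<^sup>2" by simp
    also have "\<dots> = E v v - 2 * (c * sqrt (E v v)) + c\<^sup>2"
      using E_nonneg[OF D0_D[OF that]] by (simp add: power2_diff)
    also have "\<dots> \<le> J v + c\<^sup>2" using bounded[OF that] by (simp add: J_def abs_le_iff)
    finally show ?thesis by simp
  qed
  then have bdd: "bdd_below (J ` D0)" by (intro bdd_belowI[of _ "- c\<^sup>2"]) auto
  define m where "m = Inf (J ` D0)"
  have m_le: "m \<le> J v" if "v \<in> D0" for v
    unfolding m_def using bdd that by (simp add: cInf_lower)
  have "\<exists>v\<in>D0. J v < m + 1 / real (Suc n)" for n
  proof -
    have "m < m + 1 / real (Suc n)" by simp
    then show ?thesis unfolding m_def using D0_zero by (subst (asm) cInf_less_iff) (auto simp: bdd)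
  qed
  then obtain s where s: "\<And>n. s n \<in> D0" "\<And>n. J (s n) < m + 1 / real (Suc n)" by metis
  have par: "E2 (\<lambda>x. u x - v x) = 2 * J u + 2 * J v - 4 * J (\<lambda>x. 1/2 * u x + 1/2 * v x)"
    if "u \<in> D0" "v \<in> D0" for u v
    using E_quadratic[of u v "1/2" "1/2"] that D0_D linear[OF that, of "1/2" "1/2"]
    by (simp add: J_def E_diff_self power2_eq_square)
  have close: "E2 (\<lambda>x. s i x - s j x) < 2 / real (Suc i) + 2 / real (Suc j)" for i j
    using par[OF s(1) s(1), of i j] s(2)[of i] s(2)[of j] m_le[OF D0_lin[OF s(1) s(1), of "1/2" i "1/2" j]] by simp
  have "\<exists>u\<in>D0. (\<lambda>n. E2 (\<lambda>x. s n x - u x)) \<longlonglongrightarrow> 0"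
  proof (rule D0_complete[OF s(1)])
    fix e :: real assume "e > 0"
    then obtain N where N: "4 / e < real N" using reals_Archimedean2 by blast
    have "2 / real (Suc i) < e / 2" if "i \<ge> N" for i
    proof -
      have "4 / e < real (Suc i)" using N that by linarith
      then show ?thesis using \<open>e > 0\<close> by (simp add: field_simps)
    qed
    then show "\<exists>N. \<forall>m\<ge>N. \<forall>n\<ge>N. E2 (\<lambda>x. s m x - s n x) < e"
      using close by (intro exI[of _ N]) (smt (verit) field_sum_of_halves)
  qed
  then obtain u where u: "u \<in> D0" and lim: "(\<lambda>n. E2 (\<lambda>x. s n x - u x)) \<longlonglongrightarrow> 0" by blast
  have "E u v = \<phi> v" if v: "v \<in> D0" for v
  proof -
    have "(\<lambda>n. sqrt (E2 (\<lambda>x. s n x - u x)) * sqrt (E v v)) \<longlonglongrightarrow> sqrt 0 * sqrt (E v v)"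
      by (intro tendsto_intros lim)
    then have g0: "(\<lambda>n. sqrt (E2 (\<lambda>x. s n x - u x)) * sqrt (E v v)) \<longlonglongrightarrow> 0" by simp
    have "(\<lambda>n. E (\<lambda>x. s n x - u x) v) \<longlonglongrightarrow> 0"
    proof (rule Lim_null_comparison[OF _ g0])
      show "\<forall>\<^sub>F n in sequentially. norm (E (\<lambda>x. s n x - u x) v) \<le> sqrt (E2 (\<lambda>x. s n x - u x)) * sqrt (E v v)"
        unfolding real_norm_def by (intro always_eventually allI E_Cauchy_Schwarz D_diff D0_D s u v)
    qed
    then have "(\<lambda>n. E (s n) v - E u v) \<longlonglongrightarrow> 0"
      using s u v by (simp add: E_diff D0_D)
    then have lim': "(\<lambda>n. E (s n) v) \<longlonglongrightarrow> E u v" by (simp add: LIM_zero_cancel)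
    \<comment> \<open>The variation is carried out at \<open>s n\<close>, which is minimal up to
      \<open>1 / Suc n\<close>; thus only \<open>E (s n) v\<close>, and not \<open>J\<close>, has to
      pass to the limit.\<close>
    have "0 \<le> 2 * t * (E u v - \<phi> v) + t\<^sup>2 * E v v" for t
    proof -
      have "- (1 / real (Suc n)) \<le> 2 * t * (E (s n) v - \<phi> v) + t\<^sup>2 * E v v" for n
      proof -
        have "m \<le> J (\<lambda>x. 1 * s n x + t * v x)" by (intro m_le D0_lin s v)
        moreover have "J (\<lambda>x. 1 * s n x + t * v x) = J (s n) + (2 * t * (E (s n) v - \<phi> v) + t\<^sup>2 * E v v)"
          unfolding J_def E_quadratic[OF D0_D[OF s(1)] D0_D[OF v]] linear[OF s(1) v] by (simp add: algebra_simps)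
        ultimately show ?thesis using s(2)[of n] by linarith
      qed
      moreover have "(\<lambda>n. 2 * t * (E (s n) v - \<phi> v) + t\<^sup>2 * E v v) \<longlonglongrightarrow> 2 * t * (E u v - \<phi> v) + t\<^sup>2 * E v v"
        by (intro tendsto_intros lim')
      moreover have "(\<lambda>n. - (1 / real (Suc n))) \<longlonglongrightarrow> - 0"
        by (intro tendsto_minus LIMSEQ_Suc[OF lim_1_over_n])
      ultimately show ?thesis by (intro LIMSEQ_le[of "\<lambda>n. - (1 / real (Suc n))"]) auto
    qed
    then show ?thesis using linear_perturbation_nonneg by fastforce
  qed
  then show ?thesis using u by blast
qed

section \<open>Complex-valued functions\<close>

abbreviation "cD \<equiv> cdom_energy S"
abbreviation "cD0 \<equiv> cdom0_energy S"
abbreviation "cE \<equiv> cenergy S"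

lemma cD_iff: "u \<in> cD \<longleftrightarrow> (\<lambda>x. Re (u x)) \<in> D \<and> (\<lambda>x. Im (u x)) \<in> D"
  by (simp add: cdom_energy_def)

lemma cD0_iff: "u \<in> cD0 \<longleftrightarrow> u \<in> cD \<and> (\<forall>q\<in>V0. u q = 0)"
  by (simp add: cdom0_energy_def)

lemma cD0_cD [intro, simp]: "u \<in> cD0 \<Longrightarrow> u \<in> cD"
  by (simp add: cD0_iff)

lemma cD0_Re_Im: "u \<in> cD0 \<longleftrightarrow> (\<lambda>x. Re (u x)) \<in> D0 \<and> (\<lambda>x. Im (u x)) \<in> D0"
  by (auto simp: cD0_iff cD_iff D0_def complex_eq_iff)

lemma cD_add [intro]: "u \<in> cD \<Longrightarrow> v \<in> cD \<Longrightarrow> (\<lambda>x. u x + v x) \<in> cD"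
  and cD_diff [intro]: "u \<in> cD \<Longrightarrow> v \<in> cD \<Longrightarrow> (\<lambda>x. u x - v x) \<in> cD"
  and cD_scale [intro]: "u \<in> cD \<Longrightarrow> (\<lambda>x. a * u x) \<in> cD"
  and cD_zero [simp, intro]: "(\<lambda>x. 0) \<in> cD"
  and cD_cnj: "u \<in> cD \<Longrightarrow> (\<lambda>x. cnj (u x)) \<in> cD"
  and cD_of_real [intro]: "g \<in> D \<Longrightarrow> (\<lambda>x. complex_of_real (g x)) \<in> cD"
  using D_scale[of "\<lambda>x. Im (u x)" "-1"]
  by (auto simp: cD_iff intro: D_add D_diff D_scale)

lemma cD0_add [intro]: "u \<in> cD0 \<Longrightarrow> v \<in> cD0 \<Longrightarrow> (\<lambda>x. u x + v x) \<in> cD0"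
  and cD0_diff [intro]: "u \<in> cD0 \<Longrightarrow> v \<in> cD0 \<Longrightarrow> (\<lambda>x. u x - v x) \<in> cD0"
  and cD0_scale [intro]: "u \<in> cD0 \<Longrightarrow> (\<lambda>x. a * u x) \<in> cD0"
  and cD0_zero [simp, intro]: "(\<lambda>x. 0) \<in> cD0"
  and cD0_cnj: "u \<in> cD0 \<Longrightarrow> (\<lambda>x. cnj (u x)) \<in> cD0"
  and cD0_of_real [intro]: "g \<in> D0 \<Longrightarrow> (\<lambda>x. complex_of_real (g x)) \<in> cD0"
  by (auto simp: cD0_iff cD_cnj D0_def)

lemma cD_sum [intro]: "(\<And>p. p \<in> I \<Longrightarrow> f p \<in> cD) \<Longrightarrow> (\<lambda>x. \<Sum>p\<in>I. f p x) \<in> cD"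
  by (induction I rule: infinite_finite_induct) auto

lemma cD0_sum [intro]: "(\<And>p. p \<in> I \<Longrightarrow> f p \<in> cD0) \<Longrightarrow> (\<lambda>x. \<Sum>p\<in>I. f p x) \<in> cD0"
  by (induction I rule: infinite_finite_induct) auto

lemma cE_sym: "u \<in> cD \<Longrightarrow> v \<in> cD \<Longrightarrow> cE u v = cE v u"
  by (auto simp: cenergy_def cD_iff E_sym)

lemma cE_add: "u \<in> cD \<Longrightarrow> v \<in> cD \<Longrightarrow> g \<in> cD \<Longrightarrow> cE (\<lambda>x. u x + v x) g = cE u g + cE v g"
  by (auto simp: cenergy_def cD_iff E_add complex_eq_iff)

lemma cE_scale: "u \<in> cD \<Longrightarrow> g \<in> cD \<Longrightarrow> cE (\<lambda>x. a * u x) g = a * cE u g"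
  by (auto simp: cenergy_def cD_iff E_add E_diff E_scale D_scale complex_eq_iff algebra_simps)

lemma cE_diff: "u \<in> cD \<Longrightarrow> v \<in> cD \<Longrightarrow> g \<in> cD \<Longrightarrow> cE (\<lambda>x. u x - v x) g = cE u g - cE v g"
  using cE_add[of u "\<lambda>x. -1 * v x" g] cE_scale[of v g "-1"] cD_scale[of v "-1"] by simp

lemma cE_of_real: "u \<in> cD \<Longrightarrow> g \<in> D \<Longrightarrow> cE u (\<lambda>x. complex_of_real (g x)) = Complex (E (\<lambda>x. Re (u x)) g) (E (\<lambda>x. Im (u x)) g)"
proof -
  assume u: "u \<in> cD" "g \<in> D"
  have "E v (\<lambda>x. 0) = 0" if "v \<in> D" for v
    using E_scale[of v v 0] E_sym[of v "\<lambda>x. 0"] that by simp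
  then show ?thesis using u by (simp add: cenergy_def cD_iff)
qed

lemma cD_cong: "(\<And>x. x \<in> X \<Longrightarrow> u x = v x) \<Longrightarrow> u \<in> cD \<Longrightarrow> v \<in> cD"
  unfolding cD_iff using dom_cong[of "\<lambda>x. Re (u x)" "\<lambda>x. Re (v x)"] dom_cong[of "\<lambda>x. Im (u x)" "\<lambda>x. Im (v x)"]
  by auto

lemma cE_cong:
  assumes "\<And>x. x \<in> X \<Longrightarrow> u x = u' x" "\<And>x. x \<in> X \<Longrightarrow> v x = v' x"
  shows "cE u v = cE u' v'"
  unfolding cenergy_def by (intro arg_cong2[where f = Complex] arg_cong2[where f = "(+)"] arg_cong2[where f = "(-)"] E_cong) (simp_all add: assms)

lemma cD_comp_F: "u \<in> cD \<Longrightarrow> j \<in> L \<Longrightarrow> u \<circ> F j \<in> cD"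
  using D_comp_F[of "\<lambda>x. Re (u x)" j] D_comp_F[of "\<lambda>x. Im (u x)" j] by (auto simp: cD_iff comp_def)

lemma cD_glue:
  assumes "\<And>j. j \<in> L \<Longrightarrow> u \<circ> F j \<in> cD" shows "u \<in> cD"
proof -
  have "(\<lambda>x. Re (u x)) \<in> D" "(\<lambda>x. Im (u x)) \<in> D"
    by (rule D_glue, use assms in \<open>simp add: cD_iff comp_def\<close>)+
  then show ?thesis by (simp add: cD_iff)
qed

lemma cE_self_similar:
  assumes "u \<in> cD" "v \<in> cD"
  shows "cE u v = (\<Sum>j\<in>L. complex_of_real (inverse (r j)) * cE (u \<circ> F j) (v \<circ> F j))"
proof -
  have "complex_of_real c * cE f g = Complex
      (c * E (\<lambda>x. Re (f x)) (\<lambda>x. Re (g x)) - c * E (\<lambda>x. Im (f x)) (\<lambda>x. Im (g x)))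
      (c * E (\<lambda>x. Re (f x)) (\<lambda>x. Im (g x)) + c * E (\<lambda>x. Im (f x)) (\<lambda>x. Re (g x)))" for c f g
    by (simp add: cenergy_def complex_eq_iff algebra_simps)
  then show ?thesis
    using assms unfolding cD_iff
    by (simp add: cenergy_def[of _ u v] E_self_similar complex_eq_iff comp_def sum_subtractf sum.distrib del: of_real_inverse)
qed

lemma cD_continuous: "u \<in> cD \<Longrightarrow> continuous_on X u"
proof -
  assume "u \<in> cD"
  then have "continuous_on X (\<lambda>x. complex_of_real (Re (u x)) + \<i> * complex_of_real (Im (u x)))"
    by (intro continuous_on_add continuous_on_mult continuous_on_of_real continuous_on_const D_continuous) (auto simp: cD_iff)
  then show ?thesis by (simp only: complex_eq[symmetric])
qed

text \<open>The energy norm. As \<open>cE\<close> is bilinear, its square is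
  \<open>cE u (\<lambda>x. cnj (u x))\<close> rather than \<open>cE u u\<close>; see
  \<open>cE_cnj\<close>.\<close>

definition nrm :: "('a \<Rightarrow> complex) \<Rightarrow> real" where
  "nrm u = sqrt (E2 (\<lambda>x. Re (u x)) + E2 (\<lambda>x. Im (u x)))"

lemma nrm_nonneg [simp]: "0 \<le> nrm u" if "u \<in> cD"
  using that by (auto simp: nrm_def cD_iff E_nonneg)

lemma nrm_Re: "u \<in> cD \<Longrightarrow> sqrt (E2 (\<lambda>x. Re (u x))) \<le> nrm u"
  and nrm_Im: "u \<in> cD \<Longrightarrow> sqrt (E2 (\<lambda>x. Im (u x))) \<le> nrm u"
  by (auto simp: nrm_def cD_iff E_nonneg)

lemma cE_cnj: "u \<in> cD \<Longrightarrow> cE u (\<lambda>x. cnj (u x)) = complex_of_real ((nrm u)\<^sup>2)"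
proof -
  assume "u \<in> cD"
  then have D: "(\<lambda>x. Re (u x)) \<in> D" "(\<lambda>x. Im (u x)) \<in> D" by (auto simp: cD_iff)
  have "E v (\<lambda>x. - Im (u x)) = - E v (\<lambda>x. Im (u x))" if "v \<in> D" for v
    using E_scale[OF D(2) that, of "-1"] E_sym[OF that] D D_scale[OF D(2), of "-1"] by simp
  then show ?thesis
    using D E_sym[OF D] by (simp add: cenergy_def nrm_def complex_eq_iff E_nonneg)
qed

lemma cE_bound:
  assumes "u \<in> cD" "v \<in> cD" shows "cmod (cE u v) \<le> 4 * (nrm u * nrm v)"
proof -
  have "\<bar>E f g\<bar> \<le> nrm u * nrm v" if "f \<in> {\<lambda>x. Re (u x), \<lambda>x. Im (u x)}" "g \<in> {\<lambda>x. Re (v x), \<lambda>x. Im (v x)}" for f g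
  proof -
    have "f \<in> D" "g \<in> D" using that assms by (auto simp: cD_iff)
    then have "\<bar>E f g\<bar> \<le> sqrt (E f f) * sqrt (E g g)" by (rule E_Cauchy_Schwarz)
    also have "\<dots> \<le> nrm u * nrm v"
      using that assms \<open>g \<in> D\<close> nrm_Re nrm_Im E_nonneg by (intro mult_mono) auto
    finally show ?thesis .
  qed
  from this[of "\<lambda>x. Re (u x)" "\<lambda>x. Re (v x)"] this[of "\<lambda>x. Im (u x)" "\<lambda>x. Im (v x)"]
    this[of "\<lambda>x. Re (u x)" "\<lambda>x. Im (v x)"] this[of "\<lambda>x. Im (u x)" "\<lambda>x. Re (v x)"]
  have "\<bar>Re (cE u v)\<bar> \<le> 2 * (nrm u * nrm v)" "\<bar>Im (cE u v)\<bar> \<le> 2 * (nrm u * nrm v)"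
    by (auto simp: cenergy_def)
  then show ?thesis using cmod_le[of "cE u v"] by linarith
qed

lemma cD0_sup:
  assumes "u \<in> cD0" "x \<in> X" shows "cmod (u x) \<le> K * nrm u"
proof -
  have D: "(\<lambda>x. Re (u x)) \<in> D0" "(\<lambda>x. Im (u x)) \<in> D0" using assms by (auto simp: cD0_Re_Im)
  have "(Re (u x))\<^sup>2 \<le> K\<^sup>2 * E2 (\<lambda>x. Re (u x))" "(Im (u x))\<^sup>2 \<le> K\<^sup>2 * E2 (\<lambda>x. Im (u x))"
    using D0_sup[OF D(1) assms(2)] D0_sup[OF D(2) assms(2)] E_nonneg[OF D0_D[OF D(1)]] E_nonneg[OF D0_D[OF D(2)]]
    by (auto intro: square_le_of_abs_le_sqrt)
  then have "sqrt ((Re (u x))\<^sup>2 + (Im (u x))\<^sup>2) \<le> sqrt (K\<^sup>2 * (E2 (\<lambda>x. Re (u x)) + E2 (\<lambda>x. Im (u x))))"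
    by (intro real_sqrt_le_mono) (simp add: algebra_simps)
  then show ?thesis using K_pos by (simp add: cmod_def nrm_def real_sqrt_mult)
qed

lemma integrable_mult_continuous:
  fixes f g :: "'a \<Rightarrow> complex"
  assumes "integrable M f" "continuous_on X g"
  shows "integrable M (\<lambda>x. f x * g x)"
proof -
  obtain B where B: "\<And>x. x \<in> X \<Longrightarrow> norm (g x) \<le> B" using continuous_on_bounded[OF assms(2)] by blast
  show ?thesis
  proof (rule Bochner_Integration.integrable_bound)
    show "integrable M (\<lambda>x. B * norm (f x))" using assms(1) by simp
    show "(\<lambda>x. f x * g x) \<in> borel_measurable M"
      using assms by (intro borel_measurable_times) auto
    show "AE x in M. norm (f x * g x) \<le> norm (B * norm (f x))"
    proof (rule AE_I2)
      fix x assume "x \<in> space M"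
      then have "norm (g x) * norm (f x) \<le> B * norm (f x)" using B by (intro mult_right_mono) auto
      then show "norm (f x * g x) \<le> norm (B * norm (f x))"
        by (simp add: norm_mult mult.commute)
    qed
  qed
qed

lemma integrable_cD: "u \<in> cD \<Longrightarrow> integrable M u"
  using cD_continuous by auto

lemma integrable_cD_mult: "u \<in> cD \<Longrightarrow> v \<in> cD \<Longrightarrow> integrable M (\<lambda>x. u x * v x)"
  by (intro integrable_mult_continuous integrable_cD cD_continuous)

lemma cD0_integral_bound:
  assumes "u \<in> cD0" "v \<in> cD0"
  shows "cmod (\<integral>x. u x * v x \<partial>M) \<le> K\<^sup>2 * (nrm u * nrm v)"
proof -
  have "cmod (\<integral>x. u x * v x \<partial>M) \<le> (\<integral>x. cmod (u x * v x) \<partial>M)" by (rule integral_norm_bound)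
  also have "\<dots> \<le> (\<integral>x. K\<^sup>2 * (nrm u * nrm v) \<partial>M)"
  proof (rule integral_mono)
    show "integrable M (\<lambda>x. cmod (u x * v x))"
      using assms by (intro integrable_norm integrable_cD_mult cD0_cD)
    fix x assume "x \<in> space M"
    then have "cmod (u x) * cmod (v x) \<le> (K * nrm u) * (K * nrm v)"
      using assms K_pos by (intro mult_mono cD0_sup) (auto intro!: mult_nonneg_nonneg simp: less_imp_le cD0_cD)
    then show "cmod (u x * v x) \<le> K\<^sup>2 * (nrm u * nrm v)"
      by (simp add: norm_mult power2_eq_square mult_ac)
  qed auto
  finally show ?thesis by simp
qed

definition bounded_functional :: "(('a \<Rightarrow> complex) \<Rightarrow> complex) \<Rightarrow> bool" where
  "bounded_functional \<phi> \<longleftrightarrow>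
     (\<forall>u\<in>cD0. \<forall>v\<in>cD0. \<forall>a b. \<phi> (\<lambda>x. a * u x + b * v x) = a * \<phi> u + b * \<phi> v) \<and>
     (\<exists>c. \<forall>v\<in>cD0. cmod (\<phi> v) \<le> c * nrm v)"

text \<open>Real and imaginary parts of \<open>\<phi>\<close> on real functions are represented
  separately and become the real and imaginary parts of \<open>u\<close>; no conjugate appears
  because \<open>cE\<close> is bilinear.\<close>

lemma Riesz_cD0:
  assumes "bounded_functional \<phi>"
  shows "\<exists>u\<in>cD0. \<forall>v\<in>cD0. cE u v = \<phi> v"
proof -
  have lin: "\<phi> (\<lambda>x. a * u x + b * v x) = a * \<phi> u + b * \<phi> v" if "u \<in> cD0" "v \<in> cD0" for u v a b
    using assms that unfolding bounded_functional_def by blast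
  obtain c where c: "\<And>v. v \<in> cD0 \<Longrightarrow> cmod (\<phi> v) \<le> c * nrm v"
    using assms unfolding bounded_functional_def by blast
  have zero: "E2 (\<lambda>x. 0) = 0" using E_scale[of "\<lambda>x. 0" "\<lambda>x. 0" 0] by simp
  define \<psi> where "\<psi> v = \<phi> (\<lambda>x. complex_of_real (v x))" for v
  have lin\<psi>: "\<psi> (\<lambda>x. a * u x + b * v x) = a * \<psi> u + b * \<psi> v" if "u \<in> D0" "v \<in> D0" for u v and a b :: real
    using lin[OF cD0_of_real[OF that(1)] cD0_of_real[OF that(2)], of a b] by (simp add: \<psi>_def)
  have bd: "cmod (\<psi> v) \<le> c * sqrt (E v v)" if "v \<in> D0" for v
    using c[OF cD0_of_real[OF that]] by (simp add: \<psi>_def nrm_def zero)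
  have "\<exists>u\<in>D0. \<forall>v\<in>D0. E u v = Re (\<psi> v)"
    by (rule Riesz_D0[of _ c]) (auto simp: lin\<psi> intro: order.trans[OF abs_Re_le_cmod bd])
  moreover have "\<exists>u\<in>D0. \<forall>v\<in>D0. E u v = Im (\<psi> v)"
    by (rule Riesz_D0[of _ c]) (auto simp: lin\<psi> intro: order.trans[OF abs_Im_le_cmod bd])
  ultimately obtain u1 u2 where u: "u1 \<in> D0" "u2 \<in> D0"
    "\<And>v. v \<in> D0 \<Longrightarrow> E u1 v = Re (\<psi> v)" "\<And>v. v \<in> D0 \<Longrightarrow> E u2 v = Im (\<psi> v)" by metis
  define u where "u x = Complex (u1 x) (u2 x)" for x
  have uD: "u \<in> cD0" using u by (simp add: u_def cD0_Re_Im)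
  have "cE u v = \<phi> v" if v: "v \<in> cD0" for v
  proof -
    have D: "(\<lambda>x. Re (v x)) \<in> D0" "(\<lambda>x. Im (v x)) \<in> D0" using v by (auto simp: cD0_Re_Im)
    have "\<phi> v = \<phi> (\<lambda>x. 1 * complex_of_real (Re (v x)) + \<i> * complex_of_real (Im (v x)))"
      by (simp add: complex_eq[symmetric])
    also have "\<dots> = \<psi> (\<lambda>x. Re (v x)) + \<i> * \<psi> (\<lambda>x. Im (v x))"
      by (subst lin) (use D in \<open>auto simp: \<psi>_def\<close>)
    finally show ?thesis
      using u D by (simp add: cenergy_def u_def complex_eq_iff)
  qed
  then show ?thesis using uD by blast
qed

section \<open>The form of \<open>z - \<Delta>\<close> and its weak solutions\<close>

definition Ez :: "complex \<Rightarrow> ('a \<Rightarrow> complex) \<Rightarrow> ('a \<Rightarrow> complex) \<Rightarrow> complex" where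
  "Ez z u v = cE u v + z * (\<integral>x. u x * v x \<partial>M)"

lemma Ez_sym: "u \<in> cD \<Longrightarrow> v \<in> cD \<Longrightarrow> Ez z u v = Ez z v u"
  by (simp add: Ez_def cE_sym mult.commute)

lemma Ez_add: "u \<in> cD \<Longrightarrow> v \<in> cD \<Longrightarrow> g \<in> cD \<Longrightarrow> Ez z (\<lambda>x. u x + v x) g = Ez z u g + Ez z v g"
  by (simp add: Ez_def cE_add distrib_right integrable_cD_mult distrib_left)

lemma Ez_diff: "u \<in> cD \<Longrightarrow> v \<in> cD \<Longrightarrow> g \<in> cD \<Longrightarrow> Ez z (\<lambda>x. u x - v x) g = Ez z u g - Ez z v g"
  by (simp add: Ez_def cE_diff left_diff_distrib integrable_cD_mult right_diff_distrib)

lemma Ez_scale: "u \<in> cD \<Longrightarrow> g \<in> cD \<Longrightarrow> Ez z (\<lambda>x. a * u x) g = a * Ez z u g"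
  by (simp add: Ez_def cE_scale mult.assoc distrib_left mult.left_commute)

lemma Ez_zero [simp]: "g \<in> cD \<Longrightarrow> Ez z (\<lambda>x. 0) g = 0"
  using Ez_scale[of "\<lambda>x. 0" g z 0] by simp

lemma Ez_zero_right [simp]: "g \<in> cD \<Longrightarrow> Ez z g (\<lambda>x. 0) = 0"
  using Ez_sym[of g "\<lambda>x. 0"] by simp

lemma Ez_add_right: "u \<in> cD \<Longrightarrow> v \<in> cD \<Longrightarrow> g \<in> cD \<Longrightarrow> Ez z g (\<lambda>x. u x + v x) = Ez z g u + Ez z g v"
  and Ez_diff_right: "u \<in> cD \<Longrightarrow> v \<in> cD \<Longrightarrow> g \<in> cD \<Longrightarrow> Ez z g (\<lambda>x. u x - v x) = Ez z g u - Ez z g v"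
  and Ez_scale_right: "u \<in> cD \<Longrightarrow> g \<in> cD \<Longrightarrow> Ez z g (\<lambda>x. a * u x) = a * Ez z g u"
  by (simp_all add: Ez_sym[of g] Ez_add Ez_diff Ez_scale cD_add cD_diff cD_scale)

lemma Ez_sum:
  "g \<in> cD \<Longrightarrow> (\<And>p. p \<in> I \<Longrightarrow> f p \<in> cD) \<Longrightarrow> Ez z (\<lambda>x. \<Sum>p\<in>I. f p x) g = (\<Sum>p\<in>I. Ez z (f p) g)"
  by (induction I rule: infinite_finite_induct) (simp_all add: Ez_add cD_sum)

lemma Ez_sum_right:
  "g \<in> cD \<Longrightarrow> (\<And>p. p \<in> I \<Longrightarrow> f p \<in> cD) \<Longrightarrow> Ez z g (\<lambda>x. \<Sum>p\<in>I. f p x) = (\<Sum>p\<in>I. Ez z g (f p))"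
  by (simp add: Ez_sym[of g] Ez_sum cD_sum)

lemma Ez_cong: "(\<And>x. x \<in> X \<Longrightarrow> u x = u' x) \<Longrightarrow> (\<And>x. x \<in> X \<Longrightarrow> v x = v' x) \<Longrightarrow> Ez z u v = Ez z u' v'"
  unfolding Ez_def by (intro arg_cong2[where f = "(+)"] arg_cong2[where f = "(*)"] refl cE_cong Bochner_Integration.integral_cong) auto

text \<open>On a 1-cell the energy scales by \<open>inverse (r j)\<close> and the integral by
  \<open>\<mu> j\<close>; extracting the former leaves \<open>r j * \<mu> j * z\<close> as the
  parameter of the cell. This is the origin of the parameters in the hypothesis on
  eigenvalues.\<close>

lemma Ez_self_similar:
  assumes "u \<in> cD" "v \<in> cD"
  shows "Ez z u v = (\<Sum>j\<in>L. complex_of_real (inverse (r j)) * Ez (complex_of_real (r j * \<mu> j) * z) (u \<circ> F j) (v \<circ> F j))"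
proof -
  have "complex_of_real (inverse (r j)) * Ez (complex_of_real (r j * \<mu> j) * z) (u \<circ> F j) (v \<circ> F j)
    = complex_of_real (inverse (r j)) * cE (u \<circ> F j) (v \<circ> F j) + z * (\<mu> j *\<^sub>R (\<integral>x. u (F j x) * v (F j x) \<partial>M))"
    if "j \<in> L" for j
    using r_pos[OF that] by (simp add: Ez_def scaleR_conv_of_real field_simps)
  then show ?thesis
    unfolding Ez_def[of z] using integral_self_similar(2)[OF integrable_cD_mult[OF assms]] cE_self_similar[OF assms]
    by (simp add: sum.distrib sum_distrib_left)
qed

definition sol :: "complex \<Rightarrow> ('a \<Rightarrow> complex) \<Rightarrow> bool" where
  "sol z u \<longleftrightarrow> u \<in> cD \<and> (\<forall>v\<in>cD0. Ez z u v = 0)"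

lemma has_laplacian_iff: "has_laplacian S u (\<lambda>x. z * u x) \<longleftrightarrow> sol z u"
proof -
  have "Ez z u v = 0 \<longleftrightarrow> cE u v = - (\<integral>x. z * u x * v x \<partial>M)" for v
    by (simp add: Ez_def mult.assoc eq_neg_iff_add_eq_0)
  moreover have "continuous_on X (\<lambda>x. z * u x)" if "u \<in> cD"
    using cD_continuous[OF that] by (intro continuous_intros)
  ultimately show ?thesis by (auto simp: has_laplacian_def weak_laplacian_def sol_def)
qed

lemma sol_cong: "(\<And>x. x \<in> X \<Longrightarrow> u x = v x) \<Longrightarrow> sol z u \<Longrightarrow> sol z v"
  unfolding sol_def using cD_cong[of u v] Ez_cong[of u v _ _ z] by metis

text \<open>The form in which the eigenvalue hypothesis is used: uniqueness, both for the matrix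
  \<open>Bmat\<close> and for solutions.\<close>

lemma dirichlet_eigenvalueI:
  assumes "\<not> dirichlet_eigenvalue S z" "u \<in> cD0" "\<And>v. v \<in> cD0 \<Longrightarrow> Ez z u v = 0" "x \<in> X"
  shows "u x = 0"
proof (rule ccontr)
  assume "u x \<noteq> 0"
  moreover have "sol z u" using assms by (auto simp: sol_def)
  ultimately have "dirichlet_eigenvalue S z"
    unfolding dirichlet_eigenvalue_def has_laplacian_iff using assms by (intro exI[of _ u]) (auto simp: cD0_iff)
  then show False using assms(1) by simp
qed

definition solves :: "complex \<Rightarrow> (('a \<Rightarrow> complex) \<Rightarrow> complex) \<Rightarrow> ('a \<Rightarrow> complex) \<Rightarrow> bool" where
  "solves z \<phi> u \<longleftrightarrow> u \<in> cD0 \<and> (\<forall>v\<in>cD0. Ez z u v = \<phi> v)"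

section \<open>Solvability and bounds for small parameters\<close>

lemma geometric_Cauchy_D0:
  assumes s: "\<And>n. s n \<in> D0"
    and le: "\<And>n. sqrt (E2 (\<lambda>x. s (Suc n) x - s n x)) \<le> c * (1/2) ^ n"
    and "e > 0"
  shows "\<exists>N. \<forall>m\<ge>N. \<forall>n\<ge>N. E2 (\<lambda>x. s m x - s n x) < e"
proof -
  let ?N = "\<lambda>u. sqrt (E u u)"
  have tri: "?N (\<lambda>x. u x - w x) \<le> ?N (\<lambda>x. u x - v x) + ?N (\<lambda>x. v x - w x)" if "u \<in> D0" "v \<in> D0" "w \<in> D0" for u v w
  proof -
    define f where "f x = u x - v x" for x
    define g where "g x = v x - w x" for x
    have fg: "f \<in> D" "g \<in> D" using that D0_D D_diff by (auto simp: f_def[abs_def] g_def[abs_def])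
    have "E2 (\<lambda>x. 1 * f x + 1 * g x) \<le> (?N f + ?N g)\<^sup>2"
      using E_quadratic[OF fg, of 1 1] E_Cauchy_Schwarz[OF fg] E_nonneg[OF fg(1)] E_nonneg[OF fg(2)]
      by (simp add: power2_sum abs_le_iff)
    then have "?N (\<lambda>x. 1 * f x + 1 * g x) \<le> ?N f + ?N g"
      using E_nonneg[OF fg(1)] E_nonneg[OF fg(2)] by (intro real_le_lsqrt) auto
    then show ?thesis by (simp add: f_def[abs_def] g_def[abs_def])
  qed
  have c: "0 \<le> c" using le[of 0] E_nonneg[OF D_diff[OF D0_D[OF s] D0_D[OF s]], of 1 0]
    by (simp add: order.trans[OF real_sqrt_ge_zero])
  have N0: "?N (\<lambda>x. u x - u x) = 0" for u :: "'a \<Rightarrow> real"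
    using E_scale[of "\<lambda>x. 0" "\<lambda>x. 0" 0] by simp
  \<comment> \<open>The subtracted term closes the induction: each step bound is the difference of
    two consecutive values of \<open>2 * c * (1/2) ^ i\<close>.\<close>
  have b: "?N (\<lambda>x. s (n + k) x - s n x) \<le> 2 * c * (1/2) ^ n - 2 * c * (1/2) ^ (n + k)" for n k
  proof (induction k)
    case (Suc k)
    show ?case using tri[OF s[of "Suc (n + k)"] s[of "n + k"] s[of n]] le[of "n + k"] Suc by simp
  qed (use N0 in simp)
  have sym: "E2 (\<lambda>x. s m x - s n x) = E2 (\<lambda>x. s n x - s m x)" for m n
    using s D0_D by (simp add: E_diff_self E_sym)
  have "(\<lambda>n. 2 * c * (1/2) ^ n) \<longlonglongrightarrow> 2 * c * 0"
    by (intro tendsto_intros LIMSEQ_power_zero) simp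
  then have "\<forall>\<^sub>F n in sequentially. 2 * c * (1/2) ^ n < sqrt e"
    using assms(3) by (intro order_tendstoD(2)) auto
  then obtain N where N: "\<And>n. n \<ge> N \<Longrightarrow> 2 * c * (1/2) ^ n < sqrt e"
    by (auto simp: eventually_sequentially)
  have less: "E2 (\<lambda>x. s m x - s n x) < e" if "m \<ge> n" "n \<ge> N" for m n
  proof -
    have "?N (\<lambda>x. s m x - s n x) < sqrt e"
    proof -
      have "?N (\<lambda>x. s m x - s n x) \<le> 2 * c * (1/2) ^ n - 2 * c * (1/2) ^ m"
        using b[of n "m - n"] that by simp
      moreover have "0 \<le> 2 * c * (1/2) ^ m" using c by simp
      ultimately show ?thesis using N[OF that(2)] by linarith
    qed
    then show ?thesis by simp
  qed
  then have "E2 (\<lambda>x. s m x - s n x) < e" if "m \<ge> N" "n \<ge> N" for m n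
  proof (cases "m \<ge> n")
    case False
    then have "E2 (\<lambda>x. s n x - s m x) < e" using less[of m n] that by simp
    then show ?thesis using sym[of m n] by simp
  qed (use that less in blast)
  then show ?thesis by blast
qed

text \<open>For small \<open>z\<close> the equation \<open>cE g v = \<phi> v - z \<integral> g v\<close> is solved by iterating its right-hand side.\<close>

lemma solves_small:
  assumes z: "cmod z * K\<^sup>2 \<le> 1/2" and \<phi>: "bounded_functional \<phi>"
  shows "\<exists>g. solves z \<phi> g"
proof -
  have "\<exists>t. t \<in> cD0 \<and> (\<forall>v\<in>cD0. cE t v = \<phi> v - z * (\<integral>x. s x * v x \<partial>M))" if "s \<in> cD0" for s
  proof -
    have "bounded_functional (\<lambda>v. \<phi> v - z * (\<integral>x. s x * v x \<partial>M))"
      unfolding bounded_functional_def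
    proof (intro conjI ballI allI)
      fix u v a b assume uv: "u \<in> cD0" "v \<in> cD0"
      then have "\<phi> (\<lambda>x. a * u x + b * v x) = a * \<phi> u + b * \<phi> v"
        using \<phi> unfolding bounded_functional_def by blast
      moreover have "(\<integral>x. s x * (a * u x + b * v x) \<partial>M) = (\<integral>x. a * (s x * u x) + b * (s x * v x) \<partial>M)"
        by (simp add: algebra_simps)
      moreover have "\<dots> = a * (\<integral>x. s x * u x \<partial>M) + b * (\<integral>x. s x * v x \<partial>M)"
        using integrable_cD_mult[OF cD0_cD[OF that] cD0_cD[OF uv(1)]] integrable_cD_mult[OF cD0_cD[OF that] cD0_cD[OF uv(2)]]
        by (subst Bochner_Integration.integral_add) auto
      ultimately show "\<phi> (\<lambda>x. a * u x + b * v x) - z * (\<integral>x. s x * (a * u x + b * v x) \<partial>M) =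
          a * (\<phi> u - z * (\<integral>x. s x * u x \<partial>M)) + b * (\<phi> v - z * (\<integral>x. s x * v x \<partial>M))"
        by (simp add: algebra_simps)
    next
      obtain c where c: "\<And>v. v \<in> cD0 \<Longrightarrow> cmod (\<phi> v) \<le> c * nrm v"
        using \<phi> unfolding bounded_functional_def by blast
      have "cmod (\<phi> v - z * (\<integral>x. s x * v x \<partial>M)) \<le> (c + cmod z * K\<^sup>2 * nrm s) * nrm v" if v: "v \<in> cD0" for v
      proof -
        have "cmod (\<phi> v - z * (\<integral>x. s x * v x \<partial>M)) \<le> cmod (\<phi> v) + cmod z * cmod (\<integral>x. s x * v x \<partial>M)"
          using norm_triangle_ineq4[of "\<phi> v" "z * (\<integral>x. s x * v x \<partial>M)"] by (simp add: norm_mult)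
        also have "\<dots> \<le> c * nrm v + cmod z * (K\<^sup>2 * (nrm s * nrm v))"
          using c[OF v] cD0_integral_bound[OF \<open>s \<in> cD0\<close> v] by (intro add_mono mult_left_mono) auto
        finally show ?thesis by (simp add: algebra_simps)
      qed
      then show "\<exists>c. \<forall>v\<in>cD0. cmod (\<phi> v - z * (\<integral>x. s x * v x \<partial>M)) \<le> c * nrm v" by blast
    qed
    then show ?thesis using Riesz_cD0 by blast
  qed
  then obtain T where T: "\<And>s. s \<in> cD0 \<Longrightarrow> T s \<in> cD0"
    "\<And>s v. s \<in> cD0 \<Longrightarrow> v \<in> cD0 \<Longrightarrow> cE (T s) v = \<phi> v - z * (\<integral>x. s x * v x \<partial>M)" by metis
  define s where "s n = (T ^^ n) (\<lambda>x. 0)" for n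
  have s: "s n \<in> cD0" for n unfolding s_def by (induction n) (auto intro: T)
  have sSuc: "cE (s (Suc n)) v = \<phi> v - z * (\<integral>x. s n x * v x \<partial>M)" if "v \<in> cD0" for n v
    using T(2)[OF s that, of n] by (simp add: s_def)
  define d where "d n x = s (Suc n) x - s n x" for n x
  have d: "d n \<in> cD0" for n using s by (auto simp: d_def[abs_def])
  \<comment> \<open>In differences of iterates \<open>\<phi>\<close> cancels. Testing the remaining
    recursion with the conjugate of the new difference shows that each step at least halves the
    norm.\<close>
  have dSuc: "cE (d (Suc n)) v = - z * (\<integral>x. d n x * v x \<partial>M)" if v: "v \<in> cD0" for n v
  proof -
    have "cE (d (Suc n)) v = cE (s (Suc (Suc n))) v - cE (s (Suc n)) v"
      unfolding d_def by (rule cE_diff) (use s v in auto)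
    also have "\<dots> = - z * ((\<integral>x. s (Suc n) x * v x \<partial>M) - (\<integral>x. s n x * v x \<partial>M))"
      using sSuc[OF v] by (simp add: algebra_simps)
    also have "(\<integral>x. s (Suc n) x * v x \<partial>M) - (\<integral>x. s n x * v x \<partial>M) = (\<integral>x. d n x * v x \<partial>M)"
      using integrable_cD_mult s v by (subst Bochner_Integration.integral_diff[symmetric]) (auto simp: d_def algebra_simps)
    finally show ?thesis .
  qed
  have nrm_d: "nrm (d n) \<le> nrm (d 0) * (1/2) ^ n" for n
  proof (induction n)
    case (Suc n)
    have "(nrm (d (Suc n)))\<^sup>2 = cmod (cE (d (Suc n)) (\<lambda>x. cnj (d (Suc n) x)))"
      using d by (subst cE_cnj) (auto simp: norm_power)
    also have "\<dots> = cmod z * cmod (\<integral>x. d n x * cnj (d (Suc n) x) \<partial>M)"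
      using dSuc[OF cD0_cnj[OF d]] by (simp add: norm_mult)
    also have "\<dots> \<le> cmod z * (K\<^sup>2 * (nrm (d n) * nrm (\<lambda>x. cnj (d (Suc n) x))))"
      by (intro mult_left_mono cD0_integral_bound d cD0_cnj) auto
    also have "nrm (\<lambda>x. cnj (d (Suc n) x)) = nrm (d (Suc n))"
      using E_quadratic[of "\<lambda>x. Im (d (Suc n) x)" "\<lambda>x. 0" "-1" 0] d[of "Suc n"] by (simp add: nrm_def cD0_iff cD_iff)
    also have "cmod z * (K\<^sup>2 * (nrm (d n) * nrm (d (Suc n)))) \<le> 1/2 * (nrm (d n) * nrm (d (Suc n)))"
      using mult_right_mono[OF z, of "nrm (d n) * nrm (d (Suc n))"] d by (simp add: cD0_cD mult.assoc)
    finally have "nrm (d (Suc n)) \<le> 1/2 * nrm (d n) \<or> nrm (d (Suc n)) = 0"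
      using nrm_nonneg[OF cD0_cD[OF d], of "Suc n"] by (auto simp: power2_eq_square mult_le_cancel_right)
    then have "nrm (d (Suc n)) \<le> 1/2 * nrm (d n)" using nrm_nonneg[OF cD0_cD[OF d], of n] by auto
    then show ?case using Suc by simp
  qed simp
  have "\<exists>u\<in>D0. (\<lambda>n. E2 (\<lambda>x. Re (s n x) - u x)) \<longlonglongrightarrow> 0"
  proof (rule D0_complete, use s cD0_Re_Im in blast, rule geometric_Cauchy_D0[where c = "nrm (d 0)"], use s cD0_Re_Im in blast)
    show "sqrt (E2 (\<lambda>x. Re (s (Suc n) x) - Re (s n x))) \<le> nrm (d 0) * (1/2) ^ n" for n
      using order.trans[OF nrm_Re[OF cD0_cD[OF d]] nrm_d, of n] by (simp add: d_def)
  qed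
  moreover have "\<exists>u\<in>D0. (\<lambda>n. E2 (\<lambda>x. Im (s n x) - u x)) \<longlonglongrightarrow> 0"
  proof (rule D0_complete, use s cD0_Re_Im in blast, rule geometric_Cauchy_D0[where c = "nrm (d 0)"], use s cD0_Re_Im in blast)
    show "sqrt (E2 (\<lambda>x. Im (s (Suc n) x) - Im (s n x))) \<le> nrm (d 0) * (1/2) ^ n" for n
      using order.trans[OF nrm_Im[OF cD0_cD[OF d]] nrm_d, of n] by (simp add: d_def)
  qed
  ultimately obtain u1 u2 where u: "u1 \<in> D0" "u2 \<in> D0"
    and lim1: "(\<lambda>n. E2 (\<lambda>x. Re (s n x) - u1 x)) \<longlonglongrightarrow> 0"
    and lim2: "(\<lambda>n. E2 (\<lambda>x. Im (s n x) - u2 x)) \<longlonglongrightarrow> 0" by blast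
  define g where "g x = Complex (u1 x) (u2 x)" for x
  have g: "g \<in> cD0" using u by (simp add: g_def cD0_Re_Im)
  define e where "e n x = s n x - g x" for n x
  have e: "e n \<in> cD0" for n using s g by (auto simp: e_def[abs_def])
  have "(\<lambda>n. sqrt (E2 (\<lambda>x. Re (s n x) - u1 x) + E2 (\<lambda>x. Im (s n x) - u2 x))) \<longlonglongrightarrow> sqrt (0 + 0)"
    by (intro tendsto_intros lim1 lim2)
  then have nrm_e: "(\<lambda>n. nrm (e n)) \<longlonglongrightarrow> 0" by (simp add: nrm_def e_def g_def)
  have "Ez z g v = \<phi> v" if v: "v \<in> cD0" for v
  proof -
    \<comment> \<open>The index is shifted because the iteration determines the energy of iterate
      \<open>n + 1\<close> from the integral of iterate \<open>n\<close>.\<close>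
    have "(\<lambda>n. cE (e (Suc n)) v) \<longlonglongrightarrow> 0"
    proof (rule Lim_null_comparison)
      have "(\<lambda>n. 4 * (nrm (e (Suc n)) * nrm v)) \<longlonglongrightarrow> 4 * (0 * nrm v)"
        by (intro tendsto_intros LIMSEQ_Suc nrm_e)
      then show "(\<lambda>n. 4 * (nrm (e (Suc n)) * nrm v)) \<longlonglongrightarrow> 0" by simp
    qed (use e v in \<open>auto intro!: eventuallyI cE_bound\<close>)
    moreover have "(\<lambda>n. \<integral>x. e n x * v x \<partial>M) \<longlonglongrightarrow> 0"
    proof (rule Lim_null_comparison)
      have "(\<lambda>n. K\<^sup>2 * (nrm (e n) * nrm v)) \<longlonglongrightarrow> K\<^sup>2 * (0 * nrm v)"
        by (intro tendsto_intros nrm_e)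
      then show "(\<lambda>n. K\<^sup>2 * (nrm (e n) * nrm v)) \<longlonglongrightarrow> 0" by simp
    qed (use e v in \<open>auto intro!: eventuallyI cD0_integral_bound\<close>)
    ultimately have "(\<lambda>n. cE (e (Suc n)) v + z * (\<integral>x. e n x * v x \<partial>M)) \<longlonglongrightarrow> 0 + z * 0"
      by (intro tendsto_intros)
    moreover have "cE (e (Suc n)) v + z * (\<integral>x. e n x * v x \<partial>M) = \<phi> v - Ez z g v" for n
    proof -
      have "cE (e (Suc n)) v = cE (s (Suc n)) v - cE g v"
        unfolding e_def by (rule cE_diff) (use s g v in auto)
      moreover have "(\<integral>x. e n x * v x \<partial>M) = (\<integral>x. s n x * v x \<partial>M) - (\<integral>x. g x * v x \<partial>M)"
        using integrable_cD_mult s g v by (subst Bochner_Integration.integral_diff[symmetric]) (auto simp: e_def algebra_simps)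
      ultimately show ?thesis using sSuc[OF v, of n] by (simp only: Ez_def) (simp add: algebra_simps)
    qed
    ultimately show ?thesis by (simp add: LIMSEQ_const_iff)
  qed
  then show ?thesis using g by (auto simp: solves_def)
qed

text \<open>Testing the equation with the conjugate of \<open>g\<close> gives
  \<open>(nrm g)\<^sup>2 \<le> K * nrm g + 1/2 * (nrm g)\<^sup>2\<close>, hence
  \<open>nrm g \<le> 2 * K\<close>. The bound depends on neither \<open>z\<close> nor
  \<open>x\<close>, as the remainder of the series requires.\<close>

lemma green_bound_small:
  assumes z: "cmod z * K\<^sup>2 \<le> 1/2" and g: "solves z (\<lambda>v. v x) g" and x: "x \<in> X" and y: "y \<in> X"
  shows "cmod (g y) \<le> 2 * K\<^sup>2"
proof -
  have gD: "g \<in> cD0" using g by (simp add: solves_def)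
  have cnj: "nrm (\<lambda>x. cnj (g x)) = nrm g"
    using E_quadratic[of "\<lambda>x. Im (g x)" "\<lambda>x. 0" "-1" 0] gD by (simp add: nrm_def cD0_iff cD_iff)
  have "complex_of_real ((nrm g)\<^sup>2) = cnj (g x) - z * (\<integral>x. g x * cnj (g x) \<partial>M)"
  proof -
    have "Ez z g (\<lambda>x. cnj (g x)) = cnj (g x)" using g cD0_cnj[OF gD] by (simp add: solves_def)
    then show ?thesis using cE_cnj[OF cD0_cD[OF gD]] by (simp add: Ez_def eq_diff_eq)
  qed
  then have "(nrm g)\<^sup>2 = cmod (cnj (g x) - z * (\<integral>x. g x * cnj (g x) \<partial>M))"
    by (metis abs_power2 norm_of_real)
  also have "\<dots> \<le> cmod (g x) + cmod z * cmod (\<integral>x. g x * cnj (g x) \<partial>M)"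
    using norm_triangle_ineq4[of "cnj (g x)" "z * (\<integral>x. g x * cnj (g x) \<partial>M)"] by (simp add: norm_mult)
  also have "\<dots> \<le> K * nrm g + cmod z * (K\<^sup>2 * (nrm g * nrm g))"
    using cD0_sup[OF gD x] cD0_integral_bound[OF gD cD0_cnj[OF gD]] cnj by (intro add_mono mult_left_mono) auto
  also have "\<dots> \<le> K * nrm g + 1/2 * (nrm g)\<^sup>2"
    using mult_right_mono[OF z, of "(nrm g)\<^sup>2"] by (simp add: power2_eq_square mult_ac)
  finally have "nrm g * nrm g \<le> (2 * K) * nrm g" by (simp add: power2_eq_square)
  then have "nrm g \<le> 2 * K"
    using nrm_nonneg[OF cD0_cD[OF gD]] K_pos by (cases "nrm g = 0") (auto simp: mult_le_cancel_right)
  then have "K * nrm g \<le> 2 * K\<^sup>2" using K_pos by (simp add: power2_eq_square)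
  then show ?thesis using cD0_sup[OF gD y] by simp
qed

lemma bounded_functional_point: "x \<in> X \<Longrightarrow> bounded_functional (\<lambda>v. v x)"
  unfolding bounded_functional_def using cD0_sup by blast

lemma bounded_functional_integral:
  assumes "integrable M f"
  shows "bounded_functional (\<lambda>v. \<integral>x. f x * v x \<partial>M)"
  unfolding bounded_functional_def
proof (intro conjI ballI allI)
  have int: "integrable M (\<lambda>x. f x * u x)" if "u \<in> cD0" for u
    using assms that by (intro integrable_mult_continuous cD_continuous) auto
  fix u v a b assume uv: "u \<in> cD0" "v \<in> cD0"
  have "(\<integral>x. f x * (a * u x + b * v x) \<partial>M) = (\<integral>x. a * (f x * u x) + b * (f x * v x) \<partial>M)"
    by (simp add: algebra_simps)
  also have "\<dots> = a * (\<integral>x. f x * u x \<partial>M) + b * (\<integral>x. f x * v x \<partial>M)"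
    using int uv by (subst Bochner_Integration.integral_add) auto
  finally show "(\<integral>x. f x * (a * u x + b * v x) \<partial>M) = a * (\<integral>x. f x * u x \<partial>M) + b * (\<integral>x. f x * v x \<partial>M)" .
next
  have "cmod (\<integral>x. f x * v x \<partial>M) \<le> ((\<integral>x. cmod (f x) \<partial>M) * K) * nrm v" if v: "v \<in> cD0" for v
  proof -
    have "cmod (\<integral>x. f x * v x \<partial>M) \<le> (\<integral>x. cmod (f x * v x) \<partial>M)" by (rule integral_norm_bound)
    also have "\<dots> \<le> (\<integral>x. cmod (f x) * (K * nrm v) \<partial>M)"
    proof (rule integral_mono)
      show "integrable M (\<lambda>x. cmod (f x * v x))"
        using assms v by (intro integrable_norm integrable_mult_continuous cD_continuous) auto
      show "integrable M (\<lambda>x. cmod (f x) * (K * nrm v))" using assms by auto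
      show "cmod (f x * v x) \<le> cmod (f x) * (K * nrm v)" if "x \<in> space M" for x
        using cD0_sup[OF v] that by (simp add: norm_mult mult_left_mono)
    qed
    finally show ?thesis by (simp add: mult_ac)
  qed
  then show "\<exists>c. \<forall>v\<in>cD0. cmod (\<integral>x. f x * v x \<partial>M) \<le> c * nrm v" by blast
qed

section \<open>Normal derivatives\<close>

lemma E0_delta:
  assumes q: "q \<in> V0"
  shows "E0 a (\<lambda>x. of_bool (x = q)) = (\<Sum>y\<in>V0. cnd q y * (a q - a y))"
proof -
  have "(\<Sum>x\<in>V0. \<Sum>y\<in>V0. cnd x y * (a x - a y) * (of_bool (x = q) - of_bool (y = q)))
    = (\<Sum>x\<in>V0. \<Sum>y\<in>V0. if x = q then cnd x y * (a x - a y) else 0) - (\<Sum>x\<in>V0. \<Sum>y\<in>V0. if y = q then cnd x y * (a x - a y) else 0)"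
    unfolding sum_subtractf[symmetric] by (intro sum.cong refl) auto
  also have "(\<Sum>x\<in>V0. \<Sum>y\<in>V0. if x = q then cnd x y * (a x - a y) else 0) = (\<Sum>y\<in>V0. cnd q y * (a q - a y))"
    by (subst sum.swap) (simp add: q)
  also have "(\<Sum>x\<in>V0. \<Sum>y\<in>V0. if y = q then cnd x y * (a x - a y) else 0) = (\<Sum>x\<in>V0. cnd x q * (a x - a q))"
    by (simp add: q)
  also have "\<dots> = - (\<Sum>y\<in>V0. cnd q y * (a q - a y))"
    unfolding sum_negf[symmetric] using q by (intro sum.cong refl) (simp add: cnd_sym[of _ q] algebra_simps)
  finally show ?thesis by (simp add: energy0_def)
qed

text \<open>The harmonic function with value 1 at \<open>q\<close> and 0 elsewhere on
  \<open>V0\<close>, transplanted to the m-cell at \<open>q\<close> and extended by 0.\<close>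

fun bump :: "'a \<Rightarrow> nat \<Rightarrow> 'a \<Rightarrow> real" where
  "bump q 0 = harm (\<lambda>x. of_bool (x = q))"
| "bump q (Suc m) = glue (\<lambda>j. if j = fixing_letter S q then bump q m else (\<lambda>x. 0))"

declare bump.simps(2) [simp del]

text \<open>The boundary values of \<open>bump q m\<close> appear as a hypothesis because
  \<open>bump_V0\<close>, which proves them by induction, uses this lemma in its step.\<close>

lemma bump_F_aux:
  assumes "q \<in> V0" "\<And>p. p \<in> V0 \<Longrightarrow> bump q m p = of_bool (p = q)" "j \<in> L" "x \<in> X"
  shows "bump q (Suc m) (F j x) = (if j = fixing_letter S q then bump q m x else 0)"
proof -
  have "glue (\<lambda>j. if j = fixing_letter S q then bump q m else (\<lambda>x. 0)) (F j x)
    = (if j = fixing_letter S q then bump q m else (\<lambda>x. 0)) x"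
    by (rule glue_F[where \<phi> = "\<lambda>y. of_bool (y = q)"]) (use assms fixing_letter(3)[OF assms(1)] in auto)
  then show ?thesis by (simp add: bump.simps(2))
qed

lemma bump_V0: "q \<in> V0 \<Longrightarrow> p \<in> V0 \<Longrightarrow> bump q m p = of_bool (p = q)"
proof (induction m arbitrary: p)
  case (Suc m)
  let ?k = "fixing_letter S p"
  have "bump q (Suc m) (F ?k p) = (if ?k = fixing_letter S q then bump q m p else 0)"
    by (rule bump_F_aux) (use Suc fixing_letter[of p] in auto)
  then show ?case using Suc fixing_letter[of p] by (auto)
qed simp

lemma bump_F:
  "q \<in> V0 \<Longrightarrow> j \<in> L \<Longrightarrow> x \<in> X \<Longrightarrow> bump q (Suc m) (F j x) = (if j = fixing_letter S q then bump q m x else 0)"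
  by (rule bump_F_aux) (auto simp: bump_V0)

lemma bump_D: "q \<in> V0 \<Longrightarrow> bump q m \<in> D"
proof (induction m)
  case (Suc m)
  show ?case
  proof (rule D_glue)
    fix j assume "j \<in> L"
    then have F: "(bump q (Suc m) \<circ> F j) x = (if j = fixing_letter S q then bump q m x else 0)" if "x \<in> X" for x
      using bump_F[OF Suc.prems _ that] by simp
    show "bump q (Suc m) \<circ> F j \<in> D"
    proof (cases "j = fixing_letter S q")
      case True
      show ?thesis
        by (rule dom_cong[of "bump q m"]) (use F True Suc in simp_all)
    next
      case False
      show ?thesis
        by (rule dom_cong[of "\<lambda>x. 0"]) (use F False in simp_all)
    qed
  qed
qed simp

lemma bump_bounded:
  assumes "q \<in> V0" shows "\<exists>B. \<forall>m. \<forall>x\<in>X. \<bar>bump q m x\<bar> \<le> B"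
proof -
  obtain B where B: "\<And>x. x \<in> X \<Longrightarrow> \<bar>bump q 0 x\<bar> \<le> B"
    using continuous_on_bounded[OF D_continuous[OF bump_D[OF assms, of 0]]] by auto
  have "\<bar>bump q m x\<bar> \<le> B" if "x \<in> X" for m x
    using that
  proof (induction m arbitrary: x)
    case (Suc m)
    obtain j y where j: "j \<in> L" "y \<in> X" "x = F j y" using Suc.prems X_cases by blast
    have "0 \<le> B" using B[OF j(2)] abs_ge_zero order.trans by blast
    then show ?case using Suc.IH[OF j(2)] j assms by (simp add: bump_F)
  qed (use B in blast)
  then show ?thesis by blast
qed

text \<open>Self-similarity moves the energy into the 1-cell of the fixing letter \<open>i\<close>
  and yields a factor \<open>inverse (r i)\<close> per level; at level 0 it is \<open>E0\<close>
  against a delta function on \<open>V0\<close>, since the bump is harmonic.\<close>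

lemma E_bump:
  "u \<in> D \<Longrightarrow> q \<in> V0 \<Longrightarrow> E u (bump q m) = inverse (r (fixing_letter S q) ^ m) *
     (\<Sum>y\<in>V0. cnd q y * (u q - u ((F (fixing_letter S q) ^^ m) y)))"
proof (induction m arbitrary: u)
  case 0
  then show ?case using E_harm[of u "\<lambda>x. of_bool (x = q)"] E_sym[of u "bump q 0"] by (simp add: E0_sym[of _ u] E0_delta)
next
  case (Suc m)
  let ?i = "fixing_letter S q"
  have i: "?i \<in> L" "F ?i q = q" using fixing_letter Suc.prems by auto
  have Z: "E v (\<lambda>x. 0) = 0" if "v \<in> D" for v
    using E_scale[of v v 0] E_sym[of v "\<lambda>x. 0"] that by simp
  have "E u (bump q (Suc m)) = (\<Sum>j\<in>L. inverse (r j) * E (u \<circ> F j) (bump q (Suc m) \<circ> F j))"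
    by (rule E_self_similar) (use Suc bump_D in auto)
  also have "\<dots> = (\<Sum>j\<in>L. if j = ?i then inverse (r j) * E (u \<circ> F j) (bump q m) else 0)"
  proof (intro sum.cong refl)
    fix j assume j: "j \<in> L"
    have "E (u \<circ> F j) (bump q (Suc m) \<circ> F j) = E (u \<circ> F j) (if j = ?i then bump q m else (\<lambda>x. 0))"
      by (intro E_cong) (use Suc.prems j bump_F in \<open>auto\<close>)
    then show "inverse (r j) * E (u \<circ> F j) (bump q (Suc m) \<circ> F j) = (if j = ?i then inverse (r j) * E (u \<circ> F j) (bump q m) else 0)"
      using Z[OF D_comp_F[OF Suc.prems(1) j]] by (simp split: if_splits)
  qed
  also have "\<dots> = inverse (r ?i) * E (u \<circ> F ?i) (bump q m)" using i by simp
  also have "E (u \<circ> F ?i) (bump q m) = inverse (r ?i ^ m) * (\<Sum>y\<in>V0. cnd q y * (u q - u ((F ?i ^^ Suc m) y)))"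
    using Suc.IH[OF D_comp_F[OF Suc.prems(1) i(1)] Suc.prems(2)] i by (simp add: comp_def)
  finally show ?case by (simp add: mult_ac)
qed

lemma discrete_normal_derivative_eq:
  assumes "u \<in> cD" "q \<in> V0"
  shows "discrete_normal_derivative S u q m = cE u (\<lambda>x. complex_of_real (bump q m x))"
proof -
  have "(\<lambda>x. Re (u x)) \<in> D" "(\<lambda>x. Im (u x)) \<in> D" using assms by (auto simp: cD_iff)
  then show ?thesis
    unfolding cE_of_real[OF assms(1) bump_D[OF assms(2)]]
    by (simp add: E_bump assms discrete_normal_derivative_def complex_eq_iff del: of_real_inverse of_real_power)
qed

lemma bump_eventually_0:
  assumes q: "q \<in> V0" and x: "x \<in> X" "x \<noteq> q"
  shows "\<forall>\<^sub>F m in sequentially. bump q m x = 0"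
proof -
  let ?i = "fixing_letter S q"
  have i: "?i \<in> L" "F ?i q = q" using fixing_letter q by auto
  obtain \<theta> where \<theta>: "0 < \<theta>" "\<theta> < 1" "\<And>j x y. j \<in> L \<Longrightarrow> dist (F j x) (F j y) \<le> \<theta> * dist x y"
    using contraction_F by blast
  obtain d where d: "\<And>y. y \<in> X \<Longrightarrow> dist y q \<le> d"
    using compact_imp_bounded[OF compact_X] unfolding bounded_any_center[of _ q] by (metis dist_commute)
  have le: "dist x q \<le> \<theta> ^ m * d" if "bump q m x \<noteq> 0" "x \<in> X" for m x
    using that
  proof (induction m arbitrary: x)
    case 0
    then show ?case using d by simp
  next
    case (Suc m)
    obtain j y where j: "j \<in> L" "y \<in> X" "x = F j y" using Suc.prems X_cases by blast
    then have "j = ?i" "bump q m y \<noteq> 0" using Suc.prems q by (auto simp: bump_F split: if_splits)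
    then have "dist x q \<le> \<theta> * dist y q" using \<theta>(3)[of ?i y q] i j by simp
    also have "\<dots> \<le> \<theta> * (\<theta> ^ m * d)" using Suc.IH[of y] j \<open>bump q m y \<noteq> 0\<close> \<theta>(1) by (intro mult_left_mono) auto
    finally show ?case by simp
  qed
  have "(\<lambda>m. \<theta> ^ m * d) \<longlonglongrightarrow> 0"
    using \<theta> by (intro tendsto_mult_left_zero LIMSEQ_realpow_zero) auto
  then have "\<forall>\<^sub>F m in sequentially. \<theta> ^ m * d < dist x q"
    using x by (intro order_tendstoD(2)) auto
  then show ?thesis by (elim eventually_mono) (use le x in fastforce)
qed

text \<open>The discrete normal derivatives are the energies of \<open>u\<close> against bump functions that
  shrink to \<open>q\<close>, which the weak formulation evaluates up to a vanishing error.\<close>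

lemma has_normal_derivative_weak:
  assumes u: "u \<in> cD" and f: "integrable M f" and q: "q \<in> V0" and x: "c = 0 \<or> x \<in> X - V0"
    and weak: "\<And>v. v \<in> cD0 \<Longrightarrow> cE u v = - (\<integral>y. f y * v y \<partial>M) + c * v x"
    and k: "k \<in> cD" "\<And>p. p \<in> V0 \<Longrightarrow> k p = of_bool (p = q)"
  shows "has_normal_derivative S u q (cE u k + (\<integral>y. f y * k y \<partial>M) - c * k x)"
proof -
  define b where "b m y = complex_of_real (bump q m y)" for m y
  have b: "b m \<in> cD" for m using bump_D[OF q] by (auto simp: b_def[abs_def])
  \<comment> \<open>A bump equals 1 at \<open>q\<close> and is no test function; subtracting the
    fixed \<open>k\<close> with the same boundary values makes it one.\<close>
  have bk: "(\<lambda>y. b m y - k y) \<in> cD0" for m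
    unfolding cD0_iff using cD_diff[OF b k(1)] k(2) q by (simp add: b_def bump_V0)
  have int: "integrable M (\<lambda>y. f y * v y)" if "v \<in> cD" for v
    using f that by (intro integrable_mult_continuous cD_continuous)
  have eq: "discrete_normal_derivative S u q m = cE u k + (\<integral>y. f y * k y \<partial>M) - (\<integral>y. f y * b m y \<partial>M) + c * (b m x - k x)" for m
  proof -
    have "cE u (b m) - cE u k = cE u (\<lambda>y. b m y - k y)"
      using u b k cE_diff[of "b m" k u] by (simp add: cE_sym[of u] cD_diff)
    also have "\<dots> = - (\<integral>y. f y * b m y - f y * k y \<partial>M) + c * (b m x - k x)"
      using weak[OF bk, of m] by (simp add: right_diff_distrib)
    also have "(\<integral>y. f y * b m y - f y * k y \<partial>M) = (\<integral>y. f y * b m y \<partial>M) - (\<integral>y. f y * k y \<partial>M)"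
      by (rule Bochner_Integration.integral_diff[OF int[OF b] int[OF k(1)]])
    finally show ?thesis
      using discrete_normal_derivative_eq[OF u q, of m] by (simp add: b_def[abs_def] algebra_simps)
  qed
  obtain B where B: "\<And>m x. x \<in> X \<Longrightarrow> \<bar>bump q m x\<bar> \<le> B" using bump_bounded[OF q] by blast
  \<comment> \<open>The bumps are uniformly bounded and eventually vanish at each point other than
    \<open>q\<close>, which has measure 0.\<close>
  have "(\<lambda>m. \<integral>y. f y * b m y \<partial>M) \<longlonglongrightarrow> (\<integral>y. 0 \<partial>M)"
  proof (rule integral_dominated_convergence[where w = "\<lambda>y. B * cmod (f y)"])
    show "(\<lambda>y. f y * b m y) \<in> borel_measurable M" for m
      using int[OF b] by (rule borel_measurable_integrable)
    show "integrable M (\<lambda>y. B * cmod (f y))" using f by simp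
    show "AE y in M. (\<lambda>m. f y * b m y) \<longlonglongrightarrow> 0"
      using AE_neq[of q] AE_space
    proof eventually_elim
      case (elim y)
      then have "\<forall>\<^sub>F m in sequentially. f y * b m y = 0"
        using bump_eventually_0[OF q, of y] by (auto simp: b_def elim: eventually_mono)
      then show ?case by (rule tendsto_eventually)
    qed
    show "AE y in M. cmod (f y * b m y) \<le> B * cmod (f y)" for m
    proof (rule AE_I2)
      fix y assume "y \<in> space M"
      then have "\<bar>bump q m y\<bar> * cmod (f y) \<le> B * cmod (f y)" using B by (intro mult_right_mono) auto
      then show "cmod (f y * b m y) \<le> B * cmod (f y)" by (simp add: b_def norm_mult mult.commute)
    qed
  qed simp
  then have 1: "(\<lambda>m. \<integral>y. f y * b m y \<partial>M) \<longlonglongrightarrow> 0" by simp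
  have 2: "(\<lambda>m. c * (b m x - k x)) \<longlonglongrightarrow> c * (0 - k x)"
  proof (cases "c = 0")
    case False
    then have "x \<in> X" "x \<noteq> q" using x q by auto
    then have "\<forall>\<^sub>F m in sequentially. b m x = 0"
      using bump_eventually_0[OF q, of x] by (auto simp: b_def elim: eventually_mono)
    then have "(\<lambda>m. b m x) \<longlonglongrightarrow> 0" by (rule tendsto_eventually)
    then show ?thesis by (intro tendsto_intros)
  qed simp
  have "(\<lambda>m. cE u k + (\<integral>y. f y * k y \<partial>M) - (\<integral>y. f y * b m y \<partial>M) + c * (b m x - k x)) \<longlonglongrightarrow>
      cE u k + (\<integral>y. f y * k y \<partial>M) - 0 + c * (0 - k x)"
    by (intro tendsto_intros 1 2)
  then show ?thesis by (simp add: has_normal_derivative_def eq[abs_def])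
qed

text \<open>The Gauss-Green formula for solutions, without point source (\<open>c = 0\<close>). Any
  \<open>k\<close> with the boundary values of the delta at \<open>q\<close> may be used; later it
  is another solution on the cell or on \<open>X\<close>.\<close>

lemma sol_normal_derivative:
  assumes u: "sol z u" and q: "q \<in> V0" and k: "k \<in> cD" "\<And>p. p \<in> V0 \<Longrightarrow> k p = of_bool (p = q)"
  shows "has_normal_derivative S u q (Ez z u k)" "normal_derivative S u q = Ez z u k"
proof -
  have uD: "u \<in> cD" using u by (simp add: sol_def)
  have "has_normal_derivative S u q (cE u k + (\<integral>y. (z * u y) * k y \<partial>M) - 0 * k q)"
  proof (rule has_normal_derivative_weak[OF uD _ q _ _ k])
    show "integrable M (\<lambda>y. z * u y)" using integrable_cD[OF uD] by simp
    show "cE u v = - (\<integral>y. z * u y * v y \<partial>M) + 0 * v q" if "v \<in> cD0" for v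
      using u that by (simp add: sol_def Ez_def mult.assoc eq_neg_iff_add_eq_0)
  qed auto
  then show *: "has_normal_derivative S u q (Ez z u k)" by (simp add: Ez_def mult.assoc)
  then show "normal_derivative S u q = Ez z u k"
    unfolding normal_derivative_def has_normal_derivative_def by (rule limI)
qed

section \<open>Gluing solutions on 1-cells\<close>

abbreviation zj :: "complex \<Rightarrow> nat \<Rightarrow> complex" where
  "zj z j \<equiv> complex_of_real (r j * \<mu> j) * z"

lemma is_eta_iff: "is_eta S z p u \<longleftrightarrow> sol z u \<and> (\<forall>q\<in>V0. u q = of_bool (p = q))"
  by (simp add: is_eta_def has_laplacian_iff)

lemma is_psi_iff: "is_psi S z p u \<longleftrightarrow> (\<forall>j\<in>L. sol (zj z j) (u \<circ> F j)) \<and> (\<forall>q\<in>V1. u q = of_bool (p = q))"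
proof -
  have "has_laplacian_on_cell S [j] u (\<lambda>x. z * u x) \<longleftrightarrow> sol (zj z j) (u \<circ> F j)" for j
    unfolding has_laplacian_on_cell_def has_laplacian_iff[symmetric] by (simp add: mult_ac comp_def)
  then show ?thesis by (simp add: is_psi_def)
qed

text \<open>The inductive step of the descent: boundary value problems are assumed solvable at the
  parameters of the 1-cells, whereas at \<open>z\<close> itself only uniqueness is
  available.\<close>

context
  fixes z :: complex
  assumes eta_ex: "\<And>j p. j \<in> L \<Longrightarrow> p \<in> V0 \<Longrightarrow> \<exists>u. is_eta S (zj z j) p u"
    and no_ev: "\<not> dirichlet_eigenvalue S z"
begin

abbreviation "\<psi> \<equiv> psi S z"
abbreviation "I \<equiv> V1 - V0"

text \<open>On each 1-cell the solutions \<open>\<eta>\<close> are combined with the prescribed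
  vertex values; these come from one function on \<open>V1\<close>, so the pieces can be
  glued.\<close>

lemma psi_exists: "\<exists>u. is_psi S z p u"
proof -
  obtain \<eta> where \<eta>: "\<And>j q. j \<in> L \<Longrightarrow> q \<in> V0 \<Longrightarrow> sol (zj z j) (\<eta> j q)"
    "\<And>j p q. j \<in> L \<Longrightarrow> p \<in> V0 \<Longrightarrow> q \<in> V0 \<Longrightarrow> \<eta> j p q = of_bool (p = q)"
    using eta_ex unfolding is_eta_iff by metis
  define g where "g j x = (\<Sum>q\<in>V0. of_bool (F j q = p) * \<eta> j q x)" for j x
  have g_V0: "g j q = of_bool (F j q = p)" if "j \<in> L" "q \<in> V0" for j q
  proof -
    have "g j q = (\<Sum>s\<in>V0. if s = q then of_bool (F j s = p) else 0)"
      unfolding g_def using \<eta>(2) that by (intro sum.cong) auto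
    then show ?thesis using that by simp
  qed
  have glue: "glue g (F j x) = g j x" if "j \<in> L" "x \<in> X" for j x
    by (rule glue_F[where \<phi> = "\<lambda>y. of_bool (y = p)"]) (use that g_V0 in auto)
  have "sol (zj z j) (g j)" if j: "j \<in> L" for j
  proof -
    have cD: "\<eta> j q \<in> cD" if "q \<in> V0" for q using \<eta>(1)[OF j that] by (simp add: sol_def)
    have "Ez (zj z j) (g j) v = 0" if "v \<in> cD0" for v
      unfolding g_def using \<eta>(1)[OF j] that cD
      by (subst Ez_sum) (auto simp: Ez_scale sol_def cD0_cD intro!: sum.neutral)
    moreover have "g j \<in> cD" unfolding g_def using cD by (intro cD_sum cD_scale)
    ultimately show ?thesis by (simp add: sol_def)
  qed
  then have "sol (zj z j) (glue g \<circ> F j)" if "j \<in> L" for j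
    using that glue by (intro sol_cong[of "g j" "glue g \<circ> F j"]) auto
  moreover have "glue g q = of_bool (p = q)" if "q \<in> V1" for q
    using that glue g_V0 by (auto simp: V1_eq)
  ultimately show ?thesis unfolding is_psi_iff by blast
qed

lemma psi_sol: "j \<in> L \<Longrightarrow> sol (zj z j) (\<psi> p \<circ> F j)"
  and psi_V1: "q \<in> V1 \<Longrightarrow> \<psi> p q = of_bool (p = q)"
  using someI_ex[OF psi_exists[of p]] unfolding is_psi_iff psi_def by auto

lemma psi_cD [simp, intro]: "\<psi> p \<in> cD"
proof (rule cD_glue)
  fix j assume "j \<in> L"
  then show "\<psi> p \<circ> F j \<in> cD" using psi_sol[of j p] by (simp add: sol_def)
qed

lemma psi_cD0 [simp, intro]: "p \<in> I \<Longrightarrow> \<psi> p \<in> cD0"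
  by (auto simp: cD0_iff psi_V1)

lemma finite_I [simp]: "finite I" by simp

lemma comp_F_cD0: "v \<in> cD \<Longrightarrow> j \<in> L \<Longrightarrow> (\<And>q. q \<in> V0 \<Longrightarrow> v (F j q) = 0) \<Longrightarrow> v \<circ> F j \<in> cD0"
  by (simp add: cD0_iff cD_comp_F)

text \<open>The form splits over the 1-cells; on each of them \<open>\<psi> p\<close> is a solution
  and \<open>v\<close> a test function.\<close>

lemma Ez_psi_vanish: "v \<in> cD \<Longrightarrow> (\<And>q. q \<in> V1 \<Longrightarrow> v q = 0) \<Longrightarrow> Ez z (\<psi> p) v = 0"
proof -
  assume v: "v \<in> cD" "\<And>q. q \<in> V1 \<Longrightarrow> v q = 0"
  have "Ez (zj z j) (\<psi> p \<circ> F j) (v \<circ> F j) = 0" if j: "j \<in> L" for j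
    using psi_sol[OF j, of p] comp_F_cD0[OF v(1) j] v(2) j by (simp add: sol_def)
  then show ?thesis using v by (simp add: Ez_self_similar)
qed

text \<open>The piecewise solution with the values of \<open>v\<close> at the interior vertices. For
  \<open>v\<close> in \<open>cD0\<close> the difference \<open>v - interp v\<close> vanishes on
  \<open>V1\<close>, so it is a test function on every 1-cell.\<close>

definition interp :: "('a \<Rightarrow> complex) \<Rightarrow> 'a \<Rightarrow> complex" where
  "interp v x = (\<Sum>p\<in>I. v p * \<psi> p x)"

lemma interp_cD0 [simp, intro]: "interp v \<in> cD0"
  unfolding interp_def[abs_def] by (intro cD0_sum cD0_scale psi_cD0)

lemma interp_V1: "v \<in> cD0 \<Longrightarrow> q \<in> V1 \<Longrightarrow> interp v q = v q"
proof -
  assume v: "v \<in> cD0" "q \<in> V1"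
  have "interp v q = (\<Sum>p\<in>I. if p = q then v p else 0)"
    unfolding interp_def using v by (intro sum.cong) (auto simp: psi_V1)
  then show ?thesis using v by (auto simp: cD0_iff)
qed

lemma Ez_interp: "g \<in> cD \<Longrightarrow> Ez z g (interp v) = (\<Sum>q\<in>I. v q * Ez z g (\<psi> q))"
  unfolding interp_def[abs_def] by (simp add: Ez_sum_right Ez_scale_right cD_scale)

lemma Ez_psi: "v \<in> cD0 \<Longrightarrow> Ez z (\<psi> p) v = (\<Sum>q\<in>I. v q * Ez z (\<psi> p) (\<psi> q))"
proof -
  assume v: "v \<in> cD0"
  have "Ez z (\<psi> p) (\<lambda>x. v x - interp v x) = 0"
    using v interp_V1[OF v] by (intro Ez_psi_vanish) auto
  then show ?thesis
    using v Ez_interp[OF psi_cD, of p v] by (simp add: Ez_diff_right cD0_cD)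
qed

text \<open>On a 1-cell containing \<open>q\<close>, \<open>\<psi> q\<close> has the boundary values
  of a delta, so the Gauss-Green formula identifies the normal derivative with the form. On any
  other 1-cell \<open>\<psi> q\<close> is a test function and contributes nothing.\<close>

lemma Bmat_eq:
  assumes p: "p \<in> I" and q: "q \<in> I"
  shows "Bmat S z p q = Ez z (\<psi> p) (\<psi> q)"
proof -
  have "Ez z (\<psi> p) (\<psi> q) = (\<Sum>j\<in>L. complex_of_real (inverse (r j)) * Ez (zj z j) (\<psi> p \<circ> F j) (\<psi> q \<circ> F j))"
    by (rule Ez_self_similar) auto
  also have "\<dots> = (\<Sum>j\<in>L. if q \<in> F j ` X then cell_normal_derivative S [j] (\<psi> p) q else 0)"
  proof (intro sum.cong refl)
    fix j assume j: "j \<in> L"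
    show "complex_of_real (inverse (r j)) * Ez (zj z j) (\<psi> p \<circ> F j) (\<psi> q \<circ> F j) =
        (if q \<in> F j ` X then cell_normal_derivative S [j] (\<psi> p) q else 0)"
    proof (cases "q \<in> F j ` X")
      case True
      then obtain y where y: "y \<in> X" "q = F j y" by blast
      then have "y \<in> V0" using F_in_V1[OF j, of y] q by auto
      have "normal_derivative S (\<psi> p \<circ> F j) y = Ez (zj z j) (\<psi> p \<circ> F j) (\<psi> q \<circ> F j)"
      proof (rule sol_normal_derivative(2)[OF psi_sol[OF j] \<open>y \<in> V0\<close>])
        show "(\<psi> q \<circ> F j) s = of_bool (s = y)" if "s \<in> V0" for s
          using that j y by (auto simp: psi_V1)
      qed (use j in \<open>simp add: cD_comp_F\<close>)
      then show ?thesis using True j y by (simp add: cell_normal_derivative_def)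
    next
      case False
      then have "\<psi> q \<circ> F j \<in> cD0"
        using j by (intro comp_F_cD0) (auto simp: psi_V1)
      then show ?thesis using False psi_sol[OF j, of p] by (simp add: sol_def)
    qed
  qed
  also have "\<dots> = Bmat S z p q"
    unfolding Bmat_def cell_single by (simp add: sum.inter_filter[symmetric])
  finally show ?thesis by simp
qed

text \<open>A vector annihilated by \<open>Bmat\<close> gives a combination of the
  \<open>\<psi> p\<close> that solves the homogeneous Dirichlet problem, hence is 0; its values at
  the interior vertices are the entries of the vector.\<close>

lemma inverse_Gmat: "inverse_matrix_on I (Bmat S z) (Gmat S z)"
proof -
  have "\<exists>A. inverse_matrix_on I (Bmat S z) A"
  proof (rule inverse_matrix_on_exists[OF finite_I])
    fix a p assume a: "\<And>q. q \<in> I \<Longrightarrow> (\<Sum>p\<in>I. a p * Bmat S z p q) = 0" and p: "p \<in> I"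
    define u where "u x = (\<Sum>p\<in>I. a p * \<psi> p x)" for x
    have "Ez z u v = 0" if v: "v \<in> cD0" for v
    proof -
      have "Ez z u v = (\<Sum>p\<in>I. a p * Ez z (\<psi> p) v)"
        unfolding u_def[abs_def] using v by (simp add: Ez_sum Ez_scale cD_scale cD0_cD)
      also have "\<dots> = (\<Sum>p\<in>I. \<Sum>q\<in>I. v q * (a p * Bmat S z p q))"
        by (intro sum.cong refl) (simp add: Ez_psi[OF v] sum_distrib_left Bmat_eq mult_ac)
      also have "\<dots> = (\<Sum>q\<in>I. v q * (\<Sum>p\<in>I. a p * Bmat S z p q))"
        by (subst sum.swap) (simp add: sum_distrib_left)
      finally show ?thesis using a by simp
    qed
    moreover have "u \<in> cD0" unfolding u_def[abs_def] by (intro cD0_sum cD0_scale psi_cD0)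
    moreover have "p \<in> X" using p V1_subset_X by blast
    ultimately have "u p = 0" using dirichlet_eigenvalueI[OF no_ev, of u p] by blast
    moreover have "u p = (\<Sum>s\<in>I. if s = p then a s else 0)"
      unfolding u_def using p by (intro sum.cong) (auto simp: psi_V1)
    ultimately show "a p = 0" using p by simp
  qed
  then show ?thesis unfolding Gmat_def One_nat_def by (rule someI_ex)
qed

text \<open>The functional is split into parts acting on \<open>v - interp v\<close> in the 1-cells
  and a part seeing only interior vertex values. The glued solutions account for the former, with
  \<open>r j\<close> cancelling the scaling of the energy, and the combination with
  \<open>Gmat\<close> for the latter. The abstract \<open>\<phi>j\<close> lets one argument serve
  boundary data, point sources and integrals.\<close>

lemma solves_step:
  assumes U: "\<And>j. j \<in> L \<Longrightarrow> solves (zj z j) (\<phi>j j) (U j)"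
    and \<phi>: "\<And>v. v \<in> cD0 \<Longrightarrow> \<phi> v = (\<Sum>j\<in>L. \<phi>j j ((\<lambda>x. v x - interp v x) \<circ> F j)) + (\<Sum>q\<in>I. v q * \<phi> (\<psi> q))"
  shows "solves z \<phi> (\<lambda>y. glue (\<lambda>j x. complex_of_real (r j) * U j x) y + (\<Sum>p\<in>I. \<Sum>q\<in>I. Gmat S z p q * \<phi> (\<psi> p) * \<psi> q y))"
    and "j \<in> L \<Longrightarrow> x \<in> X \<Longrightarrow> glue (\<lambda>j x. complex_of_real (r j) * U j x) (F j x) = complex_of_real (r j) * U j x"
proof -
  define \<gamma> where "\<gamma> = glue (\<lambda>j x. complex_of_real (r j) * U j x)"
  have UD: "U j \<in> cD0" if "j \<in> L" for j using U[OF that] by (simp add: solves_def)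
  have \<gamma>F: "\<gamma> (F j x) = complex_of_real (r j) * U j x" if "j \<in> L" "x \<in> X" for j x
    unfolding \<gamma>_def by (rule glue_F[where \<phi> = "\<lambda>y. 0"]) (use UD that in \<open>auto simp: cD0_iff\<close>)
  then show "glue (\<lambda>j x. complex_of_real (r j) * U j x) (F j x) = complex_of_real (r j) * U j x" if "j \<in> L" "x \<in> X" for j x
    using that by (simp add: \<gamma>_def)
  have "\<gamma> \<in> cD"
  proof (rule cD_glue)
    fix j assume j: "j \<in> L"
    show "\<gamma> \<circ> F j \<in> cD"
      by (rule cD_cong[of "\<lambda>x. complex_of_real (r j) * U j x"]) (use UD j \<gamma>F in auto)
  qed
  moreover have "\<gamma> q = 0" if q: "q \<in> V0" for q
    using \<gamma>F[of "fixing_letter S q" q] fixing_letter[OF q] UD[of "fixing_letter S q"] q by (simp add: cD0_iff)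
  ultimately have \<gamma>: "\<gamma> \<in> cD0" by (simp add: cD0_iff)
  have E\<gamma>: "Ez z \<gamma> w = (\<Sum>j\<in>L. Ez (zj z j) (U j) (w \<circ> F j))" if w: "w \<in> cD" for w
  proof -
    have "Ez (zj z j) (\<gamma> \<circ> F j) (w \<circ> F j) = complex_of_real (r j) * Ez (zj z j) (U j) (w \<circ> F j)" if j: "j \<in> L" for j
    proof -
      have "Ez (zj z j) (\<gamma> \<circ> F j) (w \<circ> F j) = Ez (zj z j) (\<lambda>x. complex_of_real (r j) * U j x) (w \<circ> F j)"
        using \<gamma>F[OF j] by (intro Ez_cong) auto
      then show ?thesis using UD[OF j] w j by (simp add: Ez_scale cD_comp_F cD0_cD)
    qed
    then show ?thesis
      using w \<gamma> r_pos by (subst Ez_self_similar) (auto intro!: sum.cong simp: less_imp_neq[symmetric])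
  qed
  \<comment> \<open>In each 1-cell \<open>\<psi> q\<close> is a solution and \<open>U j\<close> a
    test function, so the glued part does not disturb the equations at the vertices.\<close>
  have "Ez z \<gamma> (\<psi> q) = 0" for q
  proof -
    have "Ez (zj z j) (U j) (\<psi> q \<circ> F j) = 0" if "j \<in> L" for j
      using psi_sol[OF that, of q] UD[OF that] Ez_sym[of "U j" "\<psi> q \<circ> F j" "zj z j"] by (auto simp: sol_def)
    then show ?thesis using E\<gamma>[of "\<psi> q"] by simp
  qed
  then have E\<gamma>I: "Ez z \<gamma> (interp v) = 0" for v using \<gamma> by (simp add: Ez_interp cD0_cD)
  have E\<gamma>v: "Ez z \<gamma> v = (\<Sum>j\<in>L. \<phi>j j ((\<lambda>x. v x - interp v x) \<circ> F j))" if v: "v \<in> cD0" for v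
  proof -
    have w: "(\<lambda>x. v x - interp v x) \<in> cD" using v by auto
    have "Ez z \<gamma> v = Ez z \<gamma> (\<lambda>x. v x - interp v x)"
      using v \<gamma> E\<gamma>I[of v] by (simp add: Ez_diff_right cD0_cD)
    also have "\<dots> = (\<Sum>j\<in>L. \<phi>j j ((\<lambda>x. v x - interp v x) \<circ> F j))"
      unfolding E\<gamma>[OF w]
    proof (intro sum.cong refl)
      fix j assume j: "j \<in> L"
      have "(\<lambda>x. v x - interp v x) \<circ> F j \<in> cD0"
        using w j interp_V1[OF v] by (intro comp_F_cD0) auto
      then show "Ez (zj z j) (U j) ((\<lambda>x. v x - interp v x) \<circ> F j) = \<phi>j j ((\<lambda>x. v x - interp v x) \<circ> F j)"
        using U[OF j] by (simp add: solves_def)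
    qed
    finally show ?thesis .
  qed
  define \<sigma> where "\<sigma> y = (\<Sum>p\<in>I. \<Sum>q\<in>I. Gmat S z p q * \<phi> (\<psi> p) * \<psi> q y)" for y
  have \<sigma>: "\<sigma> \<in> cD0" unfolding \<sigma>_def[abs_def] by (intro cD0_sum cD0_scale psi_cD0)
  have E\<sigma>: "Ez z \<sigma> v = (\<Sum>p\<in>I. v p * \<phi> (\<psi> p))" if v: "v \<in> cD0" for v
  proof -
    have "Ez z \<sigma> v = (\<Sum>p\<in>I. \<Sum>q\<in>I. Gmat S z p q * \<phi> (\<psi> p) * Ez z (\<psi> q) v)"
      unfolding \<sigma>_def[abs_def] using v by (simp add: Ez_sum Ez_scale cD_scale cD_sum cD0_cD)
    also have "\<dots> = (\<Sum>p\<in>I. \<Sum>q\<in>I. \<Sum>s\<in>I. (v s * \<phi> (\<psi> p)) * (Gmat S z p q * Bmat S z q s))"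
      by (intro sum.cong refl) (simp add: Ez_psi[OF v] Bmat_eq sum_distrib_left mult_ac)
    also have "\<dots> = (\<Sum>p\<in>I. \<Sum>s\<in>I. (v s * \<phi> (\<psi> p)) * (\<Sum>q\<in>I. Gmat S z p q * Bmat S z q s))"
      by (rule sum.cong[OF refl], subst sum.swap) (simp add: sum_distrib_left)
    also have "\<dots> = (\<Sum>p\<in>I. \<Sum>s\<in>I. if s = p then v s * \<phi> (\<psi> p) else 0)"
      using inverse_Gmat by (intro sum.cong refl) (simp add: inverse_matrix_on_def)
    finally show ?thesis by simp
  qed
  have "Ez z (\<lambda>y. \<gamma> y + \<sigma> y) v = \<phi> v" if v: "v \<in> cD0" for v
    using v \<gamma> \<sigma> E\<gamma>v[OF v] E\<sigma>[OF v] \<phi>[OF v] by (simp add: Ez_add cD0_cD)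
  then show "solves z \<phi> (\<lambda>y. glue (\<lambda>j x. complex_of_real (r j) * U j x) y + (\<Sum>p\<in>I. \<Sum>q\<in>I. Gmat S z p q * \<phi> (\<psi> p) * \<psi> q y))"
    using \<gamma> \<sigma> unfolding solves_def \<gamma>_def \<sigma>_def by auto
qed

lemma solves_zero: "solves z' (\<lambda>v. 0) (\<lambda>x. 0)"
  by (auto simp: solves_def)

text \<open>\<open>\<psi> p\<close> has the right boundary values but fails the equation at the
  interior vertices. By \<open>Ez_psi\<close> the defect depends on interior vertex values alone, so
  the cell parts of the correction are 0.\<close>

lemma eta_step: "\<exists>u. is_eta S z p u" if p: "p \<in> V0"
proof -
  have "\<exists>U. solves z (\<lambda>v. - Ez z (\<psi> p) v) U"
  proof (rule exI, rule solves_step(1)[where \<phi>j = "\<lambda>j v. 0" and U = "\<lambda>j x. 0"])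
    show "- Ez z (\<psi> p) v = (\<Sum>j\<in>L. 0) + (\<Sum>q\<in>I. v q * - Ez z (\<psi> p) (\<psi> q))" if "v \<in> cD0" for v
      using Ez_psi[OF that, of p] by (simp add: sum_negf)
  qed (rule solves_zero)
  then obtain U where U: "U \<in> cD0" "\<And>v. v \<in> cD0 \<Longrightarrow> Ez z U v = - Ez z (\<psi> p) v" by (auto simp: solves_def)
  then have "sol z (\<lambda>x. \<psi> p x + U x)" by (auto simp: sol_def Ez_add)
  moreover have "\<psi> p q + U q = of_bool (p = q)" if "q \<in> V0" for q
    using U that by (simp add: psi_V1 cD0_iff)
  ultimately show ?thesis unfolding is_eta_iff by blast
qed

text \<open>A vertex may lie in several 1-cells and be counted repeatedly, but there
  \<open>v - interp v\<close> is 0; any other point lies in exactly one 1-cell.\<close>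

lemma point_functional_split:
  assumes "v \<in> cD0" "x \<in> X"
  shows "v x = (\<Sum>j\<in>L. if x \<in> F j ` X then ((\<lambda>x. v x - interp v x) \<circ> F j) (inv (F j) x) else 0) + (\<Sum>q\<in>I. v q * \<psi> q x)"
proof -
  let ?w = "\<lambda>x. v x - interp v x"
  obtain k y where k: "k \<in> L" "y \<in> X" "x = F k y" using assms(2) X_cases by blast
  have "(\<Sum>j\<in>L. if x \<in> F j ` X then (?w \<circ> F j) (inv (F j) x) else 0) = (\<Sum>j\<in>L. if x \<in> F j ` X then ?w x else 0)"
    by (intro sum.cong refl) auto
  also have "\<dots> = ?w x"
  proof (cases "x \<in> V1")
    case True
    then show ?thesis using interp_V1[OF assms(1)] by (simp cong: if_cong)
  next
    case False
    have "x \<in> F j ` X \<longleftrightarrow> j = k" if "j \<in> L" for j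
      using False F_inter(1)[of k j y] F_in_V1[of k y] k that by auto
    then have "(\<Sum>j\<in>L. if x \<in> F j ` X then ?w x else 0) = (\<Sum>j\<in>L. if j = k then ?w x else 0)"
      by (intro sum.cong) auto
    then show ?thesis using k by simp
  qed
  finally show ?thesis by (simp add: interp_def)
qed

text \<open>The values of \<open>\<gamma>\<close> on the 1-cells are part of the conclusion because
  the series for the kernel is read off from them.\<close>

lemma green_step:
  assumes x: "x \<in> X" and g: "\<And>j y. j \<in> L \<Longrightarrow> y \<in> X \<Longrightarrow> solves (zj z j) (\<lambda>v. v y) (g j y)"
  shows "\<exists>\<gamma>. solves z (\<lambda>v. v x) (\<lambda>y. \<gamma> y + Psi S z x y) \<and>
    (\<forall>j\<in>L. \<forall>y\<in>X. \<gamma> (F j y) = (if x \<in> F j ` X then complex_of_real (r j) * g j (inv (F j) x) y else 0))"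
proof -
  define U where "U j = (if x \<in> F j ` X then g j (inv (F j) x) else (\<lambda>y. 0))" for j
  define \<phi>j :: "nat \<Rightarrow> ('a \<Rightarrow> complex) \<Rightarrow> complex" where "\<phi>j j v = (if x \<in> F j ` X then v (inv (F j) x) else 0)" for j v
  have U: "solves (zj z j) (\<phi>j j) (U j)" if "j \<in> L" for j
    using g[OF that, of "inv (F j) x"] that unfolding U_def \<phi>j_def by (auto simp: solves_zero)
  have \<phi>: "v x = (\<Sum>j\<in>L. \<phi>j j ((\<lambda>x. v x - interp v x) \<circ> F j)) + (\<Sum>q\<in>I. v q * \<psi> q x)" if "v \<in> cD0" for v
    unfolding \<phi>j_def by (rule point_functional_split[OF that x])
  note step = solves_step[where \<phi> = "\<lambda>v. v x", OF U \<phi>]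
  show ?thesis
    using step(1) step(2)
    by (intro exI[of _ "glue (\<lambda>j x. complex_of_real (r j) * U j x)"] conjI) (auto simp: Psi_def U_def)
qed

text \<open>By self-similarity of \<open>M\<close> the part of the functional in the 1-cell of
  \<open>j\<close> is again an integral, with density \<open>\<mu> j\<close> times
  \<open>f \<circ> F j\<close>.\<close>

lemma integral_step:
  assumes f: "integrable M f"
    and ex: "\<And>j f. j \<in> L \<Longrightarrow> integrable M f \<Longrightarrow> \<exists>g. solves (zj z j) (\<lambda>v. \<integral>x. f x * v x \<partial>M) g"
  shows "\<exists>g. solves z (\<lambda>v. \<integral>x. f x * v x \<partial>M) g"
proof -
  define h where "h j x = complex_of_real (\<mu> j) * f (F j x)" for j x
  have "\<exists>g. solves (zj z j) (\<lambda>v. \<integral>x. h j x * v x \<partial>M) g" if "j \<in> L" for j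
    using integral_self_similar(1)[OF f that] by (intro ex that) (simp add: h_def[abs_def] comp_def)
  then obtain U where U: "\<And>j. j \<in> L \<Longrightarrow> solves (zj z j) (\<lambda>v. \<integral>x. h j x * v x \<partial>M) (U j)" by metis
  have int: "integrable M (\<lambda>x. f x * v x)" if "v \<in> cD" for v
    using f that by (intro integrable_mult_continuous cD_continuous)
  show ?thesis
  proof (rule exI, rule solves_step(1)[OF U])
    fix v assume v: "v \<in> cD0"
    let ?w = "\<lambda>x. v x - interp v x"
    have "(\<integral>x. f x * v x \<partial>M) = (\<integral>x. f x * ?w x + (\<Sum>q\<in>I. v q * (f x * \<psi> q x)) \<partial>M)"
      by (intro Bochner_Integration.integral_cong refl) (simp add: interp_def right_diff_distrib sum_distrib_left mult_ac)
    also have "\<dots> = (\<integral>x. f x * ?w x \<partial>M) + (\<Sum>q\<in>I. v q * (\<integral>x. f x * \<psi> q x \<partial>M))"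
    proof (subst Bochner_Integration.integral_add)
      show "integrable M (\<lambda>x. f x * ?w x)"
        by (rule int[OF cD_diff]) (use v in auto)
      show "integrable M (\<lambda>x. \<Sum>q\<in>I. v q * (f x * \<psi> q x))"
        using int by (intro Bochner_Integration.integrable_sum integrable_mult_right) auto
    qed (use int in \<open>simp add: Bochner_Integration.integral_sum\<close>)
    also have "(\<integral>x. f x * ?w x \<partial>M) = (\<Sum>j\<in>L. \<integral>x. h j x * (?w \<circ> F j) x \<partial>M)"
      using integral_self_similar(2)[OF int[OF cD_diff[OF cD0_cD[OF v] cD0_cD[OF interp_cD0]]]]
      by (simp add: h_def scaleR_conv_of_real mult.assoc)
    finally show "(\<integral>x. f x * v x \<partial>M) = (\<Sum>j\<in>L. \<integral>x. h j x * (?w \<circ> F j) x \<partial>M) + (\<Sum>q\<in>I. v q * (\<integral>x. f x * \<psi> q x \<partial>M))" .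
  qed
qed

end

section \<open>Solvability at all admissible parameters\<close>

text \<open>The first clause is what the next gluing step consumes; the other two supply the Green
  function and the solutions with an integrable right-hand side.\<close>

definition regular :: "complex \<Rightarrow> bool" where
  "regular z \<longleftrightarrow> (\<forall>p\<in>V0. \<exists>u. is_eta S z p u) \<and> (\<forall>x\<in>X. \<exists>g. solves z (\<lambda>v. v x) g) \<and>
     (\<forall>f. integrable M f \<longrightarrow> (\<exists>g. solves z (\<lambda>v. \<integral>x. f x * v x \<partial>M) g))"

definition admissible :: "complex \<Rightarrow> bool" where
  "admissible z \<longleftrightarrow> (\<forall>w\<in>words S. \<not> dirichlet_eigenvalue S (complex_of_real (rword S w * muword S w) * z))"

lemma admissible_zj: "admissible z \<Longrightarrow> j \<in> L \<Longrightarrow> admissible (zj z j)"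
  unfolding admissible_def
proof
  fix w assume a: "\<forall>w\<in>words S. \<not> dirichlet_eigenvalue S (complex_of_real (rword S w * muword S w) * z)"
    and "j \<in> L" "w \<in> words S"
  then have "\<not> dirichlet_eigenvalue S (complex_of_real (rword S (j # w) * muword S (j # w)) * z)"
    by (intro a[rule_format]) simp
  then show "\<not> dirichlet_eigenvalue S (complex_of_real (rword S w * muword S w) * zj z j)"
    by (simp add: mult_ac)
qed

lemma admissible_no_ev: "admissible z \<Longrightarrow> \<not> dirichlet_eigenvalue S z"
  unfolding admissible_def by (auto dest: bspec[where x = "[]"])

lemma regular_small:
  assumes z: "cmod z * K\<^sup>2 \<le> 1/2" shows "regular z"
  unfolding regular_def
proof (intro conjI ballI allI impI)
  show "\<exists>g. solves z (\<lambda>v. v x) g" if "x \<in> X" for x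
    using solves_small[OF z bounded_functional_point[OF that]] .
  show "\<exists>g. solves z (\<lambda>v. \<integral>x. f x * v x \<partial>M) g" if "integrable M f" for f
    using solves_small[OF z bounded_functional_integral[OF that]] .
  fix p assume p: "p \<in> V0"
  \<comment> \<open>A harmonic function carries the boundary values, and \<open>g\<close> in
    \<open>cD0\<close> removes its defect \<open>z * h\<close>.\<close>
  define h where "h x = complex_of_real (harm (\<lambda>q. of_bool (p = q)) x)" for x
  have h: "h \<in> cD" unfolding h_def[abs_def] by (intro cD_of_real harm_D)
  have hv: "cE h v = 0" if v: "v \<in> cD0" for v
  proof -
    have "E (harm a) f = 0" if "f \<in> D0" for a f
    proof -
      have "E (harm a) f = E0 a f" by (rule E_harm[OF D0_D[OF that]])
      also have "E0 a f = E0 a (\<lambda>x. 0)" by (rule E0_cong) (simp_all add: D0_V0[OF that])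
      finally show ?thesis by (simp add: energy0_def)
    qed
    moreover have "E (\<lambda>x. 0) f = 0" if "f \<in> D" for f using E_scale[OF that that, of 0] by simp
    ultimately show ?thesis using v by (simp add: cenergy_def h_def cD0_Re_Im D0_D complex_eq_iff)
  qed
  have "integrable M (\<lambda>x. - z * h x)" using integrable_cD[OF h] by simp
  then obtain g where g: "g \<in> cD0" "\<And>v. v \<in> cD0 \<Longrightarrow> Ez z g v = (\<integral>x. (- z * h x) * v x \<partial>M)"
    using solves_small[OF z bounded_functional_integral, of "\<lambda>x. - z * h x"] unfolding solves_def by auto
  have "Ez z (\<lambda>x. h x + g x) v = 0" if v: "v \<in> cD0" for v
    using h g v hv[OF v] by (simp add: Ez_add Ez_def[of z h] mult.assoc)
  then have "sol z (\<lambda>x. h x + g x)" using h g by (auto simp: sol_def)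
  moreover have "h q + g q = of_bool (p = q)" if "q \<in> V0" for q
    using that g by (simp add: h_def cD0_iff)
  ultimately show "\<exists>u. is_eta S z p u" unfolding is_eta_iff by blast
qed

lemma regular_step:
  assumes reg: "\<And>j. j \<in> L \<Longrightarrow> regular (zj z j)" and ev: "\<not> dirichlet_eigenvalue S z"
  shows "regular z"
proof -
  have eta: "\<exists>u. is_eta S (zj z j) p u" if "j \<in> L" "p \<in> V0" for j p
    using reg[OF that(1)] that(2) unfolding regular_def by blast
  have "\<exists>u. is_eta S z p u" if "p \<in> V0" for p
    by (rule eta_step[OF eta ev that])
  moreover have "\<exists>g. solves z (\<lambda>v. v x) g" if x: "x \<in> X" for x
  proof -
    have "\<forall>j y. \<exists>g. j \<in> L \<longrightarrow> y \<in> X \<longrightarrow> solves (zj z j) (\<lambda>v. v y) g"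
      using reg unfolding regular_def by blast
    then obtain g where "\<And>j y. j \<in> L \<Longrightarrow> y \<in> X \<Longrightarrow> solves (zj z j) (\<lambda>v. v y) (g j y)" by metis
    then show ?thesis using green_step[OF eta ev x] by blast
  qed
  moreover have "\<exists>g. solves z (\<lambda>v. \<integral>x. f x * v x \<partial>M) g" if f: "integrable M f" for f
  proof (rule integral_step[OF eta ev f])
    show "\<exists>g. solves (zj z j) (\<lambda>v. \<integral>x. f x * v x \<partial>M) g" if "j \<in> L" "integrable M f" for j f
      using reg[OF that(1)] that(2) unfolding regular_def by blast
  qed
  ultimately show ?thesis unfolding regular_def by blast
qed

lemma norm_zj_le: "j \<in> L \<Longrightarrow> cmod (zj z j) \<le> \<rho> * cmod z"
proof -
  assume j: "j \<in> L"
  have "\<bar>r j * \<mu> j\<bar> \<le> \<rho> * 1"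
    using j r_pos[OF j] weight_pos[OF j] weight_less_1[OF j] \<rho> by (simp add: mult_mono abs_mult del: mult_1_right)
  then show ?thesis by (simp add: norm_mult mult_right_mono abs_mult)
qed

lemma admissible_imp_regular: "admissible z \<Longrightarrow> regular z"
proof -
  have *: "admissible z \<Longrightarrow> \<rho> ^ n * cmod z * K\<^sup>2 \<le> 1/2 \<Longrightarrow> regular z" for n
  proof (induction n arbitrary: z)
    case 0
    then show ?case by (intro regular_small) simp
  next
    case (Suc n)
    show ?case
    proof (rule regular_step[OF _ admissible_no_ev[OF Suc.prems(1)]])
      fix j assume j: "j \<in> L"
      have "\<rho> ^ n * cmod (zj z j) * K\<^sup>2 \<le> \<rho> ^ n * (\<rho> * cmod z) * K\<^sup>2"
        using norm_zj_le[OF j, of z] \<rho> by (intro mult_right_mono mult_left_mono) auto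
      also have "\<dots> \<le> 1/2" using Suc.prems by (simp add: mult_ac)
      finally show "regular (zj z j)" by (intro Suc.IH admissible_zj Suc.prems j)
    qed
  qed
  assume "admissible z"
  have "(\<lambda>n. \<rho> ^ n * cmod z * K\<^sup>2) \<longlonglongrightarrow> 0 * cmod z * K\<^sup>2"
    using \<rho> by (intro tendsto_intros LIMSEQ_power_zero) auto
  then have "\<forall>\<^sub>F n in sequentially. \<rho> ^ n * cmod z * K\<^sup>2 < 1/2"
    by (intro order_tendstoD(2)) auto
  then obtain n where "\<rho> ^ n * cmod z * K\<^sup>2 < 1/2" by (auto simp: eventually_sequentially)
  then show ?thesis using *[OF \<open>admissible z\<close>, of n] by simp
qed

lemma solves_unique:
  assumes "\<not> dirichlet_eigenvalue S z" "solves z \<phi> g" "solves z \<phi> g'" "x \<in> X"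
  shows "g x = g' x"
proof -
  have g: "g \<in> cD0" "g' \<in> cD0" using assms by (auto simp: solves_def)
  have "g x - g' x = 0"
  proof (rule dirichlet_eigenvalueI[OF assms(1) _ _ assms(4)])
    show "(\<lambda>x. g x - g' x) \<in> cD0" using g by auto
    show "Ez z (\<lambda>x. g x - g' x) v = 0" if "v \<in> cD0" for v
      using assms g that by (simp add: Ez_diff solves_def)
  qed
  then show ?thesis by simp
qed

section \<open>The Dirichlet resolvent kernel\<close>

definition green :: "complex \<Rightarrow> 'a \<Rightarrow> 'a \<Rightarrow> complex" where
  "green z x = (SOME g. solves z (\<lambda>v. v x) g)"

lemma green: "admissible z \<Longrightarrow> x \<in> X \<Longrightarrow> solves z (\<lambda>v. v x) (green z x)"
proof -
  assume "admissible z" "x \<in> X"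
  then have "\<exists>g. solves z (\<lambda>v. v x) g" using admissible_imp_regular[of z] unfolding regular_def by blast
  then show ?thesis unfolding green_def by (rule someI_ex)
qed

lemma green_cD0: "admissible z \<Longrightarrow> x \<in> X \<Longrightarrow> green z x \<in> cD0"
  and Ez_green: "admissible z \<Longrightarrow> x \<in> X \<Longrightarrow> v \<in> cD0 \<Longrightarrow> Ez z (green z x) v = v x"
  using green[of z x] by (auto simp: solves_def)

text \<open>Each of the two Green functions is a test function for the other, and \<open>Ez\<close>
  is symmetric.\<close>

lemma green_sym: "admissible z \<Longrightarrow> x \<in> X \<Longrightarrow> y \<in> X \<Longrightarrow> green z x y = green z y x"
  using Ez_green[of z x "green z y"] Ez_green[of z y "green z x"] Ez_sym[of "green z x" "green z y" z]
  by (simp add: green_cD0)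

lemma green_V0: "admissible z \<Longrightarrow> x \<in> X \<Longrightarrow> y \<in> V0 \<Longrightarrow> green z x y = 0"
  using green_cD0[of z x] by (simp add: cD0_iff)

lemma eta_zj_exists: "admissible z \<Longrightarrow> j \<in> L \<Longrightarrow> p \<in> V0 \<Longrightarrow> \<exists>u. is_eta S (zj z j) p u"
  using admissible_imp_regular[OF admissible_zj, of z j] unfolding regular_def by blast

lemma Psi_V0: "admissible z \<Longrightarrow> x \<in> V0 \<Longrightarrow> Psi S z x y = 0"
  unfolding Psi_def using psi_V1[OF eta_zj_exists admissible_no_ev, of z x]
  by (auto intro!: sum.neutral)

text \<open>By uniqueness \<open>green z x\<close> is the function built in
  \<open>green_step\<close>. If \<open>y\<close> lies in several 1-cells it is a vertex, where their
  Green functions vanish, so summing over all 1-cells through \<open>y\<close> is harmless.\<close>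

lemma green_decomposition:
  assumes z: "admissible z" and x: "x \<in> X" and y: "y \<in> X"
  shows "green z x y = Psi S z x y + (\<Sum>j\<in>L. if x \<in> F j ` X \<and> y \<in> F j ` X
    then complex_of_real (r j) * green (zj z j) (inv (F j) x) (inv (F j) y) else 0)"
proof -
  obtain \<gamma> where \<gamma>: "solves z (\<lambda>v. v x) (\<lambda>y. \<gamma> y + Psi S z x y)"
    "\<And>j y. j \<in> L \<Longrightarrow> y \<in> X \<Longrightarrow> \<gamma> (F j y) = (if x \<in> F j ` X then complex_of_real (r j) * green (zj z j) (inv (F j) x) y else 0)"
    using green_step[OF eta_zj_exists[OF z] admissible_no_ev[OF z] x, of "\<lambda>j. green (zj z j)"] green admissible_zj[OF z] by blast
  obtain k y' where k: "k \<in> L" "y' \<in> X" "y = F k y'" using y X_cases by blast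
  have "\<gamma> y = (\<Sum>j\<in>L. if x \<in> F j ` X \<and> y \<in> F j ` X
    then complex_of_real (r j) * green (zj z j) (inv (F j) x) (inv (F j) y) else 0)"
  proof -
    have eq: "(if x \<in> F j ` X \<and> y \<in> F j ` X then complex_of_real (r j) * green (zj z j) (inv (F j) x) (inv (F j) y) else 0)
      = (if j = k then \<gamma> y else 0)" if j: "j \<in> L" for j
    proof (cases "j = k")
      case False
      have "green (zj z j) (inv (F j) x) (inv (F j) y) = 0" if xy: "x \<in> F j ` X" "y \<in> F j ` X"
      proof -
        obtain y'' where y'': "y'' \<in> X" "y = F j y''" using xy by blast
        have "y'' \<in> V0" using F_inter(1)[of j k y'' y'] False j k y'' by auto
        moreover have "inv (F j) x \<in> X" using xy j by auto
        ultimately show ?thesis using green_V0[OF admissible_zj[OF z j]] y'' j by simp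
      qed
      then show ?thesis using False by simp
    next
      case True
      then show ?thesis using \<gamma>(2)[OF k(1) k(2)] k by auto
    qed
    have "\<gamma> y = (\<Sum>j\<in>L. if j = k then \<gamma> y else 0)" using k by simp
    also have "\<dots> = (\<Sum>j\<in>L. if x \<in> F j ` X \<and> y \<in> F j ` X
        then complex_of_real (r j) * green (zj z j) (inv (F j) x) (inv (F j) y) else 0)"
      by (intro sum.cong[OF refl] eq[symmetric])
    finally show ?thesis .
  qed
  then show ?thesis
    using solves_unique[OF admissible_no_ev[OF z] green[OF z x] \<gamma>(1) y] by simp
qed

section \<open>The series over words and its remainder\<close>

abbreviation zw :: "complex \<Rightarrow> nat list \<Rightarrow> complex" where
  "zw z w \<equiv> complex_of_real (rword S w * muword S w) * z"

text \<open>The summand at \<open>w\<close> of the series for the Dirichlet kernel (\<open>P = Psi S\<close>), or of the remainder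
  after truncating the series (\<open>P = green\<close>).\<close>

definition cell_sum_term :: "(complex \<Rightarrow> 'a \<Rightarrow> 'a \<Rightarrow> complex) \<Rightarrow> complex \<Rightarrow> 'a \<Rightarrow> 'a \<Rightarrow> nat list \<Rightarrow> complex" where
  "cell_sum_term P z x y w = (if x \<in> cell S w \<and> y \<in> cell S w
     then complex_of_real (rword S w) * P (zw z w) (inv (wmap S w) x) (inv (wmap S w) y) else 0)"

lemma cell_subset_X: "w \<in> words S \<Longrightarrow> cell S w \<subseteq> X"
  by (auto simp: cell_def)

lemma cell_sum_term_Nil [simp]: "x \<in> X \<Longrightarrow> y \<in> X \<Longrightarrow> cell_sum_term P z x y [] = P z x y"
  by (simp add: cell_sum_term_def)

lemma cell_sum_term_Cons:
  assumes j: "j \<in> L" and w: "w \<in> words S"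
  shows "cell_sum_term P z x y (j # w) = (if x \<in> F j ` X \<and> y \<in> F j ` X
    then complex_of_real (r j) * cell_sum_term P (zj z j) (inv (F j) x) (inv (F j) y) w else 0)"
proof -
  have mem: "x \<in> cell S (j # w) \<longleftrightarrow> x \<in> F j ` X \<and> inv (F j) x \<in> cell S w" for x
    using cell_subset_X[OF w] j by (auto simp: cell_Cons)
  have inv: "inv (wmap S (j # w)) x = inv (wmap S w) (inv (F j) x)" if "x \<in> cell S (j # w)" for x
  proof -
    obtain s where "x = F j (wmap S w s)" using \<open>x \<in> cell S (j # w)\<close> by (auto simp: cell_def)
    moreover have "inv (wmap S (j # w)) (wmap S (j # w) s) = s" using j w by (intro inv_wmap) simp
    ultimately show ?thesis using j w by simp
  qed
  have z: "zw z (j # w) = zw (zj z j) w" by (simp add: mult_ac)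
  show ?thesis
  proof (cases "x \<in> cell S (j # w) \<and> y \<in> cell S (j # w)")
    case True
    then show ?thesis
      using mem[of x] mem[of y] unfolding cell_sum_term_def z by (simp add: inv mult.assoc del: wmap_Cons)
  next
    case False
    then show ?thesis using mem[of x] mem[of y] unfolding cell_sum_term_def by auto
  qed
qed

lemma words_len_words: "w \<in> words_len S n \<Longrightarrow> w \<in> words S"
  by (simp add: words_len_def)

lemma sum_cell_sum_term_Suc:
  "(\<Sum>w\<in>words_len S (Suc n). cell_sum_term P z x y w) = (\<Sum>j\<in>L. if x \<in> F j ` X \<and> y \<in> F j ` X
    then complex_of_real (r j) * (\<Sum>w\<in>words_len S n. cell_sum_term P (zj z j) (inv (F j) x) (inv (F j) y) w) else 0)"
  unfolding sum_words_len_Suc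
proof (intro sum.cong[OF refl])
  fix j assume j: "j \<in> L"
  let ?c = "x \<in> F j ` X \<and> y \<in> F j ` X"
  have "(\<Sum>w\<in>words_len S n. cell_sum_term P z x y (j # w)) = (\<Sum>w\<in>words_len S n. if ?c
      then complex_of_real (r j) * cell_sum_term P (zj z j) (inv (F j) x) (inv (F j) y) w else 0)"
    by (intro sum.cong[OF refl] cell_sum_term_Cons j words_len_words)
  also have "\<dots> = (if ?c
    then complex_of_real (r j) * (\<Sum>w\<in>words_len S n. cell_sum_term P (zj z j) (inv (F j) x) (inv (F j) y) w) else 0)"
    by (cases ?c) (simp_all only: simp_thms if_True if_False sum_distrib_left sum.neutral_const)
  finally show "(\<Sum>w\<in>words_len S n. cell_sum_term P z x y (j # w)) = (if ?c
    then complex_of_real (r j) * (\<Sum>w\<in>words_len S n. cell_sum_term P (zj z j) (inv (F j) x) (inv (F j) y) w) else 0)" .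
qed

lemma green_expansion:
  "admissible z \<Longrightarrow> x \<in> X \<Longrightarrow> y \<in> X \<Longrightarrow>
    green z x y = (\<Sum>m<n. \<Sum>w\<in>words_len S m. cell_sum_term (Psi S) z x y w) + (\<Sum>w\<in>words_len S n. cell_sum_term green z x y w)"
proof (induction n arbitrary: z x y)
  case 0
  then show ?case by simp
next
  case (Suc n)
  let ?x = "\<lambda>j. inv (F j) x" and ?y = "\<lambda>j. inv (F j) y"
  let ?c = "\<lambda>j. x \<in> F j ` X \<and> y \<in> F j ` X"
  have "green z x y = Psi S z x y + (\<Sum>j\<in>L. if ?c j then complex_of_real (r j) * green (zj z j) (?x j) (?y j) else 0)"
    by (rule green_decomposition) (use Suc in auto)
  \<comment> \<open>The case distinction is moved inside the sum over \<open>m\<close> so that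
    \<open>sum_cell_sum_term_Suc\<close> can reassemble the words by their first letter.\<close>
  also have "(\<Sum>j\<in>L. if ?c j then complex_of_real (r j) * green (zj z j) (?x j) (?y j) else 0)
    = (\<Sum>j\<in>L. (\<Sum>m<n. if ?c j then complex_of_real (r j) * (\<Sum>w\<in>words_len S m. cell_sum_term (Psi S) (zj z j) (?x j) (?y j) w) else 0)
       + (if ?c j then complex_of_real (r j) * (\<Sum>w\<in>words_len S n. cell_sum_term green (zj z j) (?x j) (?y j) w) else 0))"
  proof (intro sum.cong[OF refl])
    fix j assume j: "j \<in> L"
    show "(if ?c j then complex_of_real (r j) * green (zj z j) (?x j) (?y j) else 0) =
      (\<Sum>m<n. if ?c j then complex_of_real (r j) * (\<Sum>w\<in>words_len S m. cell_sum_term (Psi S) (zj z j) (?x j) (?y j) w) else 0)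
       + (if ?c j then complex_of_real (r j) * (\<Sum>w\<in>words_len S n. cell_sum_term green (zj z j) (?x j) (?y j) w) else 0)"
    proof (cases "?c j")
      case True
      then have "?x j \<in> X" "?y j \<in> X" using j by auto
      then have "green (zj z j) (?x j) (?y j) = (\<Sum>m<n. \<Sum>w\<in>words_len S m. cell_sum_term (Psi S) (zj z j) (?x j) (?y j) w)
          + (\<Sum>w\<in>words_len S n. cell_sum_term green (zj z j) (?x j) (?y j) w)"
        by (intro Suc.IH admissible_zj Suc.prems j)
      then show ?thesis using True by (simp add: distrib_left sum_distrib_left)
    next
      case False
      then show ?thesis by (simp only: if_False sum.neutral_const add_0_left)
    qed
  qed
  also have "\<dots> = (\<Sum>m<n. \<Sum>w\<in>words_len S (Suc m). cell_sum_term (Psi S) z x y w) + (\<Sum>w\<in>words_len S (Suc n). cell_sum_term green z x y w)"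
    unfolding sum_cell_sum_term_Suc sum.distrib by (subst sum.swap) simp
  finally show ?case
    using Suc.prems by (simp add: sum.lessThan_Suc_shift add.assoc del: sum.lessThan_Suc)
qed

text \<open>If \<open>x\<close> lies in two n-cells, post-critical finiteness makes it the image of
  a boundary point in each, where \<open>P\<close> vanishes in its first argument.\<close>

lemma cell_sum_term_unique:
  assumes P: "\<And>w x y. w \<in> words S \<Longrightarrow> x \<in> V0 \<Longrightarrow> y \<in> X \<Longrightarrow> P (zw z w) x y = 0"
    and w: "w \<in> words_len S n" "w' \<in> words_len S n" "w \<noteq> w'"
    and nz: "cell_sum_term P z x y w \<noteq> 0"
  shows "cell_sum_term P z x y w' = 0"
proof (rule ccontr)
  assume "cell_sum_term P z x y w' \<noteq> 0"
  then have "x \<in> cell S w'" by (auto simp: cell_sum_term_def split: if_splits)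
  moreover have xy: "x \<in> cell S w" "y \<in> cell S w" using nz by (auto simp: cell_sum_term_def split: if_splits)
  ultimately have "x \<in> wmap S w ` V0"
    using post_critically_finite w unfolding post_critically_finite_def by blast
  moreover have "inv (wmap S w) y \<in> X"
    using xy words_len_words[OF w(1)] by (auto simp: cell_def)
  ultimately show False
    using nz xy words_len_words[OF w(1)] P by (auto simp: cell_sum_term_def)
qed

lemma words_len_nonempty: "words_len S n \<noteq> {}"
  using cells_cover X_nonempty by blast

lemma rword_bounds: "w \<in> words S \<Longrightarrow> 0 < rword S w \<and> rword S w \<le> \<rho> ^ length w"
proof (induction w)
  case (Cons j w)
  then show ?case using r_pos[of j] \<rho>(3)[of j] \<rho>(1) by (auto intro!: mult_mono)
qed simp

lemma muword_bounds: "w \<in> words S \<Longrightarrow> 0 < muword S w \<and> muword S w \<le> 1"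
proof (induction w)
  case (Cons j w)
  then show ?case using weight_pos[of j] weight_less_1[of j] by (auto intro!: mult_le_one)
qed simp

lemma admissible_zw: "admissible z \<Longrightarrow> w \<in> words S \<Longrightarrow> admissible (zw z w)"
proof (induction w arbitrary: z)
  case (Cons j w)
  then have "admissible (zw (zj z j) w)" using admissible_zj by simp
  then show ?case by (simp add: mult_ac)
qed simp

lemma green_V0_left: "admissible z \<Longrightarrow> x \<in> V0 \<Longrightarrow> y \<in> X \<Longrightarrow> green z x y = 0"
  using green_sym[of z x y] green_V0[of z y x] by simp

text \<open>Only one word contributes; its parameter is below the threshold of
  \<open>green_bound_small\<close>, and \<open>rword S w\<close> supplies the decay.\<close>

lemma remainder_bound:
  assumes z: "admissible z" and n: "\<rho> ^ n * cmod z * K\<^sup>2 \<le> 1/2"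
  shows "cmod (\<Sum>w\<in>words_len S n. cell_sum_term green z x y w) \<le> 2 * K\<^sup>2 * \<rho> ^ n"
proof -
  have "\<exists>w\<in>words_len S n. (\<Sum>w\<in>words_len S n. cell_sum_term green z x y w) = cell_sum_term green z x y w \<and>
      (\<forall>w'\<in>words_len S n. w' \<noteq> w \<longrightarrow> cell_sum_term green z x y w' = 0)"
  proof (rule sum_single_term[OF finite_words_len words_len_nonempty])
    show "cell_sum_term green z x y w' = 0"
      if "w \<in> words_len S n" "w' \<in> words_len S n" "w \<noteq> w'" "cell_sum_term green z x y w \<noteq> 0" for w w'
      by (rule cell_sum_term_unique[OF _ that]) (intro green_V0_left admissible_zw z)
  qed
  then obtain w where w: "w \<in> words_len S n"
    "(\<Sum>w\<in>words_len S n. cell_sum_term green z x y w) = cell_sum_term green z x y w" by blast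
  have W: "w \<in> words S" and len: "length w = n" using w(1) by (auto simp: words_len_def)
  have "cmod (cell_sum_term green z x y w) \<le> 2 * K\<^sup>2 * \<rho> ^ n"
  proof (cases "x \<in> cell S w \<and> y \<in> cell S w")
    case True
    then have xy: "inv (wmap S w) x \<in> X" "inv (wmap S w) y \<in> X" using W by (auto simp: cell_def)
    have "rword S w * muword S w \<le> \<rho> ^ n * 1"
      using rword_bounds[OF W] muword_bounds[OF W] len \<rho> by (intro mult_mono) auto
    then have "cmod (zw z w) \<le> \<rho> ^ n * cmod z"
      using rword_bounds[OF W] muword_bounds[OF W] by (simp add: norm_mult abs_mult mult_right_mono)
    then have "cmod (zw z w) * K\<^sup>2 \<le> 1/2"
      using n by (meson mult_right_mono order.trans zero_le_power2)
    then have "cmod (green (zw z w) (inv (wmap S w) x) (inv (wmap S w) y)) \<le> 2 * K\<^sup>2"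
      using green_bound_small[OF _ green[OF admissible_zw[OF z W] xy(1)] xy] by blast
    then have "rword S w * cmod (green (zw z w) (inv (wmap S w) x) (inv (wmap S w) y)) \<le> \<rho> ^ n * (2 * K\<^sup>2)"
      using rword_bounds[OF W] len \<rho> by (intro mult_mono) auto
    then show ?thesis
      using True rword_bounds[OF W] by (simp add: cell_sum_term_def norm_mult mult_ac)
  next
    case False
    then have "cell_sum_term green z x y w = 0" unfolding cell_sum_term_def by (rule if_not_P)
    then show ?thesis using \<rho> by simp
  qed
  then show ?thesis using w(2) by simp
qed

text \<open>The kernel is an unordered sum, so convergence of the partial sums by length is not
  enough. One word \<open>\<omega> n\<close> per length carries the whole sum; the terms along it
  are absolutely summable, and \<open>\<omega>\<close> is injective since the lengths
  differ.\<close>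

lemma dirichlet_resolvent_kernel_eq_green:
  assumes z: "admissible z" and x: "x \<in> X" and y: "y \<in> X"
  shows "dirichlet_resolvent_kernel S z x y = green z x y"
proof -
  define f where "f = cell_sum_term (Psi S) z x y"
  define R where "R n = (\<Sum>w\<in>words_len S n. cell_sum_term green z x y w)" for n
  have "\<exists>w\<in>words_len S n. sum f (words_len S n) = f w \<and> (\<forall>w'\<in>words_len S n. w' \<noteq> w \<longrightarrow> f w' = 0)" for n
  proof (rule sum_single_term[OF finite_words_len words_len_nonempty])
    show "f w' = 0" if "w \<in> words_len S n" "w' \<in> words_len S n" "w \<noteq> w'" "f w \<noteq> 0" for w w'
    proof -
      have nz: "cell_sum_term (Psi S) z x y w \<noteq> 0" using that(4) by (simp add: f_def)
      show ?thesis
        unfolding f_def by (rule cell_sum_term_unique[OF _ that(1-3) nz]) (intro Psi_V0 admissible_zw z)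
    qed
  qed
  then obtain \<omega> where \<omega>: "\<And>n. \<omega> n \<in> words_len S n" "\<And>n. sum f (words_len S n) = f (\<omega> n)"
    "\<And>n w. w \<in> words_len S n \<Longrightarrow> w \<noteq> \<omega> n \<Longrightarrow> f w = 0" by metis
  have exp: "green z x y = (\<Sum>m<n. f (\<omega> m)) + R n" for n
    using green_expansion[OF z x y, of n] by (simp add: f_def[symmetric] \<omega>(2) R_def)
  have "(\<lambda>n. \<rho> ^ n * cmod z * K\<^sup>2) \<longlonglongrightarrow> 0 * cmod z * K\<^sup>2"
    using \<rho> by (intro tendsto_intros LIMSEQ_power_zero) auto
  then have "\<forall>\<^sub>F n in sequentially. \<rho> ^ n * cmod z * K\<^sup>2 < 1/2"
    by (intro order_tendstoD(2)) auto
  then obtain N where N: "\<And>n. n \<ge> N \<Longrightarrow> \<rho> ^ n * cmod z * K\<^sup>2 < 1/2" by (auto simp: eventually_sequentially)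
  have R_le: "cmod (R n) \<le> 2 * K\<^sup>2 * \<rho> ^ n" if "n \<ge> N" for n
    unfolding R_def using N[OF that] by (intro remainder_bound z) simp
  have "(\<lambda>n. 2 * K\<^sup>2 * \<rho> ^ n) \<longlonglongrightarrow> 2 * K\<^sup>2 * 0"
    using \<rho> by (intro tendsto_intros LIMSEQ_power_zero) auto
  then have lim0: "(\<lambda>n. 2 * K\<^sup>2 * \<rho> ^ n) \<longlonglongrightarrow> 0" by simp
  have "\<forall>\<^sub>F n in sequentially. cmod (R n) \<le> 2 * K\<^sup>2 * \<rho> ^ n"
    unfolding eventually_sequentially using R_le by blast
  then have "R \<longlonglongrightarrow> 0" using lim0 by (rule Lim_null_comparison)
  then have "(\<lambda>n. green z x y - R n) \<longlonglongrightarrow> green z x y - 0" by (intro tendsto_intros)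
  moreover have "green z x y - R n = (\<Sum>m<n. f (\<omega> m))" for n using exp[of n] by simp
  ultimately have sums: "(\<lambda>m. f (\<omega> m)) sums green z x y" by (simp add: sums_def)
  \<comment> \<open>\<open>Psi\<close> is never estimated directly: the surviving term is the
    difference of consecutive remainders, and each of these is small.\<close>
  have f\<omega>_le: "norm (norm (f (\<omega> n))) \<le> 4 * K\<^sup>2 * \<rho> ^ n" if "n \<ge> N" for n
  proof -
    have "f (\<omega> n) = R n - R (Suc n)" using exp[of n] exp[of "Suc n"] by (simp add: eq_diff_eq)
    then have "norm (f (\<omega> n)) \<le> cmod (R n) + cmod (R (Suc n))" by (simp add: norm_triangle_ineq4)
    also have "\<dots> \<le> 2 * K\<^sup>2 * \<rho> ^ n + 2 * K\<^sup>2 * \<rho> ^ Suc n" using that by (intro add_mono R_le) auto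
    also have "\<dots> \<le> 2 * K\<^sup>2 * \<rho> ^ n + 2 * K\<^sup>2 * \<rho> ^ n"
      using \<rho> by (intro add_left_mono mult_left_mono) (auto simp: mult_left_le_one_le)
    finally show ?thesis by (simp add: mult_ac)
  qed
  have "summable (\<lambda>n. 4 * K\<^sup>2 * \<rho> ^ n)" using \<rho> by (intro summable_mult summable_geometric) auto
  then have "summable (\<lambda>n. norm (f (\<omega> n)))"
    using f\<omega>_le by (rule summable_comparison_test'[where N = N])
  then have "((\<lambda>n. f (\<omega> n)) has_sum green z x y) UNIV" using sums by (rule norm_summable_imp_has_sum)
  moreover have "inj \<omega>" using \<omega>(1) unfolding words_len_def by (intro injI) (metis (mono_tags, lifting) mem_Collect_eq)
  ultimately have "(f has_sum green z x y) (range \<omega>)" by (simp add: has_sum_reindex comp_def)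
  moreover have "(f has_sum green z x y) (range \<omega>) \<longleftrightarrow> (f has_sum green z x y) (words S)"
  proof (rule has_sum_cong_neutral)
    show "f w = 0" if "w \<in> words S - range \<omega>" for w
      using \<omega>(3)[of w "length w"] that by (auto simp: words_len_def)
    show "f w = 0" if "w \<in> range \<omega> - words S" for w
      using that \<omega>(1) words_len_words by blast
  qed auto
  ultimately have "infsum f (words S) = green z x y" by (simp add: infsumI)
  then show ?thesis by (simp add: dirichlet_resolvent_kernel_def f_def cell_sum_term_def[abs_def])
qed

section \<open>The measure-valued Laplacian\<close>

text \<open>The measure \<open>M\<close> plus a point mass at \<open>x\<close>, as the image of two copies of \<open>M\<close> one of which is
  mapped to \<open>x\<close>.\<close>

definition with_point_mass :: "'a \<Rightarrow> 'a measure" where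
  "with_point_mass x = distr (count_space (UNIV :: bool set) \<Otimes>\<^sub>M M) M (\<lambda>(b, y). if b then y else x)"

lemma with_point_mass:
  assumes x: "x \<in> X"
  shows "sets (with_point_mass x) = sets M"
    and "finite_measure (with_point_mass x)"
    and "integrable M g \<Longrightarrow> integrable (with_point_mass x) (g :: 'a \<Rightarrow> complex)"
    and "integrable M g \<Longrightarrow> (\<integral>y. g y \<partial>with_point_mass x) = (\<integral>y. g y \<partial>M) + g x"
proof -
  let ?P = "count_space (UNIV :: bool set)" and ?f = "\<lambda>(b, y). if b then y else x"
  show "sets (with_point_mass x) = sets M" by (simp add: with_point_mass_def)
  have f: "?f \<in> measurable (?P \<Otimes>\<^sub>M M) M"
    by (rule measurable_pair_measure_countable1) (use x in auto)
  interpret P: finite_measure ?P by (rule finite_measure_count_space) simp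
  interpret PM: pair_sigma_finite ?P M ..
  show "finite_measure (with_point_mass x)"
  proof (rule finite_measureI)
    have "?f -` X \<inter> space (?P \<Otimes>\<^sub>M M) = UNIV \<times> X"
      using x by (auto simp: space_pair_measure)
    then have "emeasure (with_point_mass x) X = emeasure (?P \<Otimes>\<^sub>M M) (UNIV \<times> X)"
      using f sets.top[of M] by (simp add: with_point_mass_def emeasure_distr)
    also have "\<dots> = emeasure ?P UNIV * emeasure M X"
      using sets.top[of M] by (intro emeasure_pair_measure_Times) auto
    finally show "emeasure (with_point_mass x) (space (with_point_mass x)) \<noteq> \<infinity>"
      by (simp add: with_point_mass_def emeasure_eq_measure)
  qed
  assume g: "integrable M g"
  show "integrable (with_point_mass x) g" "(\<integral>y. g y \<partial>with_point_mass x) = (\<integral>y. g y \<partial>M) + g x"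
  proof -
    have gm: "g \<in> borel_measurable M" using g by (rule borel_measurable_integrable)
    have int: "integrable M (\<lambda>y. g (if b then y else x))" for b
      using g by (cases b) auto
    have int': "integrable (?P \<Otimes>\<^sub>M M) (\<lambda>p. g (?f p))"
    proof (rule PM.Fubini_integrable)
      show "(\<lambda>p. g (?f p)) \<in> borel_measurable (?P \<Otimes>\<^sub>M M)"
        using measurable_comp[OF f gm] by (simp add: comp_def)
      show "AE b in ?P. integrable M (\<lambda>y. g (?f (b, y)))" using int by (intro AE_I2) simp
    qed (simp add: integrable_count_space)
    show "integrable (with_point_mass x) g"
      unfolding with_point_mass_def using int' by (subst integrable_distr_eq[OF f gm])
    have "(\<integral>y. g y \<partial>with_point_mass x) = (\<integral>p. g (?f p) \<partial>(?P \<Otimes>\<^sub>M M))"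
      unfolding with_point_mass_def by (rule integral_distr[OF f gm])
    also have "\<dots> = (\<integral>b. (\<integral>y. g (?f (b, y)) \<partial>M) \<partial>?P)"
      using PM.integral_fst'[OF int'] by simp
    also have "\<dots> = (\<integral>y. g y \<partial>M) + g x"
      by (simp add: lebesgue_integral_count_space_finite UNIV_bool)
    finally show "(\<integral>y. g y \<partial>with_point_mass x) = (\<integral>y. g y \<partial>M) + g x" .
  qed
qed

text \<open>The measure \<open>z w M\<close> minus the Dirac mass at \<open>x\<close> needs one
  density with respect to \<open>M\<close> plus that mass: \<open>h\<close> is -1 at
  \<open>x\<close> and \<open>z * w\<close> elsewhere. The single point is null for
  \<open>M\<close>, so the \<open>M\<close>-part is unaffected.\<close>

lemma has_measure_laplacian_point_mass:
  assumes w: "w \<in> cD" and x: "x \<in> X"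
    and weak: "\<And>v. v \<in> cD0 \<Longrightarrow> Ez z w v = v x"
  shows "has_measure_laplacian S w (\<lambda>A. z * (LINT y:A|M. w y) - indicator A x)"
proof -
  define \<nu> :: "'a set \<Rightarrow> complex" where "\<nu> A = z * (LINT y:A|M. w y) - indicator A x" for A
  define h where "h y = (if y = x then - 1 else z * w y)" for y
  let ?N = "with_point_mass x"
  have h_meas: "h \<in> borel_measurable M"
    unfolding h_def
  proof (rule measurable_If)
    have "{y \<in> space M. y = x} = {x}" using x by auto
    then show "{y \<in> space M. y = x} \<in> sets M" using x by (simp add: sets_M_iff)
  qed (use integrable_cD[OF w] in \<open>auto intro!: borel_measurable_times\<close>)
  have AE: "AE y in M. h y = z * w y" using AE_neq[of x] by eventually_elim (simp add: h_def)
  have zw: "integrable M (\<lambda>y. z * w y)" using integrable_cD[OF w] by simp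
  have int_h: "integrable M h"
    using zw by (rule integrable_cong_AE_imp[OF _ h_meas]) (use AE in \<open>auto elim: eventually_mono\<close>)
  have \<nu>: "\<nu> A = (LINT y:A|?N. h y)" if A: "A \<in> sets M" for A
  proof -
    have "integrable M (\<lambda>y. indicator A y *\<^sub>R h y)" using A int_h by (rule integrable_mult_indicator)
    then have "(LINT y:A|?N. h y) = (\<integral>y. indicator A y *\<^sub>R h y \<partial>M) + indicator A x *\<^sub>R h x"
      unfolding set_lebesgue_integral_def by (rule with_point_mass(4)[OF x])
    also have "(\<integral>y. indicator A y *\<^sub>R h y \<partial>M) = (\<integral>y. z * (indicator A y *\<^sub>R w y) \<partial>M)"
      using AE A h_meas zw integrable_cD[OF w]
      by (intro integral_cong_AE) (auto elim: eventually_mono)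
    also have "\<dots> = z * (LINT y:A|M. w y)"
      unfolding set_lebesgue_integral_def by (rule integral_mult_right_zero)
    finally show ?thesis by (simp add: \<nu>_def h_def indicator_def)
  qed
  have "has_complex_measure_integral X \<nu> v (- cE w v)" if v: "v \<in> cD0" for v
  proof -
    have int: "integrable M (\<lambda>y. v y * h y)"
      using integrable_mult_continuous[OF int_h cD_continuous[OF cD0_cD[OF v]]] by (simp add: mult.commute)
    have "(\<integral>y. v y * h y \<partial>?N) = (\<integral>y. v y * h y \<partial>M) + v x * h x"
      by (rule with_point_mass(4)[OF x int])
    also have "(\<integral>y. v y * h y \<partial>M) = (\<integral>y. z * (w y * v y) \<partial>M)"
      using AE int integrable_cD_mult[OF w cD0_cD[OF v]] by (intro integral_cong_AE) (auto elim: eventually_mono)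
    also have "\<dots> + v x * h x = - cE w v"
      using weak[OF v] by (simp add: h_def Ez_def algebra_simps)
    finally have "(\<integral>y. v y * h y \<partial>?N) = - cE w v" .
    then show ?thesis
      unfolding has_complex_measure_integral_def
      using with_point_mass[OF x] int int_h \<nu> sets_M
      by (intro exI[of _ ?N] exI[of _ h]) auto
  qed
  moreover have "complex_measure_on X \<nu>"
    using with_point_mass[OF x] int_h \<nu> sets_M by (intro complex_measure_on_density[of ?N X h]) auto
  ultimately show ?thesis using w by (simp add: has_measure_laplacian_def \<nu>_def[abs_def])
qed

section \<open>The Neumann resolvent kernel\<close>

context
  fixes z :: complex and \<eta> C :: "'a \<Rightarrow> 'a \<Rightarrow> complex"
  assumes adm: "admissible z"
    and eta: "\<And>p. p \<in> V0 \<Longrightarrow> is_eta S z p (\<eta> p)"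
    and C_sym: "\<And>p q. p \<in> V0 \<Longrightarrow> q \<in> V0 \<Longrightarrow> C p q = C q p"
    and C_inv: "\<And>p x. p \<in> V0 \<Longrightarrow> x \<in> V0 \<Longrightarrow> (\<Sum>q\<in>V0. C p q * normal_derivative S (\<eta> q) x) = of_bool (p = x)"
begin

lemma eta_sol: "p \<in> V0 \<Longrightarrow> sol z (\<eta> p)"
  and eta_V0: "p \<in> V0 \<Longrightarrow> q \<in> V0 \<Longrightarrow> \<eta> p q = of_bool (q = p)"
  using eta unfolding is_eta_iff by auto

lemma eta_cD [simp]: "p \<in> V0 \<Longrightarrow> \<eta> p \<in> cD"
  using eta_sol by (simp add: sol_def)

text \<open>With \<open>k = \<eta> x\<close> the Gauss-Green formula turns normal derivatives into
  values of the form, so \<open>C\<close> inverts the Gram matrix of the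
  \<open>\<eta> q\<close>.\<close>

lemma C_inv_Ez: "p \<in> V0 \<Longrightarrow> x \<in> V0 \<Longrightarrow> (\<Sum>q\<in>V0. C p q * Ez z (\<eta> q) (\<eta> x)) = of_bool (p = x)"
  using C_inv[of p x] sol_normal_derivative(2)[OF eta_sol, of _ x "\<eta> x"] by (simp add: eta_V0 cong: sum.cong)

text \<open>With \<open>e p = \<eta> p x\<close> this is the term added to the Dirichlet kernel;
  with the integrals of \<open>f * \<eta> p\<close> it corrects a Dirichlet solution to a Neumann
  one.\<close>

definition correction :: "('a \<Rightarrow> complex) \<Rightarrow> 'a \<Rightarrow> complex" where
  "correction e y = (\<Sum>p\<in>V0. \<Sum>q\<in>V0. C p q * e p * \<eta> q y)"

lemma correction_cD [simp]: "correction e \<in> cD"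
  unfolding correction_def[abs_def] by (intro cD_sum cD_scale eta_cD)

lemma Ez_correction: "v \<in> cD \<Longrightarrow> Ez z (correction e) v = (\<Sum>p\<in>V0. \<Sum>q\<in>V0. C p q * e p * Ez z (\<eta> q) v)"
  unfolding correction_def[abs_def] by (simp add: Ez_sum Ez_scale cD_sum cD_scale)

lemma correction_sol: "sol z (correction e)"
  using eta_sol by (auto simp: sol_def Ez_correction intro!: sum.neutral)

text \<open>In view of the Gauss-Green formula, \<open>correction e\<close> has normal derivative
  \<open>e s\<close> at \<open>s\<close>; the matrix \<open>C\<close> is made for this.\<close>

lemma Ez_correction_eta: "s \<in> V0 \<Longrightarrow> Ez z (correction e) (\<eta> s) = e s"
proof -
  assume s: "s \<in> V0"
  have "Ez z (correction e) (\<eta> s) = (\<Sum>p\<in>V0. e p * (\<Sum>q\<in>V0. C p q * Ez z (\<eta> q) (\<eta> s)))"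
    using s by (simp add: Ez_correction sum_distrib_left mult_ac)
  also have "\<dots> = (\<Sum>p\<in>V0. if p = s then e p else 0)"
    using s by (intro sum.cong) (auto simp: C_inv_Ez)
  finally show ?thesis using s by simp
qed

lemma correction_sym: "correction (\<lambda>p. \<eta> p x) y = correction (\<lambda>p. \<eta> p y) x"
  unfolding correction_def using C_sym by (subst sum.swap) (auto intro!: sum.cong simp: mult_ac)

definition neumann :: "'a \<Rightarrow> 'a \<Rightarrow> complex" where
  "neumann x y = green z x y + correction (\<lambda>p. \<eta> p x) y"

lemma neumann_sym: "x \<in> X \<Longrightarrow> y \<in> X \<Longrightarrow> neumann x y = neumann y x"
  unfolding neumann_def using green_sym[OF adm] correction_sym by simp

lemma neumann_cD: "x \<in> X \<Longrightarrow> neumann x \<in> cD"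
  unfolding neumann_def[abs_def] using green_cD0[OF adm] by (intro cD_add) auto

lemma Ez_neumann: "x \<in> X \<Longrightarrow> v \<in> cD0 \<Longrightarrow> Ez z (neumann x) v = v x"
  unfolding neumann_def[abs_def] using green_cD0[OF adm, of x] correction_sol
  by (simp add: Ez_add Ez_green[OF adm] sol_def)

lemma Ez_cD0_eta: "u \<in> cD0 \<Longrightarrow> s \<in> V0 \<Longrightarrow> Ez z u (\<eta> s) = 0"
  using eta_sol[of s] Ez_sym[of u "\<eta> s" z] by (simp add: sol_def)

text \<open>Tested with \<open>\<eta> s\<close>, the Green function contributes 0 and the correction
  \<open>\<eta> s x\<close>, which cancels the contribution of the point source. The source must lie
  off \<open>V0\<close>: one at \<open>s\<close> would stay under every bump.\<close>

lemma neumann_normal_derivative: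
  assumes x: "x \<in> X - V0" and s: "s \<in> V0"
  shows "has_normal_derivative S (neumann x) s 0"
proof -
  have xX: "x \<in> X" using x by simp
  have "has_normal_derivative S (neumann x) s
      (cE (neumann x) (\<eta> s) + (\<integral>y. z * neumann x y * \<eta> s y \<partial>M) - 1 * \<eta> s x)"
  proof (rule has_normal_derivative_weak[OF neumann_cD[OF xX] _ s])
    show "integrable M (\<lambda>y. z * neumann x y)" using integrable_cD[OF neumann_cD[OF xX]] by simp
    show "cE (neumann x) v = - (\<integral>y. z * neumann x y * v y \<partial>M) + 1 * v x" if "v \<in> cD0" for v
      using Ez_neumann[OF xX that] by (simp add: Ez_def mult.assoc algebra_simps)
  qed (use x s eta_V0 in auto)
  moreover have "Ez z (neumann x) (\<eta> s) = \<eta> s x"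
    unfolding neumann_def[abs_def] using green_cD0[OF adm xX] s
    by (simp add: Ez_add Ez_cD0_eta Ez_correction_eta)
  ultimately show ?thesis by (simp add: Ez_def mult.assoc)
qed

text \<open>The last clause is the weak Neumann condition: the equation holds also when tested with
  \<open>\<eta> s\<close>, which does not vanish on \<open>V0\<close>.\<close>

lemma neumann_solution:
  assumes f: "integrable M f"
  shows "\<exists>u. u \<in> cD \<and> (\<forall>x\<in>X. u x = (\<integral>y. neumann x y * f y \<partial>M)) \<and>
    (\<forall>v\<in>cD0. Ez z u v = (\<integral>y. f y * v y \<partial>M)) \<and> (\<forall>s\<in>V0. Ez z u (\<eta> s) = (\<integral>y. f y * \<eta> s y \<partial>M))"
proof -
  have "\<exists>U. solves z (\<lambda>v. \<integral>y. f y * v y \<partial>M) U"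
    using admissible_imp_regular[OF adm] f by (simp add: regular_def)
  then obtain U where U: "U \<in> cD0" "\<And>v. v \<in> cD0 \<Longrightarrow> Ez z U v = (\<integral>y. f y * v y \<partial>M)"
    unfolding solves_def by blast
  define e where "e p = (\<integral>y. f y * \<eta> p y \<partial>M)" for p
  define u where "u x = U x + correction e x" for x
  have int: "integrable M (\<lambda>y. g y * f y)" if "g \<in> cD" for g
    using integrable_mult_continuous[OF f cD_continuous[OF that]] by (simp add: mult.commute)
  have "u x = (\<integral>y. neumann x y * f y \<partial>M)" if x: "x \<in> X" for x
  proof -
    have "(\<integral>y. neumann x y * f y \<partial>M) = (\<integral>y. green z x y * f y + correction (\<lambda>p. \<eta> p x) y * f y \<partial>M)"
      by (simp add: neumann_def distrib_right)
    also have "\<dots> = (\<integral>y. green z x y * f y \<partial>M) + (\<integral>y. correction (\<lambda>p. \<eta> p x) y * f y \<partial>M)"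
      by (rule Bochner_Integration.integral_add) (use green_cD0[OF adm x] in \<open>auto intro!: int\<close>)
    \<comment> \<open>The equation of \<open>U\<close> tested with the Green function, and that of
      the Green function tested with \<open>U\<close>.\<close>
    also have "(\<integral>y. green z x y * f y \<partial>M) = U x"
      using U green_cD0[OF adm x] Ez_green[OF adm x U(1)] Ez_sym[of U "green z x" z] by (simp add: mult.commute)
    also have "(\<integral>y. correction (\<lambda>p. \<eta> p x) y * f y \<partial>M) = (\<integral>y. (\<Sum>p\<in>V0. \<Sum>q\<in>V0. C p q * \<eta> p x * (\<eta> q y * f y)) \<partial>M)"
      by (simp add: correction_def sum_distrib_right mult.assoc)
    also have "\<dots> = (\<Sum>p\<in>V0. \<Sum>q\<in>V0. C p q * \<eta> p x * e q)"
      using int[OF eta_cD] by (simp add: e_def mult.commute[of "f _"])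
    also have "\<dots> = correction e x"
      unfolding correction_def using C_sym by (subst sum.swap) (auto intro!: sum.cong simp: mult_ac)
    finally show ?thesis by (simp add: u_def)
  qed
  moreover have "u \<in> cD" unfolding u_def[abs_def] using U by (intro cD_add) auto
  moreover have "Ez z u v = (\<integral>y. f y * v y \<partial>M)" if "v \<in> cD0" for v
    unfolding u_def[abs_def] using U that correction_sol by (simp add: Ez_add sol_def)
  moreover have "Ez z u (\<eta> s) = (\<integral>y. f y * \<eta> s y \<partial>M)" if "s \<in> V0" for s
    unfolding u_def[abs_def] using U that by (simp add: Ez_add Ez_cD0_eta Ez_correction_eta e_def)
  ultimately show ?thesis by blast
qed

lemma neumann_resolvent_kernel_cong:
  assumes GN: "\<And>x y. x \<in> X \<Longrightarrow> y \<in> X \<Longrightarrow> GN x y = neumann x y"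
  shows "neumann_resolvent_kernel S z GN"
  unfolding neumann_resolvent_kernel_def
proof (intro allI impI, elim conjE)
  fix f u
  assume f2: "square_integrable M f" and u: "\<forall>x\<in>X. u x = (\<integral>y. GN x y * f y \<partial>M)"
  \<comment> \<open>Square integrability suffices, since \<open>M\<close> is a probability
    measure.\<close>
  have f: "integrable M f"
  proof (rule integrable_norm_iff[THEN iffD1])
    show fm: "f \<in> borel_measurable M" using f2 by (simp add: square_integrable_def)
    show "integrable M (\<lambda>x. cmod (f x))"
      by (rule square_integrable_imp_integrable) (use f2 fm in \<open>auto simp: square_integrable_def\<close>)
  qed
  obtain u' where u': "u' \<in> cD" "\<And>x. x \<in> X \<Longrightarrow> u' x = (\<integral>y. neumann x y * f y \<partial>M)"
    "\<And>v. v \<in> cD0 \<Longrightarrow> Ez z u' v = (\<integral>y. f y * v y \<partial>M)" "\<And>s. s \<in> V0 \<Longrightarrow> Ez z u' (\<eta> s) = (\<integral>y. f y * \<eta> s y \<partial>M)"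
    using neumann_solution[OF f] by blast
  have eq: "u' x = u x" if "x \<in> X" for x
    using u u'(2)[OF that] GN that by (auto intro!: Bochner_Integration.integral_cong)
  have uD: "u \<in> cD" by (rule cD_cong[OF eq u'(1)])
  have Ezu: "Ez z u v = Ez z u' v" for v by (rule Ez_cong) (use eq in auto)
  have zuf: "integrable M (\<lambda>x. z * u x - f x)" using integrable_cD[OF uD] f by auto
  \<comment> \<open>Stated on all of \<open>cD\<close>: it is applied to test functions for the
    equation and to \<open>\<eta> s\<close> for the normal derivative.\<close>
  have cE: "cE u v = Ez z u v - (\<integral>x. f x * v x \<partial>M) - (\<integral>x. (z * u x - f x) * v x \<partial>M)" if v: "v \<in> cD" for v
  proof -
    have "(\<integral>x. (z * u x - f x) * v x \<partial>M) = (\<integral>x. z * (u x * v x) - f x * v x \<partial>M)"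
      by (simp add: left_diff_distrib mult.assoc)
    also have "\<dots> = z * (\<integral>x. u x * v x \<partial>M) - (\<integral>x. f x * v x \<partial>M)"
      using integrable_cD_mult[OF uD v] integrable_mult_continuous[OF f cD_continuous[OF v]]
      by (subst Bochner_Integration.integral_diff) auto
    finally show ?thesis by (simp add: Ez_def)
  qed
  have weak: "cE u v = - (\<integral>x. (z * u x - f x) * v x \<partial>M)" if "v \<in> cD0" for v
    using cE[OF cD0_cD[OF that]] u'(3)[OF that] by (simp add: Ezu)
  then have wl: "weak_laplacian S u (\<lambda>x. z * u x - f x)" using uD by (simp add: weak_laplacian_def)
  have "square_integrable M (\<lambda>x. z * u x - f x)"
  proof -
    obtain B where B: "\<And>x. x \<in> X \<Longrightarrow> cmod (u x) \<le> B" using continuous_on_bounded[OF cD_continuous[OF uD]] by blast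
    have "integrable M (\<lambda>x. (cmod (z * u x - f x))\<^sup>2)"
    proof (rule Bochner_Integration.integrable_bound)
      show "integrable M (\<lambda>x. 2 * (cmod z * B)\<^sup>2 + 2 * (cmod (f x))\<^sup>2)"
        using f2 by (auto simp: square_integrable_def)
      show "(\<lambda>x. (cmod (z * u x - f x))\<^sup>2) \<in> borel_measurable M"
        using borel_measurable_integrable[OF zuf] by measurable
      show "AE x in M. norm ((cmod (z * u x - f x))\<^sup>2) \<le> norm (2 * (cmod z * B)\<^sup>2 + 2 * (cmod (f x))\<^sup>2)"
      proof (rule AE_I2)
        fix x assume "x \<in> space M"
        then have "cmod z * cmod (u x) \<le> cmod z * B" using B by (intro mult_left_mono) auto
        then have "cmod (z * u x - f x) \<le> cmod z * B + cmod (f x)"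
          using norm_triangle_ineq4[of "z * u x" "f x"] by (simp add: norm_mult)
        then have "(cmod (z * u x - f x))\<^sup>2 \<le> (cmod z * B + cmod (f x))\<^sup>2" by (rule power_mono) simp
        also have "\<dots> \<le> 2 * (cmod z * B)\<^sup>2 + 2 * (cmod (f x))\<^sup>2"
          using zero_le_power2[of "cmod z * B - cmod (f x)"] by (simp add: power2_sum power2_diff)
        finally show "norm ((cmod (z * u x - f x))\<^sup>2) \<le> norm (2 * (cmod z * B)\<^sup>2 + 2 * (cmod (f x))\<^sup>2)" by simp
      qed
    qed
    then show ?thesis using borel_measurable_integrable[OF zuf] by (simp add: square_integrable_def)
  qed
  then have "has_L2_laplacian S u (\<lambda>x. z * u x - f x)" using wl by (simp add: has_L2_laplacian_def)
  moreover have "has_laplacian S u (\<lambda>x. z * u x - f x)" if "continuous_on X f"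
    using wl cD_continuous[OF uD] that by (auto simp: has_laplacian_def intro!: continuous_intros)
  moreover have "has_normal_derivative S u s 0" if s: "s \<in> V0" for s
  proof -
    have "has_normal_derivative S u s (cE u (\<eta> s) + (\<integral>y. (z * u y - f y) * \<eta> s y \<partial>M) - 0 * \<eta> s s)"
      by (rule has_normal_derivative_weak[OF uD zuf s]) (use weak s eta_V0 in auto)
    then show ?thesis using cE[OF eta_cD[OF s]] u'(4)[OF s] by (simp add: Ezu)
  qed
  ultimately show "has_L2_laplacian S u (\<lambda>x. z * u x - f x) \<and>
        (continuous_on X f \<longrightarrow> has_laplacian S u (\<lambda>x. z * u x - f x)) \<and> (\<forall>q\<in>V0. has_normal_derivative S u q 0)"
    by blast
qed

end

lemma has_measure_laplacian_cong:
  assumes "\<And>x. x \<in> X \<Longrightarrow> u x = u' x" "has_measure_laplacian S u' \<nu>"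
  shows "has_measure_laplacian S u \<nu>"
proof -
  have "cE u v = cE u' v" for v by (rule cE_cong) (simp_all add: assms)
  moreover have "u \<in> cD"
    using assms by (intro cD_cong[of u' u]) (auto simp: has_measure_laplacian_def)
  ultimately show ?thesis using assms(2) by (simp add: has_measure_laplacian_def)
qed

lemma has_normal_derivative_cong:
  assumes "\<And>x. x \<in> X \<Longrightarrow> u x = u' x" "q \<in> V0" "has_normal_derivative S u' q d"
  shows "has_normal_derivative S u q d"
proof -
  have "(F (fixing_letter S q) ^^ m) y \<in> X" if "y \<in> V0" for m y
    using that fixing_letter(1)[OF assms(2)] by (induction m) auto
  then have "discrete_normal_derivative S u q = discrete_normal_derivative S u' q"
    using assms(1,2) by (auto simp: discrete_normal_derivative_def fun_eq_iff intro!: sum.cong)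
  then show ?thesis using assms(3) by (simp add: has_normal_derivative_def)
qed

end

theorem theorem4p2:
  fixes S :: "'a::euclidean_space pcf_data"
    and z :: complex
    and \<eta> :: "'a \<Rightarrow> 'a \<Rightarrow> complex"
    and C :: "'a \<Rightarrow> 'a \<Rightarrow> complex"
    and GN :: "'a \<Rightarrow> 'a \<Rightarrow> complex"
  assumes "self_similar_set S"
    and "post_critically_finite S"
    and "self_similar_measure S"
    and "self_similar_energy S"
    and "\<And>w. w \<in> words S \<Longrightarrow>
           \<not> dirichlet_eigenvalue S (complex_of_real (rword S w * muword S w) * z)"
    and "\<not> neumann_eigenvalue S z"
    and "\<And>p. p \<in> bdry S \<Longrightarrow> is_eta S z p (\<eta> p)"
    and "\<And>p q. p \<in> bdry S \<Longrightarrow> q \<in> bdry S \<Longrightarrow> C p q = C q p"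
    and "\<And>p x. p \<in> bdry S \<Longrightarrow> x \<in> bdry S \<Longrightarrow>
           (\<Sum>q\<in>bdry S. C p q * normal_derivative S (\<eta> q) x) = of_bool (p = x)"
    and "\<And>x y. GN x y = dirichlet_resolvent_kernel S z x y
           + (\<Sum>p\<in>bdry S. \<Sum>q\<in>bdry S. C p q * \<eta> p x * \<eta> q y)"
  shows "(\<forall>x\<in>fractal S. \<forall>y\<in>fractal S. GN x y = GN y x) \<and>
    (\<forall>x\<in>fractal S. \<exists>\<nu>. has_measure_laplacian S (GN x) \<nu> \<and>
       (\<forall>A\<in>sets borel. A \<subseteq> fractal S - bdry S \<longrightarrow>
          z * (LINT y:A|ssmeasure S. GN x y) - \<nu> A = indicator A x)) \<and>
    (\<forall>x\<in>fractal S - bdry S. \<forall>q\<in>bdry S. has_normal_derivative S (GN x) q 0) \<and>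
    neumann_resolvent_kernel S z GN"
proof -
  interpret pcf_energy S by standard fact+
  have adm: "admissible z" unfolding admissible_def using assms(5) by blast
  note hyps = adm assms(7-9)
  let ?N = "neumann z \<eta> C"
  have GN: "GN x y = ?N x y" if "x \<in> X" "y \<in> X" for x y
    using assms(10) that by (simp add: dirichlet_resolvent_kernel_eq_green[OF adm] neumann_def[OF hyps] correction_def[OF hyps])
  have "GN x y = GN y x" if "x \<in> X" "y \<in> X" for x y
    using that GN neumann_sym[OF hyps] by simp
  moreover have "\<exists>\<nu>. has_measure_laplacian S (GN x) \<nu> \<and>
      (\<forall>A\<in>sets borel. A \<subseteq> X - V0 \<longrightarrow> z * (LINT y:A|M. GN x y) - \<nu> A = indicator A x)" if x: "x \<in> X" for x
  proof (intro exI conjI ballI impI)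
    \<comment> \<open>The measure is written with \<open>neumann\<close>, for which the weak
      equation is known; \<open>GN x\<close> agrees with it on \<open>X\<close>.\<close>
    show "has_measure_laplacian S (GN x) (\<lambda>A. z * (LINT y:A|M. ?N x y) - indicator A x)"
      using GN x neumann_cD[OF hyps x] Ez_neumann[OF hyps x]
      by (intro has_measure_laplacian_cong[OF _ has_measure_laplacian_point_mass]) auto
    have "(LINT y:A|M. GN x y) = (LINT y:A|M. ?N x y)" for A
      unfolding set_lebesgue_integral_def using GN x by (intro Bochner_Integration.integral_cong) auto
    then show "z * (LINT y:A|M. GN x y) - (z * (LINT y:A|M. ?N x y) - indicator A x) = indicator A x" for A
      by simp
  qed
  moreover have "has_normal_derivative S (GN x) q 0" if "x \<in> X - V0" "q \<in> V0" for x q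
    by (rule has_normal_derivative_cong[OF GN that(2) neumann_normal_derivative[OF hyps that]]) (use that in auto)
  moreover have "neumann_resolvent_kernel S z GN"
    by (rule neumann_resolvent_kernel_cong[OF hyps GN])
  ultimately show ?thesis by blast
qed

end
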